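(* There is an algorithm that, given a chordal bipartite graph $G$, enumerates all minimal dominating sets of $G$ with polynomial delay and using polynomial space.
   Context: All graphs are finite and simple. A bipartite graph is chordal bipartite if it contains no induced cycle of length greater than four. A dominating set of $G$ is a set $D\subseteq V(G)$ such that every vertex of $G$ is in $D$ or adjacent to a vertex of $D$; it is minimal if it is inclusion-wise minimal with this property. An enumeration algorithm runs with polynomial delay if the time before the first output, between any two consecutive outputs, and after the last output are each bounded by a polynomial in the input size; every solution must be output exactly once. Polynomial space means the memory used is bounded by a polynomial in the input size. *)

theory Defs
  imports "Graph_Theory.Pair_Digraph" "HOL-Computational_Algebra.Polynomial"
begin

section \<open>Graphs\<close>

text \<open>
  Finite simple graphs are the locale \<^locale>\<open>pair_graph\<close>: finitely many vertices, and a symmetric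
  and irreflexive arc relation.
\<close>

definition bipartite :: "'a pair_pre_digraph \<Rightarrow> bool" where
  "bipartite G \<longleftrightarrow> (\<exists>A B. A \<union> B = pverts G \<and> A \<inter> B = {} \<and> parcs G \<subseteq> A \<times> B \<union> B \<times> A)"

text \<open>A cycle is given by the cyclic list of its vertices; induced means that it has no chords.\<close>

definition induced_cycle :: "'a pair_pre_digraph \<Rightarrow> 'a list \<Rightarrow> bool" where
  "induced_cycle G c \<longleftrightarrow>
     3 \<le> length c \<and> distinct c \<and> set c \<subseteq> pverts G \<and>
     (\<forall>i < length c. \<forall>j < length c.
        (c ! i, c ! j) \<in> parcs G \<longleftrightarrow>
          Suc i mod length c = j \<or> Suc j mod length c = i)"

definition chordal_bipartite :: "'a pair_pre_digraph \<Rightarrow> bool" where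
  "chordal_bipartite G \<longleftrightarrow>
     pair_graph G \<and> bipartite G \<and> \<not> (\<exists>c. induced_cycle G c \<and> 4 < length c)"

definition dominating_set :: "'a pair_pre_digraph \<Rightarrow> 'a set \<Rightarrow> bool" where
  "dominating_set G D \<longleftrightarrow>
     D \<subseteq> pverts G \<and> (\<forall>v \<in> pverts G. v \<in> D \<or> (\<exists>u \<in> D. (u, v) \<in> parcs G))"

definition minimal_dominating_set :: "'a pair_pre_digraph \<Rightarrow> 'a set \<Rightarrow> bool" where
  "minimal_dominating_set G D \<longleftrightarrow>
     dominating_set G D \<and> \<not> (\<exists>D'. D' \<subset> D \<and> dominating_set G D')"


section \<open>Model of computation\<close>

text \<open>
  Algorithms are programs of the language WHILE of Jones (Computability and Complexity, 1997),
  extended by a write-only output instruction. There are finitely many variables, each holding a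
  binary tree; the only operations are the empty tree, pairing, the two projections and the test for
  being the empty tree. There is no test for equality of trees, so that every instruction takes
  constant time on a pointer machine that shares subtrees. Time is the number of instructions and
  tests executed. Memory is the total number of cons cells in the variables of the program,
  counted without sharing. A program that runs in polynomial memory in this sense is simulated step
  by step on a Turing machine with a polynomial overhead in time and space, and conversely.
\<close>

datatype val = Leaf | Pair val val

datatype expr = Var nat | Empty | Cons expr expr | Hd expr | Tl expr

datatype prog =
    Assign nat expr
  | Output expr
  | Seq prog prog
  | If expr prog prog
  | While expr prog

type_synonym store = "nat \<Rightarrow> val"

fun left :: "val \<Rightarrow> val" where
  "left Leaf = Leaf"
| "left (Pair a b) = a"

fun right :: "val \<Rightarrow> val" where
  "right Leaf = Leaf"
| "right (Pair a b) = b"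

fun evaluate :: "expr \<Rightarrow> store \<Rightarrow> val" where
  "evaluate (Var x) s = s x"
| "evaluate Empty s = Leaf"
| "evaluate (Cons e f) s = Pair (evaluate e s) (evaluate f s)"
| "evaluate (Hd e) s = left (evaluate e s)"
| "evaluate (Tl e) s = right (evaluate e s)"

text \<open>
  A terminating run is recorded as its trace: one entry per instruction or test executed, consisting
  of the store after this step and the value output in this step, if any.
\<close>

type_synonym trace = "(store \<times> val option) list"

inductive exec :: "prog \<Rightarrow> store \<Rightarrow> trace \<Rightarrow> store \<Rightarrow> bool" where
  Assign: "s' = s(x := evaluate e s) \<Longrightarrow> exec (Assign x e) s [(s', None)] s'"
| Output: "exec (Output e) s [(s, Some (evaluate e s))] s"
| Seq: "exec P s t s' \<Longrightarrow> exec Q s' t' s'' \<Longrightarrow> exec (Seq P Q) s (t @ t') s''"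
| If_true: "evaluate e s \<noteq> Leaf \<Longrightarrow> exec P s t s' \<Longrightarrow> exec (If e P Q) s ((s, None) # t) s'"
| If_false: "evaluate e s = Leaf \<Longrightarrow> exec Q s t s' \<Longrightarrow> exec (If e P Q) s ((s, None) # t) s'"
| While_false: "evaluate e s = Leaf \<Longrightarrow> exec (While e P) s [(s, None)] s"
| While_true: "evaluate e s \<noteq> Leaf \<Longrightarrow> exec P s t s' \<Longrightarrow> exec (While e P) s' t' s'' \<Longrightarrow>
    exec (While e P) s ((s, None) # t @ t') s''"

inductive_cases AssignE: "exec (Assign x e) s t s'"
inductive_cases OutputE: "exec (Output e) s t s'"
inductive_cases SeqE: "exec (Seq P Q) s t s'"
inductive_cases IfE: "exec (If e P Q) s t s'"
inductive_cases WhileE: "exec (While e P) s t s'"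

lemma exec_deterministic:
  "exec P s t s' \<Longrightarrow> exec P s u s'' \<Longrightarrow> u = t \<and> s'' = s'"
proof (induction arbitrary: u s'' rule: exec.induct)
  case Assign
  then show ?case by (auto elim: AssignE)
next
  case Output
  then show ?case by (auto elim: OutputE)
next
  case Seq
  from Seq.prems show ?case by (rule SeqE) (use Seq.IH in blast)
next
  case If_true
  from If_true.prems show ?case by (rule IfE) (use If_true.IH If_true.hyps in blast)+
next
  case If_false
  from If_false.prems show ?case by (rule IfE) (use If_false.IH If_false.hyps in blast)+
next
  case While_false
  from While_false.prems show ?case by (rule WhileE) (use While_false.hyps in blast)+
next
  case While_true
  from While_true.prems show ?case by (rule WhileE) (use While_true.IH While_true.hyps in blast)+
qed

fun expr_vars :: "expr \<Rightarrow> nat set" where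
  "expr_vars (Var x) = {x}"
| "expr_vars Empty = {}"
| "expr_vars (Cons e f) = expr_vars e \<union> expr_vars f"
| "expr_vars (Hd e) = expr_vars e"
| "expr_vars (Tl e) = expr_vars e"

fun vars :: "prog \<Rightarrow> nat set" where
  "vars (Assign x e) = insert x (expr_vars e)"
| "vars (Output e) = expr_vars e"
| "vars (Seq P Q) = vars P \<union> vars Q"
| "vars (If e P Q) = expr_vars e \<union> vars P \<union> vars Q"
| "vars (While e P) = expr_vars e \<union> vars P"

text \<open>The function \<^const>\<open>size\<close> on \<^typ>\<open>val\<close> counts the occurrences of \<^const>\<open>Pair\<close>.\<close>

definition memory :: "prog \<Rightarrow> store \<Rightarrow> nat" where
  "memory P s = (\<Sum>x \<in> vars P. size (s x))"

definition initial :: "val \<Rightarrow> store" where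
  "initial input = (\<lambda>x. if x = 0 then input else Leaf)"

definition outputs :: "trace \<Rightarrow> val list" where
  "outputs t = List.map_filter snd t"

text \<open>
  Quantifying over all contiguous blocks of the trace without output covers the time before the
  first output, between consecutive outputs, after the last one, and the total time if there is
  no output.
\<close>

definition delay_at_most :: "nat \<Rightarrow> trace \<Rightarrow> bool" where
  "delay_at_most d t \<longleftrightarrow>
     (\<forall>t1 block t2. t = t1 @ block @ t2 \<and> outputs block = [] \<longrightarrow> length block \<le> d)"

definition space_at_most :: "nat \<Rightarrow> prog \<Rightarrow> trace \<Rightarrow> bool" where
  "space_at_most m P t \<longleftrightarrow> (\<forall>(s, _) \<in> set t. memory P s \<le> m)"

text \<open>
  An enumeration problem is given by its set of inputs and the set of solutions of each input.
\<close>

definition enumerates_poly_delay_poly_space :: "prog \<Rightarrow> (val \<times> val set) set \<Rightarrow> bool" where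
  "enumerates_poly_delay_poly_space P problem \<longleftrightarrow>
     (\<exists>delay space :: nat poly. \<forall>(input, solutions) \<in> problem.
        \<exists>t s. exec P (initial input) t s \<and>
          distinct (outputs t) \<and> set (outputs t) = solutions \<and>
          delay_at_most (poly delay (size input)) t \<and>
          space_at_most (poly space (size input)) P t)"


section \<open>Encoding of graphs and vertex sets\<close>

text \<open>
  With respect to a listing of the vertices, a graph is encoded by its adjacency matrix (a list of
  rows) and a set of vertices by its characteristic vector. On sets of listed vertices the latter
  encoding is injective.
\<close>

definition bool_val :: "bool \<Rightarrow> val" where
  "bool_val b = (if b then Pair Leaf Leaf else Leaf)"

definition list_val :: "val list \<Rightarrow> val" where
  "list_val xs = foldr Pair xs Leaf"

definition set_val :: "'a list \<Rightarrow> 'a set \<Rightarrow> val" where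
  "set_val vs D = list_val (map (\<lambda>v. bool_val (v \<in> D)) vs)"

definition graph_val :: "'a list \<Rightarrow> 'a pair_pre_digraph \<Rightarrow> val" where
  "graph_val vs G = list_val (map (\<lambda>u. set_val vs {v. (u, v) \<in> parcs G}) vs)"

text \<open>
  The vertices are natural numbers so that one fixed program has to handle all finite graphs;
  as they may be listed in any order, no special vertex set is assumed.
\<close>

definition chordal_bipartite_domination :: "(val \<times> val set) set" where
  "chordal_bipartite_domination =
     {(graph_val vs G, set_val vs ` {D. minimal_dominating_set G D}) | vs (G :: nat pair_pre_digraph).
        chordal_bipartite G \<and> distinct vs \<and> set vs = pverts G}"

end

(*
  Write N[u] for closed neighbourhoods, and H(S) for the hypergraph of all N[u] contained in S; the
  minimal dominating sets are the minimal transversals of H(V). A doubly lexical ordering of the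
  bipartite adjacency matrix shows that every nonempty set S' of vertices contains a vertex v such that
  the neighbourhoods N(u) of those neighbours u of v with N[u] contained in S' form a chain. Removing such
  vertices one by one gives sets {} = S_0, S_1, ..., S_n = V. Greedily discarding redundant vertices maps
  each minimal transversal D of H(S_{i+1}) to a minimal transversal T of H(S_i), its parent. This is a
  tree in which every node above the last level has a child, since T or T + v is one. All edges that are
  new in H(S_{i+1}) contain v, and the chain condition leaves only polynomially many candidates for
  D - T. Hence a depth-first search with a stack has polynomial delay and space.
*)

theory Submission
  imports Defs
begin

section \<open>Polynomial-time functions\<close>

text \<open>The chain condition has to compare open neighbourhoods: two neighbours of v lie on the
  same side of the bipartition, so neither belongs to the closed neighbourhood of the other. This is
  the obstacle to bounding the candidates, because D - T can be large: many new edges may be met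
  only in their own centres. These centres are forced, however. Guess at most one vertex Z that
  serves all new edges met in a neighbour of their centre, and at most one vertex W for the edge of
  v; the remaining vertices are then determined. For n vertices this gives (n + 1)^2 guesses. Each
  is checked for minimality and for having T as its parent, so a set occurs below one node only and
  no earlier output has to be remembered. All leaves have depth n, so the search never enters a
  barren subtree. The programs for single steps are not written out: they come from closure
  properties of a class of polynomial-time functions. Only the search loop, which has to produce
  output, is an explicit program.\<close>

lemma poly_nat_mono: "m \<le> n \<Longrightarrow> poly p m \<le> poly p (n :: nat)"
  by (induction p) (auto intro!: add_mono mult_mono)

lemma outputs_append: "outputs (t @ u) = outputs t @ outputs u"
  by (simp add: outputs_def List.map_filter_def)

lemma outputs_Nil [simp]: "outputs [] = []"
  by (simp add: outputs_def List.map_filter_def)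

lemma outputs_Cons: "outputs (x # t) = (case snd x of None \<Rightarrow> [] | Some v \<Rightarrow> [v]) @ outputs t"
  by (simp add: outputs_def List.map_filter_def split: option.split)

lemmas outputs_simps = outputs_append outputs_Cons

section \<open>Costs of silent programs on a single tree\<close>

definition ev :: "expr \<Rightarrow> val \<Rightarrow> val" where
  "ev e a = evaluate e (\<lambda>_. a)"

lemma ev_simps [simp]:
  "ev (Var x) a = a" "ev Empty a = Leaf" "ev (Cons e f) a = Pair (ev e a) (ev f a)"
  "ev (Hd e) a = left (ev e a)" "ev (Tl e) a = right (ev e a)"
  by (simp_all add: ev_def)

lemma evaluate_eq_ev: "expr_vars e \<subseteq> {0} \<Longrightarrow> evaluate e s = ev e (s 0)"
  by (induction e) auto

lemma size_left_le: "size (left a) \<le> size a" and size_right_le: "size (right a) \<le> size a"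
  by (cases a; simp)+

text \<open>A variable may occur several times, so sizes can be multiplied, but by a factor that
  depends on the expression alone. Assignments therefore have polynomial cost.\<close>

lemma size_ev_le: "\<exists>c. \<forall>a. size (ev e a) \<le> c * Suc (size a)"
proof (induction e)
  case (Var x)
  show ?case by (rule exI[of _ 1]) simp
next
  case (Cons e f)
  then obtain c d where "\<forall>a. size (ev e a) \<le> c * Suc (size a)" "\<forall>a. size (ev f a) \<le> d * Suc (size a)"
    by blast
  then have "size (ev (Cons e f) a) \<le> (c + d + 1) * Suc (size a)" for a
    using add_mono[of "size (ev e a)" "c * Suc (size a)" "size (ev f a)" "d * Suc (size a)"]
    by (simp add: algebra_simps)
  then show ?case by blast
next
  case (Hd e)
  then show ?case using size_left_le order_trans by (metis ev_simps(4))
next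
  case (Tl e)
  then show ?case using size_right_le order_trans by (metis ev_simps(5))
qed simp

text \<open>
  Programs are built over the single variable \<^term>\<open>0 :: nat\<close>, so that a store amounts to one tree
  and the memory is its size; intermediate results are kept in components of that tree.
\<close>

definition runs :: "prog \<Rightarrow> val \<Rightarrow> val \<Rightarrow> nat \<Rightarrow> bool" where
  "runs P a b k \<longleftrightarrow> size b \<le> k \<and>
     (\<forall>s. s 0 = a \<longrightarrow> (\<exists>t s'. exec P s t s' \<and> s' 0 = b \<and> outputs t = [] \<and> length t \<le> k \<and>
        (\<forall>(r, _) \<in> set t. size (r 0) \<le> k)))"

lemma runsE:
  assumes "runs P (s 0) b k"
  obtains t s' where "exec P s t s'" "s' 0 = b" "outputs t = []" "length t \<le> k"
    "\<And>r v. (r, v) \<in> set t \<Longrightarrow> size (r 0) \<le> k"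
  using assms unfolding runs_def by blast

lemma runs_size: "runs P a b k \<Longrightarrow> size b \<le> k"
  by (simp add: runs_def)

lemma runsI:
  assumes "size b \<le> k"
    and "\<And>s. s 0 = a \<Longrightarrow> \<exists>t s'. exec P s t s' \<and> s' 0 = b \<and> outputs t = [] \<and> length t \<le> k \<and>
        (\<forall>(r, _) \<in> set t. size (r 0) \<le> k)"
  shows "runs P a b k"
  using assms by (simp add: runs_def)

lemma runs_mono: "runs P a b k \<Longrightarrow> k \<le> l \<Longrightarrow> runs P a b l"
proof (rule runsI)
  fix s :: store
  assume "runs P a b k" "k \<le> l" "s 0 = a"
  then obtain t s' where 1: "exec P s t s'" "s' 0 = b" "outputs t = []" "length t \<le> k"
    "\<And>r v. (r, v) \<in> set t \<Longrightarrow> size (r 0) \<le> k"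
    using runsE by metis
  have "size (r 0) \<le> l" if "(r, v) \<in> set t" for r v
    using 1(5)[OF that] \<open>k \<le> l\<close> by simp
  with 1 \<open>k \<le> l\<close> show "\<exists>t s'. exec P s t s' \<and> s' 0 = b \<and> outputs t = [] \<and> length t \<le> l \<and>
      (\<forall>(r, _) \<in> set t. size (r 0) \<le> l)"
    by (intro exI[of _ t] exI[of _ s']) auto
qed (auto dest: runs_size)

lemma runs_Assign:
  assumes "expr_vars e \<subseteq> {0}" "b = ev e a"
  shows "runs (Assign 0 e) a b (Suc (size b))"
proof (rule runsI)
  fix s :: store
  assume "s 0 = a"
  then have "evaluate e s = b" using assms evaluate_eq_ev by simp
  then show "\<exists>t s'. exec (Assign 0 e) s t s' \<and> s' 0 = b \<and> outputs t = [] \<and>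
      length t \<le> Suc (size b) \<and> (\<forall>(r, _) \<in> set t. size (r 0) \<le> Suc (size b))"
    by (intro exI[of _ "[(s(0 := b), None)]"] exI[of _ "s(0 := b)"])
      (auto intro: exec.Assign simp: outputs_simps)
qed simp

lemma runs_Seq:
  assumes "runs P a b k" "runs Q b c l"
  shows "runs (Seq P Q) a c (k + l)"
proof (rule runsI)
  show "size c \<le> k + l" using runs_size[OF assms(2)] by simp
  fix s :: store
  assume s: "s 0 = a"
  obtain t s' where 1: "exec P s t s'" "s' 0 = b" "outputs t = []" "length t \<le> k"
    "\<And>r v. (r, v) \<in> set t \<Longrightarrow> size (r 0) \<le> k"
    using runsE assms(1) s by metis
  obtain u s'' where 2: "exec Q s' u s''" "s'' 0 = c" "outputs u = []" "length u \<le> l"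
    "\<And>r v. (r, v) \<in> set u \<Longrightarrow> size (r 0) \<le> l"
    using runsE assms(2) 1(2) by metis
  show "\<exists>t s'. exec (Seq P Q) s t s' \<and> s' 0 = c \<and> outputs t = [] \<and> length t \<le> k + l \<and>
        (\<forall>(r, _) \<in> set t. size (r 0) \<le> k + l)"
    using 1 2
    by (intro exI[of _ "t @ u"] exI[of _ s''])
        (auto simp: outputs_simps intro: exec.Seq trans_le_add1 trans_le_add2)
qed

text \<open>The trace entry of the test holds the old store: \<open>size a\<close> covers its memory
  and \<open>Suc\<close> its time.\<close>

lemma runs_If:
  assumes "expr_vars e \<subseteq> {0}" "runs (if ev e a \<noteq> Leaf then P else Q) a b k"
  shows "runs (If e P Q) a b (Suc (k + size a))"
proof (rule runsI)
  show "size b \<le> Suc (k + size a)" using runs_size[OF assms(2)] by simp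
  fix s :: store
  assume s: "s 0 = a"
  obtain t s' where 1: "exec (if ev e a \<noteq> Leaf then P else Q) s t s'" "s' 0 = b" "outputs t = []"
    "length t \<le> k" "\<And>r v. (r, v) \<in> set t \<Longrightarrow> size (r 0) \<le> k"
    using runsE assms(2) s by metis
  have "exec (If e P Q) s ((s, None) # t) s'"
    using 1(1) s assms(1) by (auto simp: evaluate_eq_ev intro: exec.If_true exec.If_false split: if_splits)
  with 1 s show "\<exists>t s'. exec (If e P Q) s t s' \<and> s' 0 = b \<and> outputs t = [] \<and>
      length t \<le> Suc (k + size a) \<and> (\<forall>(r, _) \<in> set t. size (r 0) \<le> Suc (k + size a))"
    by (intro exI[of _ "(s, None) # t"] exI[of _ s']) (auto simp: outputs_simps intro: le_SucI trans_le_add1)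
qed

text \<open>\<open>S i\<close> is the tree after i rounds. There are n + 1 tests and n rounds of at
  most k steps.\<close>

lemma runs_While:
  assumes "expr_vars e \<subseteq> {0}"
    and "\<And>i. i < n \<Longrightarrow> ev e (S i) \<noteq> Leaf \<and> runs P (S i) (S (Suc i)) k"
    and "ev e (S n) = Leaf" and "\<And>i. i \<le> n \<Longrightarrow> size (S i) \<le> k"
  shows "runs (While e P) (S 0) (S n) (Suc n * Suc k)"
  using assms(2-)
proof (induction n arbitrary: S)
  case 0
  show ?case
  proof (rule runsI)
    fix s :: store
    assume s: "s 0 = S 0"
    then have "exec (While e P) s [(s, None)] s"
      using assms(1) 0 by (auto simp: evaluate_eq_ev intro: exec.While_false)
    then show "\<exists>t s'. exec (While e P) s t s' \<and> s' 0 = S 0 \<and> outputs t = [] \<and>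
        length t \<le> Suc 0 * Suc k \<and> (\<forall>(r, _) \<in> set t. size (r 0) \<le> Suc 0 * Suc k)"
      using s 0(3)[of 0]
      by (intro exI[of _ "[(s, None)]"] exI[of _ s]) (auto simp: outputs_simps)
  qed (use 0(3)[of 0] in simp)
next
  case (Suc n)
  have IH: "runs (While e P) (S 1) (S (Suc n)) (Suc n * Suc k)"
    using Suc.IH[of "\<lambda>i. S (Suc i)"] Suc.prems by simp
  show ?case
  proof (rule runsI)
    show "size (S (Suc n)) \<le> Suc (Suc n) * Suc k"
      using runs_size[OF IH] by (rule order_trans) simp
    fix s :: store
    assume s: "s 0 = S 0"
    have step: "runs P (S 0) (S 1) k" and test: "evaluate e s \<noteq> Leaf"
      using Suc.prems(1)[of 0] s assms(1) by (auto simp: evaluate_eq_ev)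
    obtain t s' where 1: "exec P s t s'" "s' 0 = S 1" "outputs t = []" "length t \<le> k"
      "\<And>r v. (r, v) \<in> set t \<Longrightarrow> size (r 0) \<le> k"
      using runsE step s by metis
    obtain u s'' where 2: "exec (While e P) s' u s''" "s'' 0 = S (Suc n)" "outputs u = []"
      "length u \<le> Suc n * Suc k" "\<And>r v. (r, v) \<in> set u \<Longrightarrow> size (r 0) \<le> Suc n * Suc k"
      using runsE IH 1(2) by metis
    have "size (s 0) \<le> k" using Suc.prems(3)[of 0] s by simp
    then show "\<exists>t s'. exec (While e P) s t s' \<and> s' 0 = S (Suc n) \<and> outputs t = [] \<and>
        length t \<le> Suc (Suc n) * Suc k \<and> (\<forall>(r, _) \<in> set t. size (r 0) \<le> Suc (Suc n) * Suc k)"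
      using 1 2 test
      by (intro exI[of _ "(s, None) # t @ u"] exI[of _ s''])
        (auto simp: outputs_simps intro: exec.While_true trans_le_add1 trans_le_add2 dest!: 1(5) 2(5))
  qed
qed

section \<open>Running a program on the left component of a pair\<close>

fun left_expr :: "expr \<Rightarrow> expr" where
  "left_expr (Var x) = Hd (Var x)"
| "left_expr Empty = Empty"
| "left_expr (Cons e f) = Cons (left_expr e) (left_expr f)"
| "left_expr (Hd e) = Hd (left_expr e)"
| "left_expr (Tl e) = Tl (left_expr e)"

text \<open>A single variable offers no place to save a value, so the right component of its tree
  takes that role; every assignment has to restore it.\<close>

fun left_prog :: "prog \<Rightarrow> prog" where
  "left_prog (Assign x e) = Assign x (Cons (left_expr e) (Tl (Var x)))"
| "left_prog (Output e) = Output (left_expr e)"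
| "left_prog (Seq P Q) = Seq (left_prog P) (left_prog Q)"
| "left_prog (If e P Q) = If (left_expr e) (left_prog P) (left_prog Q)"
| "left_prog (While e P) = While (left_expr e) (left_prog P)"

lemma expr_vars_left [simp]: "expr_vars (left_expr e) = expr_vars e"
  by (induction e) auto

lemma vars_left [simp]: "vars (left_prog P) = vars P"
  by (induction P) auto

lemma evaluate_left:
  "expr_vars e \<subseteq> {0} \<Longrightarrow> r 0 = Pair (s 0) c \<Longrightarrow> evaluate (left_expr e) r = evaluate e s"
  by (induction e) auto

lemma exec_left:
  assumes "exec P s t s'" "vars P \<subseteq> {0}" "r 0 = Pair (s 0) c"
  shows "\<exists>u r'. exec (left_prog P) r u r' \<and> r' 0 = Pair (s' 0) c \<and>
    list_all2 (\<lambda>x y. fst y 0 = Pair (fst x 0) c \<and> snd y = snd x) t u"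
  using assms
proof (induction arbitrary: r rule: exec.induct)
  case (Assign s' s x e)
  then have "evaluate (left_expr e) r = evaluate e s" by (intro evaluate_left) auto
  then have "exec (left_prog (Assign x e)) r [(r(x := Pair (evaluate e s) c), None)] (r(x := Pair (evaluate e s) c))"
    using Assign by (auto intro!: exec.Assign)
  then show ?case using Assign by fastforce
next
  case (Output e s)
  then have "evaluate (left_expr e) r = evaluate e s" by (intro evaluate_left) auto
  then have "exec (left_prog (Output e)) r [(r, Some (evaluate e s))] r"
    using exec.Output[of "left_expr e" r] by auto
  then show ?case using Output by fastforce
next
  case (Seq P s t s' Q t' s'')
  from Seq.IH(1)[of r] Seq.prems obtain u r' where 1: "exec (left_prog P) r u r'" "r' 0 = Pair (s' 0) c"
    "list_all2 (\<lambda>x y. fst y 0 = Pair (fst x 0) c \<and> snd y = snd x) t u" by auto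
  from Seq.IH(2)[of r'] Seq.prems 1(2) obtain u' r'' where 2: "exec (left_prog Q) r' u' r''"
    "r'' 0 = Pair (s'' 0) c"
    "list_all2 (\<lambda>x y. fst y 0 = Pair (fst x 0) c \<and> snd y = snd x) t' u'" by auto
  show ?case
    using exec.Seq[OF 1(1) 2(1)] 2(2) list_all2_appendI[OF 1(3) 2(3)] by auto
next
  case (If_true e s P t s' Q)
  from If_true.IH[of r] If_true.prems obtain u r' where 1: "exec (left_prog P) r u r'" "r' 0 = Pair (s' 0) c"
    "list_all2 (\<lambda>x y. fst y 0 = Pair (fst x 0) c \<and> snd y = snd x) t u" by auto
  have "evaluate (left_expr e) r = evaluate e s" using If_true.prems by (intro evaluate_left) auto
  then show ?case
    using exec.If_true[OF _ 1(1), of "left_expr e" "left_prog Q"] If_true 1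
    by (intro exI[of _ "(r, None) # u"] exI[of _ r']) auto
next
  case (If_false e s Q t s' P)
  from If_false.IH[of r] If_false.prems obtain u r' where 1: "exec (left_prog Q) r u r'" "r' 0 = Pair (s' 0) c"
    "list_all2 (\<lambda>x y. fst y 0 = Pair (fst x 0) c \<and> snd y = snd x) t u" by auto
  have "evaluate (left_expr e) r = evaluate e s" using If_false.prems by (intro evaluate_left) auto
  then show ?case
    using exec.If_false[OF _ 1(1), of "left_expr e" "left_prog P"] If_false 1
    by (intro exI[of _ "(r, None) # u"] exI[of _ r']) auto
next
  case (While_false e s P)
  have "evaluate (left_expr e) r = evaluate e s" using While_false.prems by (intro evaluate_left) auto
  then show ?case
    using exec.While_false[of "left_expr e" r "left_prog P"] While_false
    by (intro exI[of _ "[(r, None)]"] exI[of _ r]) auto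
next
  case (While_true e s P t s' t' s'')
  from While_true.IH(1)[of r] While_true.prems obtain u r' where 1: "exec (left_prog P) r u r'" "r' 0 = Pair (s' 0) c"
    "list_all2 (\<lambda>x y. fst y 0 = Pair (fst x 0) c \<and> snd y = snd x) t u" by auto
  from While_true.IH(2)[of r'] While_true.prems 1(2) obtain u' r'' where 2:
    "exec (left_prog (While e P)) r' u' r''" "r'' 0 = Pair (s'' 0) c"
    "list_all2 (\<lambda>x y. fst y 0 = Pair (fst x 0) c \<and> snd y = snd x) t' u'" by auto
  have "evaluate (left_expr e) r = evaluate e s" using While_true.prems by (intro evaluate_left) auto
  then show ?case
    using exec.While_true[OF _ 1(1), of "left_expr e" u' r''] While_true.hyps(1) While_true.prems 1 2
    by (intro exI[of _ "(r, None) # u @ u'"] exI[of _ r'']) (auto intro: list_all2_appendI)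
qed

lemma runs_left:
  assumes "runs P a b k" "vars P \<subseteq> {0}"
  shows "runs (left_prog P) (Pair a c) (Pair b c) (Suc (k + size c))"
proof (rule runsI)
  show "size (Pair b c) \<le> Suc (k + size c)" using runs_size[OF assms(1)] by simp
  fix r :: store
  assume r: "r 0 = Pair a c"
  obtain t s' where 1: "exec P (r(0 := a)) t s'" "s' 0 = b" "outputs t = []" "length t \<le> k"
    "\<And>r v. (r, v) \<in> set t \<Longrightarrow> size (r 0) \<le> k"
    using runsE[of P "r(0 := a)" b k] assms(1) by (metis fun_upd_same)
  obtain u r' where 2: "exec (left_prog P) r u r'" "r' 0 = Pair (s' 0) c"
    and 3: "list_all2 (\<lambda>x y. fst y 0 = Pair (fst x 0) c \<and> snd y = snd x) t u"
    using exec_left[OF 1(1) assms(2), of r c] r by auto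
  have "outputs u = outputs t"
    using 3 by (induction rule: list_all2_induct) (auto simp: outputs_simps)
  moreover have "\<forall>(q, _) \<in> set u. size (q 0) \<le> Suc (k + size c)"
  proof safe
    fix q v
    assume "(q, v) \<in> set u"
    then obtain i where "i < length u" "u ! i = (q, v)" by (auto simp: in_set_conv_nth)
    with 3 have "t ! i \<in> set t" "q 0 = Pair (fst (t ! i) 0) c"
      by (auto simp: list_all2_conv_all_nth)
    then show "size (q 0) \<le> Suc (k + size c)" using 1(5)[of "fst (t ! i)" "snd (t ! i)"] by simp
  qed
  ultimately show "\<exists>t s'. exec (left_prog P) r t s' \<and> s' 0 = Pair b c \<and> outputs t = [] \<and>
      length t \<le> Suc (k + size c) \<and> (\<forall>(q, _) \<in> set t. size (q 0) \<le> Suc (k + size c))"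
    using 1 2 list_all2_lengthD[OF 3] by (intro exI[of _ u] exI[of _ r']) auto
qed

section \<open>Encodings of values as trees\<close>

class enc = fixes enc :: "'a \<Rightarrow> val"

instantiation bool :: enc
begin
definition enc_bool :: "bool \<Rightarrow> val" where "enc_bool = bool_val"
instance ..
end

instantiation list :: (enc) enc
begin
definition enc_list :: "'a list \<Rightarrow> val" where "enc_list xs = list_val (map enc xs)"
instance ..
end

instantiation prod :: (enc, enc) enc
begin
definition enc_prod :: "'a \<times> 'b \<Rightarrow> val" where "enc_prod p = Pair (enc (fst p)) (enc (snd p))"
instance ..
end

text \<open>A tree is read relative to a type: \<open>[]\<close> and \<open>False\<close> are both
  \<open>Leaf\<close>. Booleans and lists are encoded as in the adjacency matrix of the input, so
  the input is itself an encoded value.\<close>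

lemma enc_simps [simp]:
  "enc True = Pair Leaf Leaf" "enc False = Leaf"
  "enc [] = Leaf" "enc (x # xs) = Pair (enc x) (enc xs)"
  "enc (a, b) = Pair (enc a) (enc b)"
  by (simp_all add: enc_bool_def enc_list_def enc_prod_def bool_val_def list_val_def)

lemma enc_bool_eq_Leaf [simp]: "enc b = Leaf \<longleftrightarrow> \<not> b"
  by (cases b) auto

lemma enc_list_eq_Leaf [simp]: "enc (xs :: 'a::enc list) = Leaf \<longleftrightarrow> xs = []"
  by (cases xs) auto

lemma size_enc_list: "size (enc xs) = length xs + (\<Sum>x\<leftarrow>xs. size (enc x))"
  by (induction xs) auto

lemma size_enc_elem: "x \<in> set xs \<Longrightarrow> size (enc x) < size (enc xs)"
  by (induction xs) auto

lemma length_le_size_enc: "length xs \<le> size (enc xs)"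
  by (simp add: size_enc_list)

lemma size_enc_list_le:
  assumes "length xs \<le> m" "\<And>x. x \<in> set xs \<Longrightarrow> size (enc x) \<le> k"
  shows "size (enc xs) \<le> m * Suc k"
proof -
  have "(\<Sum>x\<leftarrow>xs. size (enc x)) \<le> length xs * k"
    using assms(2) by (induction xs) (auto simp: add_mono)
  moreover have "length xs + length xs * k \<le> m * Suc k"
    using mult_le_mono1[OF assms(1), of "Suc k"] by simp
  ultimately show ?thesis by (simp add: size_enc_list)
qed

section \<open>Functions computable in polynomial time\<close>

definition poly_bounded :: "('a::enc \<Rightarrow> nat) \<Rightarrow> bool" where
  "poly_bounded g \<longleftrightarrow> (\<exists>p. \<forall>x. g x \<le> poly p (size (enc x)))"

text \<open>The cost in \<open>runs\<close> also bounds the final tree, so the result of such a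
  function has polynomial size.\<close>

definition polytime :: "('a::enc \<Rightarrow> 'b::enc) \<Rightarrow> bool" where
  "polytime f \<longleftrightarrow> (\<exists>P k. vars P \<subseteq> {0} \<and> poly_bounded k \<and> (\<forall>x. runs P (enc x) (enc (f x)) (k x)))"

lemma polytimeE:
  assumes "polytime f"
  obtains P k where "vars P \<subseteq> {0}" "poly_bounded k" "\<And>x. runs P (enc x) (enc (f x)) (k x)"
  using assms unfolding polytime_def by blast

lemma polytimeI:
  assumes "vars P \<subseteq> {0}" "poly_bounded k" "\<And>x. runs P (enc x) (enc (f x)) (k x)"
  shows "polytime f"
  using assms unfolding polytime_def by blast

lemma poly_bounded_le: "poly_bounded h \<Longrightarrow> (\<And>x. g x \<le> h x) \<Longrightarrow> poly_bounded g"
  unfolding poly_bounded_def by (meson order_trans)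

lemma poly_bounded_const: "poly_bounded (\<lambda>_. c)"
  unfolding poly_bounded_def by (intro exI[of _ "[:c:]"]) simp

lemma poly_bounded_add:
  assumes "poly_bounded g" "poly_bounded h"
  shows "poly_bounded (\<lambda>x. g x + h x)"
proof -
  obtain p q where "\<forall>x. g x \<le> poly p (size (enc x))" "\<forall>x. h x \<le> poly q (size (enc x))"
    using assms unfolding poly_bounded_def by blast
  then show ?thesis unfolding poly_bounded_def by (intro exI[of _ "p + q"]) (simp add: add_mono)
qed

lemma poly_bounded_mult:
  assumes "poly_bounded g" "poly_bounded h"
  shows "poly_bounded (\<lambda>x. g x * h x)"
proof -
  obtain p q where "\<forall>x. g x \<le> poly p (size (enc x))" "\<forall>x. h x \<le> poly q (size (enc x))"
    using assms unfolding poly_bounded_def by blast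
  then show ?thesis unfolding poly_bounded_def by (intro exI[of _ "p * q"]) (simp add: mult_le_mono)
qed

lemma poly_bounded_Suc: "poly_bounded g \<Longrightarrow> poly_bounded (\<lambda>x. Suc (g x))"
  using poly_bounded_add[OF _ poly_bounded_const[of 1]] by force

lemma poly_bounded_size_enc: "poly_bounded (\<lambda>x. size (enc x))"
  unfolding poly_bounded_def by (intro exI[of _ "[:0, 1:]"]) simp

text \<open>Polynomials over the naturals are monotone, so bounds can be composed.\<close>

lemma poly_bounded_subst:
  assumes "poly_bounded g" "poly_bounded (\<lambda>x. size (enc (f x)))"
  shows "poly_bounded (\<lambda>x. g (f x))"
proof -
  obtain p q where p: "\<forall>x. g x \<le> poly p (size (enc x))" and q: "\<forall>x. size (enc (f x)) \<le> poly q (size (enc x))"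
    using assms unfolding poly_bounded_def by blast
  have "g (f x) \<le> poly (pcompose p q) (size (enc x))" for x
    using order_trans[OF p[rule_format] poly_nat_mono[OF q[rule_format]]] by (simp add: poly_pcompose)
  then show ?thesis unfolding poly_bounded_def by blast
qed

lemma poly_bounded_size:
  assumes "polytime f"
  shows "poly_bounded (\<lambda>x. size (enc (f x)))"
  using assms by (rule polytimeE) (blast intro: poly_bounded_le runs_size)

lemmas poly_bounded_intros = poly_bounded_const poly_bounded_add poly_bounded_mult poly_bounded_Suc
    poly_bounded_size_enc

lemma polytime_expr:
  assumes "expr_vars e \<subseteq> {0}" "\<And>x. ev e (enc x) = enc (f x)"
  shows "polytime f"
proof -
  obtain c where c: "\<forall>a. size (ev e a) \<le> c * Suc (size a)" using size_ev_le by blast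
  show ?thesis
  proof (rule polytimeI[of "Assign 0 e"])
    show "poly_bounded (\<lambda>x. Suc (size (enc (f x))))"
      by (rule poly_bounded_le[of "\<lambda>x. Suc (c * Suc (size (enc x)))"])
        (use c assms(2) in \<open>auto intro!: poly_bounded_intros simp del: mult_Suc_right simp flip: assms(2)\<close>)
    show "runs (Assign 0 e) (enc x) (enc (f x)) (Suc (size (enc (f x))))" for x
      using runs_Assign[OF assms(1) refl, of "enc x"] assms(2) by simp
  qed (use assms(1) in simp)
qed

lemma polytime_comp:
  assumes "polytime g" "polytime f"
  shows "polytime (\<lambda>x. g (f x))"
proof -
  obtain P k where P: "vars P \<subseteq> {0}" "poly_bounded k" "\<And>x. runs P (enc x) (enc (f x)) (k x)"
    using assms(2) by (rule polytimeE) blast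
  obtain Q l where Q: "vars Q \<subseteq> {0}" "poly_bounded l" "\<And>x. runs Q (enc x) (enc (g x)) (l x)"
    using assms(1) by (rule polytimeE) blast
  show ?thesis
  proof (rule polytimeI[of "Seq P Q"])
    show "poly_bounded (\<lambda>x. k x + l (f x))"
      by (intro poly_bounded_add P poly_bounded_subst[OF Q(2)] poly_bounded_size assms)
    show "runs (Seq P Q) (enc x) (enc (g (f x))) (k x + l (f x))" for x
      by (rule runs_Seq[OF P(3) Q(3)])
  qed (use P Q in auto)
qed

lemma polytime_id: "polytime (\<lambda>x. x)"
  by (rule polytime_expr[of "Var 0"]) auto

lemma polytime_const: "polytime (\<lambda>_. c)"
proof -
  have "\<exists>e. expr_vars e = {} \<and> (\<forall>a. ev e a = v)" for v
  proof (induction v)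
    case Leaf
    then show ?case by (intro exI[of _ Empty]) simp
  next
    case (Pair v w)
    then obtain e f where "expr_vars e = {} \<and> (\<forall>a. ev e a = v)" "expr_vars f = {} \<and> (\<forall>a. ev f a = w)"
      by blast
    then show ?case by (intro exI[of _ "Cons e f"]) simp
  qed
  then obtain e where "expr_vars e = {} \<and> (\<forall>a. ev e a = enc c)" by blast
  then show ?thesis by (intro polytime_expr[of e]) auto
qed

lemma polytime_fst: "polytime f \<Longrightarrow> polytime (\<lambda>x. fst (f x))"
  by (rule polytime_comp[of fst], rule polytime_expr[of "Hd (Var 0)"]) (auto simp: enc_prod_def)

lemma polytime_snd: "polytime f \<Longrightarrow> polytime (\<lambda>x. snd (f x))"
  by (rule polytime_comp[of snd], rule polytime_expr[of "Tl (Var 0)"]) (auto simp: enc_prod_def)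

text \<open>Makes functions of several arguments available. The argument is duplicated; each copy is
  processed on the left while the other component waits on the right, and swaps exchange the
  two.\<close>

lemma polytime_Pair:
  fixes f :: "'a::enc \<Rightarrow> 'b::enc" and g :: "'a \<Rightarrow> 'c::enc"
  assumes "polytime f" "polytime g"
  shows "polytime (\<lambda>x. (f x, g x))"
proof -
  obtain P k where P: "vars P \<subseteq> {0}" "poly_bounded k" "\<And>x. runs P (enc x) (enc (f x)) (k x)"
    using assms(1) by (rule polytimeE) blast
  obtain Q l where Q: "vars Q \<subseteq> {0}" "poly_bounded l" "\<And>x. runs Q (enc x) (enc (g x)) (l x)"
    using assms(2) by (rule polytimeE) blast
  let ?swap = "Assign 0 (Cons (Tl (Var 0)) (Hd (Var 0)))"
  show ?thesis
  proof (rule polytimeI)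
    fix x :: 'a
    have "runs (Assign 0 (Cons (Var 0) (Var 0))) (enc x) (enc (x, x)) (Suc (Suc (size (enc x) +
        size (enc x))))"
      using runs_Assign[of "Cons (Var 0) (Var 0)" "enc (x, x)" "enc x"] by simp
    moreover have "runs (left_prog P) (enc (x, x)) (enc (f x, x)) (Suc (k x + size (enc x)))"
      using runs_left[OF P(3) P(1)] by simp
    moreover have "runs ?swap (enc (f x, x)) (enc (x, f x)) (Suc (Suc (size (enc x) + size (enc (f x)))))"
      using runs_Assign[of "Cons (Tl (Var 0)) (Hd (Var 0))" "enc (x, f x)" "enc (f x, x)"] by simp
    moreover have "runs (left_prog Q) (enc (x, f x)) (enc (g x, f x)) (Suc (l x + size (enc (f x))))"
      using runs_left[OF Q(3) Q(1)] by simp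
    moreover have "runs ?swap (enc (g x, f x)) (enc (f x, g x)) (Suc (Suc (size (enc (f x)) +
        size (enc (g x)))))"
      using runs_Assign[of "Cons (Tl (Var 0)) (Hd (Var 0))" "enc (f x, g x)" "enc (g x, f x)"] by simp
    ultimately show "runs (Seq (Assign 0 (Cons (Var 0) (Var 0))) (Seq (left_prog P) (Seq ?swap
        (Seq (left_prog Q) ?swap)))) (enc x) (enc (f x, g x))
        (Suc (Suc (size (enc x) + size (enc x))) + (Suc (k x + size (enc x)) + (Suc (Suc (size (enc x) +
            size (enc (f x)))) + (Suc (l x + size (enc (f x))) + Suc (Suc (size (enc (f x)) +
                size (enc (g x))))))))"
      by (intro runs_Seq)
  next
    show "poly_bounded (\<lambda>x. Suc (Suc (size (enc x) + size (enc x))) + (Suc (k x + size (enc x)) +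
        (Suc (Suc (size (enc x) + size (enc (f x)))) +
        (Suc (l x + size (enc (f x))) + Suc (Suc (size (enc (f x)) + size (enc (g x))))))))"
      by (intro poly_bounded_intros P Q poly_bounded_size assms)
  qed (use P Q in auto)
qed

lemma polytime_if:
  fixes f g :: "'a::enc \<Rightarrow> 'b::enc"
  assumes "polytime b" "polytime f" "polytime g"
  shows "polytime (\<lambda>x. if b x then f x else g x)"
proof -
  have B': "polytime (\<lambda>x. (b x, x))" by (intro polytime_Pair assms polytime_id)
  obtain B j where B: "vars B \<subseteq> {0}" "poly_bounded j" "\<And>x. runs B (enc x) (enc (b x, x)) (j x)"
    using B' by (rule polytimeE) blast
  obtain P k where P: "vars P \<subseteq> {0}" "poly_bounded k" "\<And>x. runs P (enc x) (enc (f x)) (k x)"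
    using assms(2) by (rule polytimeE) blast
  obtain Q l where Q: "vars Q \<subseteq> {0}" "poly_bounded l" "\<And>x. runs Q (enc x) (enc (g x)) (l x)"
    using assms(3) by (rule polytimeE) blast
  let ?T = "Assign 0 (Tl (Var 0))"
  show ?thesis
  proof (rule polytimeI)
    fix x :: 'a
    have T: "runs ?T (enc (b x, x)) (enc x) (Suc (size (enc x)))"
      by (rule runs_Assign) auto
    have "runs (if ev (Hd (Var 0)) (enc (b x, x)) \<noteq> Leaf then Seq ?T P else Seq ?T Q) (enc (b x, x))
        (enc (if b x then f x else g x)) (Suc (size (enc x)) + (k x + l x))"
      using runs_Seq[OF T runs_mono[OF P(3)], of "k x + l x"]
        runs_Seq[OF T runs_mono[OF Q(3)], of "k x + l x"]
      by (cases "b x") auto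
    from runs_Seq[OF B(3) runs_If[OF _ this]]
    show "runs (Seq B (If (Hd (Var 0)) (Seq ?T P) (Seq ?T Q))) (enc x) (enc (if b x then f x else g x))
      (j x + Suc (Suc (size (enc x)) + (k x + l x) + size (enc (b x, x))))"
      by simp
  next
    show "poly_bounded (\<lambda>x. j x + Suc (Suc (size (enc x)) + (k x + l x) + size (enc (b x, x))))"
      by (intro poly_bounded_intros B P Q poly_bounded_size B')
  qed (use B P Q in auto)
qed

lemma polytime_Not: "polytime b \<Longrightarrow> polytime (\<lambda>x. \<not> b x)"
  by (rule back_subst[of polytime, OF polytime_if[OF _ polytime_const[of False]
      polytime_const[of True]]]) auto

lemma polytime_conj: "polytime b \<Longrightarrow> polytime c \<Longrightarrow> polytime (\<lambda>x. b x \<and> c x)"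
  by (rule back_subst[of polytime, OF polytime_if[of b c "\<lambda>_. False", OF _ _ polytime_const]]) auto

lemma polytime_disj: "polytime b \<Longrightarrow> polytime c \<Longrightarrow> polytime (\<lambda>x. b x \<or> c x)"
  by (rule back_subst[of polytime, OF polytime_if[of b "\<lambda>_. True" c, OF _ polytime_const]]) auto

lemma polytime_imp: "polytime b \<Longrightarrow> polytime c \<Longrightarrow> polytime (\<lambda>x. b x \<longrightarrow> c x)"
  by (rule back_subst[of polytime, OF polytime_if[of b c "\<lambda>_. True", OF _ _ polytime_const]]) auto

lemma polytime_Cons: "polytime f \<Longrightarrow> polytime g \<Longrightarrow> polytime (\<lambda>x. f x # g x)"
  using polytime_comp[of "\<lambda>p. fst p # snd p" "\<lambda>x. (f x, g x)"] polytime_expr[of "Var 0" "\<lambda>p. fst p # snd p"]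
  by (auto intro!: polytime_Pair simp: enc_prod_def)

lemma polytime_tl: "polytime f \<Longrightarrow> polytime (\<lambda>x. tl (f x))"
proof (rule polytime_comp[of tl])
  show "polytime (tl :: 'b list \<Rightarrow> _)"
  proof (rule polytime_expr[of "Tl (Var 0)"])
    show "ev (Tl (Var 0)) (enc xs) = enc (tl xs)" for xs :: "'b list" by (cases xs) auto
  qed simp
qed

lemma polytime_null: "polytime f \<Longrightarrow> polytime (\<lambda>x. f x = [])"
proof (rule polytime_comp[of "\<lambda>xs. xs = []"])
  define P where P: "P = If (Var 0) (Assign 0 Empty) (Assign 0 (Cons Empty Empty))"
  show "polytime (\<lambda>xs :: 'b list. xs = [])"
  proof (rule polytimeI)
    fix xs :: "'b list"
    have "runs (if ev (Var 0) (enc xs) \<noteq> Leaf then Assign 0 Empty else Assign 0 (Cons Empty Empty))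
        (enc xs) (enc (xs = [])) 2"
      using runs_mono[OF runs_Assign[of Empty Leaf "enc xs"], of 2]
        runs_mono[OF runs_Assign[of "Cons Empty Empty" "Pair Leaf Leaf" "enc xs"], of 2]
      by auto
    from runs_If[OF _ this] show "runs P (enc xs) (enc (xs = [])) (Suc (2 + size (enc xs)))"
      by (simp add: P)
  qed (use P in \<open>auto intro!: poly_bounded_intros\<close>)
qed

section \<open>Computations on lists\<close>

definition head :: "'a list list \<Rightarrow> 'a list" where
  "head xss = (case xss of [] \<Rightarrow> [] | xs # _ \<Rightarrow> xs)"

lemma polytime_head: "polytime f \<Longrightarrow> polytime (\<lambda>x. head (f x))"
  by (rule polytime_comp[of head], rule polytime_expr[of "Hd (Var 0)"])
      (auto simp: head_def split: list.split)

text \<open>A bound on all intermediate accumulators has to be supplied: a step that doubles its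
  accumulator takes polynomial time, but iterating it leads to exponential size.\<close>

lemma polytime_foldl:
  fixes step :: "'a::enc \<Rightarrow> 'b::enc \<Rightarrow> 'c::enc \<Rightarrow> 'b"
  assumes step: "polytime (\<lambda>p. step (fst p) (fst (snd p)) (snd (snd p)))" and init: "polytime init"
      and xs: "polytime xs"
    and h: "poly_bounded h" and h_le: "\<And>x i. size (enc (foldl (step x) (init x) (take i (xs x)))) \<le> h x"
  shows "polytime (\<lambda>x. foldl (step x) (init x) (xs x))"
proof -
  have I': "polytime (\<lambda>x. (x, init x, xs x))" by (intro polytime_Pair polytime_id init xs)
  obtain I j where I: "vars I \<subseteq> {0}" "poly_bounded j" "\<And>x. runs I (enc x) (enc (x, init x, xs x)) (j x)"
    using I' by (rule polytimeE) blast
  obtain P k where P: "vars P \<subseteq> {0}" "poly_bounded k"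
    "\<And>p. runs P (enc p) (enc (step (fst p) (fst (snd p)) (snd (snd p)))) (k p)"
    using step by (rule polytimeE) blast
  obtain q where q: "\<And>p. k p \<le> poly q (size (enc p))" using P(2) unfolding poly_bounded_def by blast
  \<comment> \<open>\<open>sp\<close> splits the state (x, accumulator, y # rest) into the argument
    of the step and the pair (x, rest), which waits on the right; \<open>re\<close> assembles the
    next state.\<close>
  define sp where "sp = Cons (Cons (Hd (Var 0)) (Cons (Hd (Tl (Var 0))) (Hd (Tl (Tl (Var 0))))))
    (Cons (Hd (Var 0)) (Tl (Tl (Tl (Var 0)))))"
  define re where "re = Cons (Hd (Tl (Var 0))) (Cons (Hd (Var 0)) (Tl (Tl (Var 0))))"
  define body where "body = Seq (Assign 0 sp) (Seq (left_prog P) (Assign 0 re))"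
  have vars: "expr_vars sp \<subseteq> {0}" "expr_vars re \<subseteq> {0}" by (auto simp: sp_def re_def)
  \<comment> \<open>\<open>t\<close> bounds the size of every state, and \<open>K\<close> below
    bounds the cost of one round.\<close>
  define t where "t x = size (enc x) + h x + size (enc (xs x)) + 3" for x
  define K where "K x = Suc (2 * t x) + (Suc (poly q (t x) + t x) + Suc (t x))" for x
  define acc where "acc x i = foldl (step x) (init x) (take i (xs x))" for x i
  define S where "S x i = enc (x, acc x i, drop i (xs x))" for x i
  have drop_le: "size (enc (drop i l)) \<le> size (enc l)" for i and l :: "'c list"
    using append_take_drop_id[of i l, symmetric]
    by (metis le_add2 length_append size_enc_list sum_list_append map_append add_mono)
  have S_le: "size (S x i) \<le> t x" for x i
    using h_le[of x i] drop_le[of i "xs x"] by (simp add: S_def t_def acc_def)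
  have loop: "runs body (S x i) (S x (Suc i)) (K x)" if i: "i < length (xs x)" for x i
  proof -
    let ?y = "xs x ! i" and ?d = "drop (Suc i) (xs x)"
    have d: "drop i (xs x) = ?y # ?d" using i by (simp add: Cons_nth_drop_Suc)
    have a: "acc x (Suc i) = step x (acc x i) ?y" using i by (simp add: acc_def take_Suc_conv_app_nth)
    have Si: "S x i = enc (x, acc x i, ?y # ?d)" by (simp add: S_def d)
    have "size (S x i) \<le> t x" "size (S x (Suc i)) \<le> t x" by (rule S_le)+
    then have le: "size (enc (x, acc x i, ?y)) \<le> t x" "size (enc (x, ?d)) \<le> t x"
      "size (enc (acc x (Suc i), x, ?d)) \<le> t x" "size (enc (x, acc x (Suc i), ?d)) \<le> t x"
      unfolding Si unfolding S_def by auto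
    have "runs (Assign 0 sp) (S x i) (enc ((x, acc x i, ?y), (x, ?d))) (Suc (2 * t x))"
      by (rule runs_mono[OF runs_Assign[OF vars(1)]]) (use le in \<open>auto simp: Si sp_def\<close>)
    moreover have "runs (left_prog P) (enc ((x, acc x i, ?y), (x, ?d))) (enc (acc x (Suc i), (x, ?d)))
        (Suc (poly q (t x) + t x))"
      using runs_left[OF P(3) P(1), of "(x, acc x i, ?y)" "enc (x, ?d)"]
        order_trans[OF q poly_nat_mono[OF le(1)]] le(2)
      by (auto simp: a intro: runs_mono)
    moreover have "runs (Assign 0 re) (enc (acc x (Suc i), (x, ?d))) (enc (x, acc x (Suc i), ?d)) (Suc (t x))"
      by (rule runs_mono[OF runs_Assign[OF vars(2)]]) (use le in \<open>auto simp: re_def\<close>)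
    ultimately show ?thesis
      unfolding body_def K_def S_def by (intro runs_Seq)
  qed
  have K_ge: "t x \<le> K x" for x by (simp add: K_def)
  let ?loop = "While (Tl (Tl (Var 0))) body" and ?end = "Assign 0 (Hd (Tl (Var 0)))"
  show ?thesis
  proof (rule polytimeI)
    fix x :: 'a
    let ?n = "length (xs x)" and ?r = "foldl (step x) (init x) (xs x)"
    have "runs I (enc x) (S x 0) (j x)" using I(3) by (simp add: S_def acc_def)
    moreover have "runs ?loop (S x 0) (S x ?n) (Suc ?n * Suc (K x))"
    proof (rule runs_While)
      show "size (S x i) \<le> K x" for i using S_le K_ge order_trans by blast
    qed (use loop in \<open>auto simp: S_def\<close>)
    then have "runs ?loop (S x 0) (S x ?n) (Suc (size (enc (xs x))) * Suc (K x))"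
      by (rule runs_mono) (intro mult_le_mono Suc_mono length_le_size_enc order_refl Suc_leI le_imp_less_Suc)
    moreover have "runs ?end (S x ?n) (enc ?r) (Suc (t x))"
      by (rule runs_mono[OF runs_Assign]) (use S_le[of x ?n] in \<open>auto simp: S_def acc_def\<close>)
    ultimately show "runs (Seq I (Seq ?loop ?end)) (enc x) (enc ?r)
        (j x + (Suc (size (enc (xs x))) * Suc (K x) + Suc (t x)))"
      by (intro runs_Seq)
  next
    have t: "poly_bounded t" unfolding t_def by (intro poly_bounded_intros h poly_bounded_size xs)
    have "poly_bounded (\<lambda>x. poly q (t x))"
    proof -
      obtain r where r: "\<forall>x. t x \<le> poly r (size (enc x))" using t unfolding poly_bounded_def by blast
      have "poly q (t x) \<le> poly (pcompose q r) (size (enc x))" for x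
        using poly_nat_mono[OF r[rule_format]] by (simp add: poly_pcompose)
      then show ?thesis unfolding poly_bounded_def by blast
    qed
    then show "poly_bounded (\<lambda>x. j x + (Suc (size (enc (xs x))) * Suc (K x) + Suc (t x)))"
      unfolding K_def by (intro poly_bounded_intros I t poly_bounded_size xs)
  qed (use I P vars in \<open>auto simp: body_def\<close>)
qed

lemmas polytime_basic = polytime_id polytime_const polytime_fst polytime_snd polytime_Pair polytime_if
    polytime_Not
  polytime_conj polytime_disj polytime_imp polytime_Cons polytime_tl
  polytime_null polytime_head

text \<open>If a round adds at most an amount independent of the accumulator, sizes grow linearly in
  the number of rounds. This form suits most loops below.\<close>

lemma polytime_foldl_add:
  fixes step :: "'a::enc \<Rightarrow> 'b::enc \<Rightarrow> 'c::enc \<Rightarrow> 'b"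
  assumes step: "polytime (\<lambda>p. step (fst p) (fst (snd p)) (snd (snd p)))" and init: "polytime init"
      and xs: "polytime xs"
    and h: "poly_bounded h"
    and h_le: "\<And>x acc y. y \<in> set (xs x) \<Longrightarrow> size (enc (step x acc y)) \<le> size (enc acc) + h x"
  shows "polytime (\<lambda>x. foldl (step x) (init x) (xs x))"
proof (rule polytime_foldl[OF step init xs])
  show "poly_bounded (\<lambda>x. size (enc (init x)) + size (enc (xs x)) * h x)"
    by (intro poly_bounded_intros poly_bounded_size init xs h)
  fix x i
  have "size (enc (foldl (step x) acc ys)) \<le> size (enc acc) + length ys * h x"
    if "set ys \<subseteq> set (xs x)" for ys acc
    using that
  proof (induction ys arbitrary: acc)
    case (Cons y ys)
    then have "size (enc (foldl (step x) (step x acc y) ys)) \<le> size (enc (step x acc y)) + length ys * h x"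
      "size (enc (step x acc y)) \<le> size (enc acc) + h x"
      using h_le by auto
    then show ?case by simp
  qed simp
  from this[OF set_take_subset]
  have "size (enc (foldl (step x) (init x) (take i (xs x)))) \<le>
      size (enc (init x)) + length (take i (xs x)) * h x" .
  also have "\<dots> \<le> size (enc (init x)) + size (enc (xs x)) * h x"
    using length_le_size_enc[of "xs x"] by (intro add_left_mono mult_le_mono1) simp
  finally show "size (enc (foldl (step x) (init x) (take i (xs x)))) \<le>
      size (enc (init x)) + size (enc (xs x)) * h x" .
qed

lemma polytime_rev:
  assumes "polytime xs"
  shows "polytime (\<lambda>x. rev (xs x))"
proof -
  have "polytime (\<lambda>x. foldl (\<lambda>acc y. y # acc) [] (xs x))"
    by (rule polytime_foldl_add[where h = "\<lambda>x. Suc (size (enc (xs x)))"])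
      ((intro polytime_basic poly_bounded_intros poly_bounded_size
          assms)+, simp add: less_imp_le size_enc_elem)
  then show ?thesis by (simp add: foldl_conv_fold rev_conv_fold)
qed

lemma polytime_append:
  assumes "polytime xs" "polytime ys"
  shows "polytime (\<lambda>x. xs x @ ys x)"
proof -
  have "polytime (\<lambda>x. foldl (\<lambda>acc y. y # acc) (ys x) (rev (xs x)))"
    by (rule polytime_foldl_add[where h = "\<lambda>x. Suc (size (enc (xs x)))"])
      ((intro polytime_basic polytime_rev poly_bounded_intros poly_bounded_size
          assms)+, simp add: less_imp_le size_enc_elem)
  then show ?thesis by (simp add: foldl_conv_fold fold_Cons_rev)
qed

lemma polytime_concat:
  assumes "polytime xss"
  shows "polytime (\<lambda>x. concat (xss x))"
proof -
  have eq: "foldl (\<lambda>acc ys. ys @ acc) [] (rev xs) = concat xs" for xs :: "'b list list"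
    by (induction xs) auto
  have "size (enc (ys @ acc)) \<le> size (enc acc) + size (enc (xss x))" if "ys \<in> set (xss x)" for ys acc x
    using size_enc_elem[OF that] by (simp add: size_enc_list)
  then have "polytime (\<lambda>x. foldl (\<lambda>acc ys. ys @ acc) [] (rev (xss x)))"
    by (intro polytime_foldl_add[where h = "\<lambda>x. size (enc (xss x))"] polytime_basic polytime_rev
        polytime_append poly_bounded_size assms) simp
  then show ?thesis by (simp add: eq)
qed

text \<open>An element is smaller than the list that contains it, so a bound in terms of the pair
  (x, y) becomes one in terms of x alone.\<close>

lemma poly_bounded_elem:
  assumes "polytime (\<lambda>p. f (fst p) (snd p))" "polytime xs"
  obtains h where "poly_bounded h" "\<And>x y. y \<in> set (xs x) \<Longrightarrow> size (enc (f x y)) \<le> h x"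
proof -
  from poly_bounded_size[OF
      assms(1)] obtain q where "\<And>p. size (enc (f (fst p) (snd p))) \<le> poly q (size (enc p))"
    unfolding poly_bounded_def by blast
  from this[of "(_, _)"] have q: "size (enc (f x y)) \<le> poly q (size (enc (x, y)))" for x y by simp
  have "poly_bounded (\<lambda>x. size (enc x) + size (enc (xs x)) + 1)"
    by (intro poly_bounded_intros poly_bounded_size assms)
  then obtain r where r: "\<And>x. size (enc x) + size (enc (xs x)) + 1 \<le> poly r (size (enc x))"
    unfolding poly_bounded_def by blast
  show thesis
  proof
    show "poly_bounded (\<lambda>x. poly (pcompose q r) (size (enc x)))"
      unfolding poly_bounded_def by blast
    fix x y
    assume "y \<in> set (xs x)"
    then have "size (enc (x, y)) \<le> poly r (size (enc x))"
      using size_enc_elem[of y "xs x"] r[of x] by simp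
    then show "size (enc (f x y)) \<le> poly (pcompose q r) (size (enc x))"
      unfolding poly_pcompose by (rule order_trans[OF q poly_nat_mono])
  qed
qed

lemma polytime_map:
  assumes "polytime (\<lambda>p. f (fst p) (snd p))" "polytime xs"
  shows "polytime (\<lambda>x. map (f x) (xs x))"
proof -
  obtain h where h: "poly_bounded h" "\<And>x y. y \<in> set (xs x) \<Longrightarrow> size (enc (f x y)) \<le> h x"
    using poly_bounded_elem[OF assms] by blast
  \<comment> \<open>The fold builds its result from the back, hence it runs over the reversed
    list.\<close>
  have eq: "foldl (\<lambda>acc y. g y # acc) [] (rev ys) = map g ys" for g ys
    by (induction ys) auto
  have f: "polytime (\<lambda>p. f (fst p) (snd (snd p)))"
    using polytime_comp[OF assms(1) polytime_Pair[OF polytime_fst[OF polytime_id] polytime_snd[OF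
        polytime_snd[OF polytime_id]]]] by simp
  have "polytime (\<lambda>x. foldl (\<lambda>acc y. f x y # acc) [] (rev (xs x)))"
    by (rule polytime_foldl_add[where h = "\<lambda>x. Suc (h x)"])
      ((intro polytime_basic polytime_rev f poly_bounded_intros h assms)+, simp add: h)
  then show ?thesis by (simp add: eq)
qed

lemma polytime_filter:
  assumes "polytime (\<lambda>p. P (fst p) (snd p))" "polytime xs"
  shows "polytime (\<lambda>x. filter (P x) (xs x))"
proof -
  have eq: "foldl (\<lambda>acc y. if Q y then y # acc else acc) [] (rev ys) = filter Q ys" for Q ys
    by (induction ys) auto
  have P: "polytime (\<lambda>p. P (fst p) (snd (snd p)))"
    using polytime_comp[OF assms(1) polytime_Pair[OF polytime_fst[OF polytime_id] polytime_snd[OF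
        polytime_snd[OF polytime_id]]]] by simp
  have "polytime (\<lambda>x. foldl (\<lambda>acc y. if P x y then y # acc else acc) [] (rev (xs x)))"
    by (rule polytime_foldl_add[where h = "\<lambda>x. Suc (size (enc (xs x)))"])
      ((intro polytime_basic polytime_rev P poly_bounded_intros poly_bounded_size
          assms)+, simp add: less_imp_le size_enc_elem)
  then show ?thesis by (simp add: eq)
qed

lemma size_enc_bool: "size (enc (b :: bool)) \<le> 1"
  by (cases b) auto

lemma polytime_ball:
  assumes "polytime (\<lambda>p. P (fst p) (snd p))" "polytime xs"
  shows "polytime (\<lambda>x. \<forall>y \<in> set (xs x). P x y)"
proof -
  have eq: "foldl (\<lambda>acc y. acc \<and> Q y) b ys \<longleftrightarrow> b \<and> (\<forall>y \<in> set ys. Q y)" for Q b ys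
    by (induction ys arbitrary: b) auto
  have P: "polytime (\<lambda>p. P (fst p) (snd (snd p)))"
    using polytime_comp[OF assms(1) polytime_Pair[OF polytime_fst[OF polytime_id] polytime_snd[OF
        polytime_snd[OF polytime_id]]]] by simp
  have "polytime (\<lambda>x. foldl (\<lambda>acc y. acc \<and> P x y) True (xs x))"
    by (rule polytime_foldl_add[where h = "\<lambda>x. 1"])
      ((intro polytime_basic P poly_bounded_intros assms)+, use size_enc_bool trans_le_add2 in blast)
  then show ?thesis by (simp add: eq)
qed

lemma polytime_bex:
  assumes "polytime (\<lambda>p. P (fst p) (snd p))" "polytime xs"
  shows "polytime (\<lambda>x. \<exists>y \<in> set (xs x). P x y)"
  using polytime_Not[OF polytime_ball[OF polytime_Not[OF assms(1)] assms(2)]] by simp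

subsection \<open>Characteristic vectors\<close>

text \<open>The default \<open>False\<close> has the code \<open>Leaf\<close>, which is also
  \<open>left Leaf\<close>; so a projection computes the function on the empty list as well. The
  default \<open>[]\<close> of \<open>head\<close> has the same reason.\<close>

definition bhead :: "bool list \<Rightarrow> bool" where
  "bhead bs = (case bs of [] \<Rightarrow> False | b # _ \<Rightarrow> b)"

lemma polytime_bhead: "polytime f \<Longrightarrow> polytime (\<lambda>x. bhead (f x))"
  by (rule polytime_comp[of bhead], rule polytime_expr[of "Hd (Var 0)"])
      (auto simp: bhead_def split: list.split)

text \<open>The fold consumes the second list inside its accumulator. The first list fixes the
  length of the result; a shorter second list is padded with \<open>False\<close>.\<close>

definition bmap2 :: "(bool \<Rightarrow> bool \<Rightarrow> bool) \<Rightarrow> bool list \<Rightarrow> bool list \<Rightarrow> bool list" where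
  "bmap2 f xs ys = rev (snd (foldl (\<lambda>p x. (tl (fst p), f x (bhead (fst p)) # snd p)) (ys, []) xs))"

lemma bmap2_simps [simp]:
  "bmap2 f [] ys = []"
  "bmap2 f (x # xs) ys = f x (bhead ys) # bmap2 f xs (tl ys)"
proof -
  have acc: "snd (foldl (\<lambda>p x. (tl (fst p), f x (bhead (fst p)) # snd p)) (ys, acc) xs) =
      snd (foldl (\<lambda>p x. (tl (fst p), f x (bhead (fst p)) # snd p)) (ys, []) xs) @ acc" for xs ys acc
  proof (induction xs arbitrary: ys acc)
    case (Cons x xs)
    show ?case
      using Cons.IH[of "tl ys" "f x (bhead ys) # acc"] Cons.IH[of "tl ys" "[f x (bhead ys)]"] by simp
  qed simp
  show "bmap2 f (x # xs) ys = f x (bhead ys) # bmap2 f xs (tl ys)"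
    unfolding bmap2_def using acc[of "tl ys" "[f x (bhead ys)]" xs] by simp
qed (simp add: bmap2_def)

lemma bmap2_map: "bmap2 f (map p vs) (map q vs) = map (\<lambda>v. f (p v) (q v)) vs"
  by (induction vs) (auto simp: bhead_def)

text \<open>An arbitrary \<open>f\<close> on two booleans is a table of four constants, looked up by
  nested conditionals.\<close>

lemma polytime_bool2:
  fixes f :: "bool \<Rightarrow> bool \<Rightarrow> bool"
  assumes "polytime b" "polytime c"
  shows "polytime (\<lambda>x. f (b x) (c x))"
proof -
  have "polytime (\<lambda>x. if b x then (if c x then f True True else f True False)
      else (if c x then f False True else f False False))"
    by (intro polytime_if assms polytime_const)
  also have "(\<lambda>x. if b x then (if c x then f True True else f True False)
      else (if c x then f False True else f False False)) = (\<lambda>x. f (b x) (c x))"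
    by (auto simp: fun_eq_iff)
  finally show ?thesis .
qed

lemma size_enc_tl: "size (enc (tl xs)) \<le> size (enc xs)"
  by (cases xs) auto

lemma polytime_bmap2:
  assumes "polytime xs" "polytime ys"
  shows "polytime (\<lambda>x. bmap2 f (xs x) (ys x))"
  unfolding bmap2_def
proof (intro polytime_rev polytime_snd polytime_foldl_add[where h = "\<lambda>_. 2"])
  fix p :: "bool list \<times> bool list" and y
  show "size (enc (tl (fst p), f y (bhead (fst p)) # snd p)) \<le> size (enc p) + 2"
    using size_enc_tl[of "fst p"] size_enc_bool[of "f y (bhead (fst p))"]
    by (cases p) simp
qed (intro polytime_basic polytime_bhead polytime_bool2[where f = f] poly_bounded_intros assms)+

definition "bunion = bmap2 (\<or>)"
definition "bdiff = bmap2 (\<lambda>a b. a \<and> \<not> b)"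
definition "bhit xs ys \<longleftrightarrow> (\<exists>b \<in> set (bmap2 (\<and>) xs ys). b)"
definition "bsub xs ys \<longleftrightarrow> (\<forall>b \<in> set (bmap2 (\<longrightarrow>) xs ys). b)"
text \<open>Trees cannot be compared in one step, so inclusion is tested both ways. This decides
  equality of vectors of the same length.\<close>

definition "bequal xs ys \<longleftrightarrow> bsub xs ys \<and> bsub ys xs"

lemma polytime_bunion: "polytime f \<Longrightarrow> polytime g \<Longrightarrow> polytime (\<lambda>x. bunion (f x) (g x))"
  unfolding bunion_def by (rule polytime_bmap2)

lemma polytime_bdiff: "polytime f \<Longrightarrow> polytime g \<Longrightarrow> polytime (\<lambda>x. bdiff (f x) (g x))"
  unfolding bdiff_def by (rule polytime_bmap2)

lemma polytime_bhit: "polytime f \<Longrightarrow> polytime g \<Longrightarrow> polytime (\<lambda>x. bhit (f x) (g x))"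
  unfolding bhit_def by (intro polytime_bex polytime_bmap2 polytime_basic)

lemma polytime_bsub: "polytime f \<Longrightarrow> polytime g \<Longrightarrow> polytime (\<lambda>x. bsub (f x) (g x))"
  unfolding bsub_def by (intro polytime_ball polytime_bmap2 polytime_basic)

lemma polytime_bequal: "polytime f \<Longrightarrow> polytime g \<Longrightarrow> polytime (\<lambda>x. bequal (f x) (g x))"
  unfolding bequal_def by (intro polytime_bsub polytime_basic)

lemma size_bdiff: "size (enc (bdiff xs ys)) \<le> size (enc xs)"
proof (induction xs arbitrary: ys)
  case (Cons x xs)
  have "size (enc (x \<and> \<not> bhead ys)) \<le> size (enc x)" by (cases "bhead ys") auto
  then show ?case using Cons.IH[of "tl ys"] by (simp add: bdiff_def)
qed (simp add: bdiff_def)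

lemmas polytime_intros = polytime_basic polytime_rev polytime_append polytime_concat polytime_map
    polytime_filter polytime_ball polytime_bex
  polytime_bunion polytime_bdiff polytime_bhit polytime_bsub polytime_bequal

definition bits :: "'a list \<Rightarrow> 'a set \<Rightarrow> bool list" where
  "bits vs D = map (\<lambda>v. v \<in> D) vs"

text \<open>Elements outside the listing are invisible to a characteristic vector, hence the
  intersections with \<open>set vs\<close>.\<close>

lemma bits_simps [simp]:
  "bunion (bits vs A) (bits vs B) = bits vs (A \<union> B)"
  "bdiff (bits vs A) (bits vs B) = bits vs (A - B)"
  "bhit (bits vs A) (bits vs B) \<longleftrightarrow> A \<inter> B \<inter> set vs \<noteq> {}"
  "bsub (bits vs A) (bits vs B) \<longleftrightarrow> A \<inter> set vs \<subseteq> B"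
  by (auto simp: bits_def bunion_def bdiff_def bhit_def bsub_def bmap2_map)

lemma bits_eq_iff: "bits vs A = bits vs B \<longleftrightarrow> A \<inter> set vs = B \<inter> set vs"
  by (auto simp: bits_def)

lemma bequal_bits [simp]: "bequal (bits vs A) (bits vs B) \<longleftrightarrow> bits vs A = bits vs B"
  by (auto simp: bequal_def bits_eq_iff)

lemma enc_bits: "enc (bits vs D) = set_val vs D"
  by (simp add: bits_def set_val_def enc_list_def enc_bool_def o_def)

lemma size_enc_bools: "size (enc (bs :: bool list)) \<le> 2 * length bs"
proof (induction bs)
  case (Cons b bs)
  then show ?case using size_enc_bool[of b] by simp
qed simp

text \<open>Only the length of \<open>xs\<close> matters. Each round puts a new vector in front and
  a leading \<open>False\<close> on the old ones, so no arithmetic on positions is required.\<close>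

definition unit_vectors :: "'a list \<Rightarrow> bool list list" where
  "unit_vectors xs = foldl (\<lambda>acc _. (True # map (\<lambda>_. False) acc) # map ((#) False) acc) [] xs"

lemma unit_vectors_append1:
  "unit_vectors (xs @ [x]) = (True # map (\<lambda>_. False) (unit_vectors xs)) # map ((#) False) (unit_vectors xs)"
  by (simp add: unit_vectors_def)

lemma unit_vectors_shape:
  "length (unit_vectors xs) = length xs \<and> (\<forall>e \<in> set (unit_vectors xs). length e = length xs)"
  by (induction xs rule: rev_induct) (auto simp: unit_vectors_append1, simp_all add: unit_vectors_def)

lemma unit_vectors_bits:
  assumes "distinct vs" "length xs = length vs"
  shows "unit_vectors xs = map (\<lambda>v. bits vs {v}) vs"
  using assms
proof (induction vs arbitrary: xs)
  case Nil
  then show ?case by (simp add: unit_vectors_def)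
next
  case (Cons v vs)
  then obtain ys y where xs: "xs = ys @ [y]" "length ys = length vs" by (cases xs rule: rev_cases) auto
  have "unit_vectors ys = map (\<lambda>v. bits vs {v}) vs" using Cons xs by simp
  then show ?case using Cons.prems(1) by (auto simp: xs unit_vectors_append1 bits_def)
qed

lemma polytime_unit_vectors:
  assumes "polytime xs"
  shows "polytime (\<lambda>x. unit_vectors (xs x))"
  unfolding unit_vectors_def
proof (rule polytime_foldl)
  \<comment> \<open>A round lengthens all vectors, so its growth depends on the accumulator; the
    known shape of the result gives a quadratic bound instead.\<close>
  show "poly_bounded (\<lambda>x. size (enc (xs x)) * Suc (2 * size (enc (xs x))))"
    by (intro poly_bounded_intros poly_bounded_size assms)
  fix x i
  show "size (enc (foldl (\<lambda>acc _. (True # map (\<lambda>_. False) acc) # map ((#) False) acc) [] (take i (xs x))))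
      \<le> size (enc (xs x)) * Suc (2 * size (enc (xs x)))"
    unfolding unit_vectors_def[symmetric]
  proof (rule size_enc_list_le)
    have "length (take i (xs x)) \<le> size (enc (xs x))"
      using length_le_size_enc[of "xs x"] by simp
    then show "length (unit_vectors (take i (xs x))) \<le> size (enc (xs x))"
      using unit_vectors_shape[of "take i (xs x)"] by simp
    show "size (enc e) \<le> 2 * size (enc (xs x))" if "e \<in> set (unit_vectors (take i (xs x)))" for e
      using unit_vectors_shape[of "take i (xs x)"] size_enc_bools[of e] that
        length_le_size_enc[of "xs x"] by fastforce
  qed
qed (intro polytime_intros assms)+

section \<open>Simple vertices of chordal bipartite graphs\<close>

lemma sum_pow2_less:
  assumes "finite X" "inj_on \<rho> X" "\<And>x. x \<in> X \<Longrightarrow> \<rho> x < (m :: nat)"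
  shows "(\<Sum>x\<in>X. 2 ^ \<rho> x) < (2 ^ m :: nat)"
proof -
  have "(\<Sum>x\<in>X. 2 ^ \<rho> x) = (\<Sum>i\<in>\<rho> ` X. 2 ^ i :: nat)"
    using assms(2) by (simp add: sum.reindex)
  also have "\<dots> \<le> (\<Sum>i<m. 2 ^ i)"
    using assms by (intro sum_mono2) auto
  also have "\<dots> < 2 ^ m"
    by (induction m) auto
  finally show ?thesis .
qed

text \<open>Binary numerals are compared at the highest digit in which they differ; the lower digits
  together cannot outweigh it.\<close>

lemma sum_pow2_less_if_last_difference:
  fixes \<rho> :: "'a \<Rightarrow> nat"
  assumes "finite X" "finite Y" "inj_on \<rho> (X \<union> Y)" "y \<in> X" "y \<notin> Y"
    and agree: "\<And>z. \<rho> y < \<rho> z \<Longrightarrow> z \<in> X \<longleftrightarrow> z \<in> Y"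
  shows "(\<Sum>x\<in>Y. 2 ^ \<rho> x) < (\<Sum>x\<in>X. 2 ^ \<rho> x :: nat)"
proof -
  let ?C = "{x \<in> X. \<rho> y < \<rho> x}" and ?L = "{x \<in> Y. \<rho> x < \<rho> y}"
  have "Y = ?C \<union> ?L"
  proof (intro set_eqI iffI)
    fix z assume "z \<in> Y"
    then have "\<rho> z \<noteq> \<rho> y" using assms by (auto dest: inj_onD)
    then show "z \<in> ?C \<union> ?L" using \<open>z \<in> Y\<close> agree[of z] by auto
  qed (use agree in auto)
  then have "(\<Sum>x\<in>Y. 2 ^ \<rho> x) = (\<Sum>x\<in>?C \<union> ?L. 2 ^ \<rho> x :: nat)" by simp
  also have "\<dots> = (\<Sum>x\<in>?C. 2 ^ \<rho> x) + (\<Sum>x\<in>?L. 2 ^ \<rho> x)"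
    using assms by (intro sum.union_disjoint) auto
  also have "(\<Sum>x\<in>?L. 2 ^ \<rho> x) < (2 ^ \<rho> y :: nat)"
    by (rule sum_pow2_less) (use assms in \<open>auto intro: inj_on_subset\<close>)
  then have "(\<Sum>x\<in>?C. 2 ^ \<rho> x) + (\<Sum>x\<in>?L. 2 ^ \<rho> x) < (\<Sum>x\<in>?C. 2 ^ \<rho> x) + (2 ^ \<rho> y :: nat)"
    by simp
  also have "\<dots> = (\<Sum>x\<in>insert y ?C. 2 ^ \<rho> x)"
    using assms by simp
  also have "\<dots> \<le> (\<Sum>x\<in>X. 2 ^ \<rho> x)"
    using assms by (intro sum_mono2) auto
  finally show ?thesis .
qed

text \<open>A potential for local search: an edge weighs 2 to the sum of the positions of its ends.
  Exchanging two vertices that violate the lexical order increases the total.\<close>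

definition edge_weight :: "('a \<Rightarrow> 'a \<Rightarrow> bool) \<Rightarrow> 'a set \<Rightarrow> 'a set \<Rightarrow> ('a \<Rightarrow> nat) \<Rightarrow> nat" where
  "edge_weight E X Y \<rho> = (\<Sum>x\<in>X. \<Sum>y\<in>Y. if E x y then 2 ^ \<rho> x * 2 ^ \<rho> y else 0)"

text \<open>Lets rows and columns change roles, so that one exchange lemma serves both
  sides.\<close>

lemma edge_weight_commute:
  assumes "\<And>x y. E x y \<Longrightarrow> E y x"
  shows "edge_weight E X Y \<rho> = edge_weight E Y X \<rho>"
proof -
  have "edge_weight E X Y \<rho> = (\<Sum>y\<in>Y. \<Sum>x\<in>X. if E x y then 2 ^ \<rho> x * 2 ^ \<rho> y else 0)"
    unfolding edge_weight_def by (rule sum.swap)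
  also have "\<dots> = edge_weight E Y X \<rho>"
    unfolding edge_weight_def by (intro sum.cong refl) (auto simp: mult.commute dest: assms)
  finally show ?thesis .
qed

text \<open>A rearrangement inequality: read as a binary number, row \<open>u\<close> exceeds row
  \<open>w\<close> but stands at the smaller position, so exchanging the two positions increases the
  total.\<close>

lemma edge_weight_swap:
  assumes fin: "finite X" "finite Y" and disj: "X \<inter> Y = {}" and inj: "inj_on \<rho> (X \<union> Y)"
    and uw: "u \<in> X" "w \<in> X" "\<rho> u < \<rho> w"
    and y: "y \<in> Y" "E u y" "\<not> E w y" and agree: "\<And>z. z \<in> Y \<Longrightarrow> \<rho> y < \<rho> z \<Longrightarrow> E u z \<longleftrightarrow> E w z"
  shows "edge_weight E X Y \<rho> < edge_weight E X Y (\<rho>(u := \<rho> w, w := \<rho> u))"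
proof -
  let ?\<rho> = "\<rho>(u := \<rho> w, w := \<rho> u)"
  define W where "W x = (\<Sum>y\<in>{y\<in>Y. E x y}. 2 ^ \<rho> y :: nat)" for x
  have "u \<notin> Y" "w \<notin> Y" "u \<noteq> w" using uw disj by auto
  have W: "(\<Sum>y\<in>Y. if E x y then 2 ^ \<rho>' x * 2 ^ \<rho>' y else 0) = 2 ^ \<rho>' x * W x"
    if "\<And>y. y \<in> Y \<Longrightarrow> \<rho>' y = \<rho> y" for x \<rho>'
  proof -
    have "(\<Sum>y\<in>Y. if E x y then 2 ^ \<rho>' x * 2 ^ \<rho>' y else 0) =
        (\<Sum>y\<in>{y\<in>Y. E x y}. 2 ^ \<rho>' x * 2 ^ \<rho>' y)"
      using fin by (simp add: sum.inter_filter)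
    also have "\<dots> = 2 ^ \<rho>' x * W x"
      unfolding W_def sum_distrib_left by (rule sum.cong) (auto simp: that)
    finally show ?thesis .
  qed
  have eq: "edge_weight E X Y \<rho> = (\<Sum>x\<in>X. 2 ^ \<rho> x * W x)"
    "edge_weight E X Y ?\<rho> = (\<Sum>x\<in>X. 2 ^ ?\<rho> x * W x)"
  proof -
    show "edge_weight E X Y \<rho> = (\<Sum>x\<in>X. 2 ^ \<rho> x * W x)"
      unfolding edge_weight_def by (rule sum.cong[OF refl W]) simp
    show "edge_weight E X Y ?\<rho> = (\<Sum>x\<in>X. 2 ^ ?\<rho> x * W x)"
      unfolding edge_weight_def
      by (rule sum.cong[OF refl W]) (use \<open>u \<notin> Y\<close> \<open>w \<notin> Y\<close> in auto)
  qed
  have split: "(\<Sum>x\<in>X. f x) = f u + f w + (\<Sum>x\<in>X - {u, w}. f x)" for f :: "'a \<Rightarrow> nat"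
  proof -
    have "(\<Sum>x\<in>X. f x) = f u + (\<Sum>x\<in>X - {u}. f x)" using fin uw by (intro sum.remove)
    also have "(\<Sum>x\<in>X - {u}. f x) = f w + (\<Sum>x\<in>X - {u} - {w}. f x)"
      using fin uw \<open>u \<noteq> w\<close> by (intro sum.remove) auto
    also have "X - {u} - {w} = X - {u, w}" by blast
    finally show ?thesis by simp
  qed
  have "W w < W u"
    unfolding W_def using inj fin y agree
    by (intro sum_pow2_less_if_last_difference[where y = y]) (auto intro: inj_on_subset)
  then obtain d where d: "W u = W w + d" "d > 0" using less_imp_add_positive by metis
  have "2 ^ \<rho> u < (2 ^ \<rho> w :: nat)" using uw by simp
  then have "2 ^ \<rho> u * W u + 2 ^ \<rho> w * W w < 2 ^ \<rho> w * W u + 2 ^ \<rho> u * W w"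
    using d by (simp add: algebra_simps)
  moreover have "(\<Sum>x\<in>X - {u, w}. 2 ^ ?\<rho> x * W x) = (\<Sum>x\<in>X - {u, w}. 2 ^ \<rho> x * W x)"
    by (rule sum.cong) auto
  ultimately show ?thesis
    using \<open>u \<noteq> w\<close> unfolding eq split[of "\<lambda>x. 2 ^ \<rho> x * W x"] split[of "\<lambda>x. 2 ^ ?\<rho> x * W x"] by simp
qed

locale bipartite_relation =
  fixes E :: "'a \<Rightarrow> 'a \<Rightarrow> bool" and A S :: "'a set"
  assumes sym: "E x y \<Longrightarrow> E y x" and bip: "E x y \<Longrightarrow> x \<in> A \<longleftrightarrow> y \<notin> A" and fin: "finite S"
begin

text \<open>Rows on the same side are lexicographically nondecreasing, the largest position being
  the most significant. One injective numbering orders rows and columns simultaneously.\<close>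

definition doubly_lexical :: "('a \<Rightarrow> nat) \<Rightarrow> bool" where
  "doubly_lexical \<rho> \<longleftrightarrow> inj_on \<rho> S \<and>
     (\<forall>u\<in>S. \<forall>w\<in>S. \<forall>x\<in>S. (u \<in> A \<longleftrightarrow> w \<in> A) \<and> \<rho> u < \<rho> w \<and> E u x \<and> \<not> E w x \<longrightarrow>
       (\<exists>y\<in>S. \<rho> x < \<rho> y \<and> E w y \<and> \<not> E u y \<and> (\<forall>z\<in>S. \<rho> y < \<rho> z \<longrightarrow> (E u z \<longleftrightarrow> E w z))))"

lemma doubly_lexicalD:
  assumes "doubly_lexical \<rho>" "u \<in> S" "w \<in> S" "x \<in> S" "u \<in> A \<longleftrightarrow> w \<in> A" "\<rho> u < \<rho> w" "E u x" "\<not> E w x"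
  shows "\<exists>y\<in>S. \<rho> x < \<rho> y \<and> E w y \<and> \<not> E u y \<and> (\<forall>z\<in>S. \<rho> y < \<rho> z \<longrightarrow> (E u z \<longleftrightarrow> E w z))"
  using assms unfolding doubly_lexical_def by blast

text \<open>A numbering of maximal edge weight works: exchanging two vertices that violate the order
  would increase the weight.\<close>

lemma doubly_lexical_exists: "\<exists>\<rho>. doubly_lexical \<rho>"
proof -
  let ?n = "card S"
  let ?P = "\<lambda>\<rho>. bij_betw \<rho> S {0..<?n}"
  let ?\<Phi> = "edge_weight E (S \<inter> A) (S - A)"
  obtain \<rho>\<^sub>0 where "?P \<rho>\<^sub>0" using ex_bij_betw_finite_nat[OF fin] by blast
  \<comment> \<open>A crude bound on the weight, so that a maximum exists.\<close>
  moreover have "?\<Phi> \<rho> < Suc (card (S \<inter> A) * (card (S - A) * (2 ^ ?n * 2 ^ ?n)))" if "?P \<rho>" for \<rho>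
  proof -
    have "\<rho> x < ?n" if "x \<in> S" for x using \<open>?P \<rho>\<close> that by (auto dest: bij_betwE)
    then have "2 ^ \<rho> x \<le> (2 ^ ?n :: nat)" if "x \<in> S" for x
      using that by (simp add: less_imp_le)
    then have "(if E x y then 2 ^ \<rho> x * 2 ^ \<rho> y else 0) \<le> (2 ^ ?n * 2 ^ ?n :: nat)"
      if "x \<in> S" "y \<in> S" for x y
      using that by (auto intro: mult_le_mono)
    then have "?\<Phi> \<rho> \<le> (\<Sum>x\<in>S \<inter> A. \<Sum>y\<in>S - A. 2 ^ ?n * 2 ^ ?n)"
      unfolding edge_weight_def by (intro sum_mono) auto
    then show ?thesis by simp
  qed
  ultimately obtain \<rho> where \<rho>: "?P \<rho>" and max: "\<And>\<rho>'. ?P \<rho>' \<Longrightarrow> ?\<Phi> \<rho>' \<le> ?\<Phi> \<rho>"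
    using ex_has_greatest_nat[of ?P \<rho>\<^sub>0 ?\<Phi>] by blast
  have inj: "inj_on \<rho> S" using \<rho> by (rule bij_betw_imp_inj_on)
  have "\<exists>y\<in>S. \<rho> x < \<rho> y \<and> E w y \<and> \<not> E u y \<and> (\<forall>z\<in>S. \<rho> y < \<rho> z \<longrightarrow> (E u z \<longleftrightarrow> E w z))"
    if uw: "u \<in> S" "w \<in> S" "u \<in> A \<longleftrightarrow> w \<in> A" "\<rho> u < \<rho> w" and x: "x \<in> S" "E u x" "\<not> E w x" for u w x
  proof -
    \<comment> \<open>Among the columns in which the two rows differ, the one at the largest
      position decides their order.\<close>
    let ?D = "{z \<in> S. E u z \<noteq> E w z}"
    have "finite (\<rho> ` ?D)" "\<rho> ` ?D \<noteq> {}" using fin x by auto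
    from Max_in[OF this] obtain y where y: "y \<in> ?D" "\<rho> y = Max (\<rho> ` ?D)"
      by (elim imageE) (simp del: mem_Collect_eq)
    have y_max: "\<rho> z \<le> \<rho> y" if "z \<in> ?D" for z
      unfolding y(2) using that fin by (intro Max_ge) auto
    have agree: "E u z \<longleftrightarrow> E w z" if "z \<in> S" "\<rho> y < \<rho> z" for z
    proof (rule ccontr)
      assume "E u z \<noteq> E w z"
      then have "\<rho> z \<le> \<rho> y" using that(1) by (intro y_max) simp
      with that(2) show False by simp
    qed
    have "\<not> E u y"
    proof
      assume "E u y"
      let ?\<rho> = "\<rho>(u := \<rho> w, w := \<rho> u)"
      have "?P ?\<rho>"
      proof -
        have "inj_on ?\<rho> S" using inj uw by (auto simp: inj_on_def)
        moreover have "?\<rho> ` S \<subseteq> \<rho> ` S" using uw by auto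
        moreover have "card (?\<rho> ` S) = card (\<rho> ` S)"
          using card_image[OF inj] card_image[OF \<open>inj_on ?\<rho> S\<close>] by simp
        ultimately have "?\<rho> ` S = \<rho> ` S"
          using fin by (intro card_subset_eq) auto
        with \<open>inj_on ?\<rho> S\<close> show ?thesis using \<rho> by (simp add: bij_betw_def)
      qed
      then have le: "?\<Phi> ?\<rho> \<le> ?\<Phi> \<rho>" by (rule max)
      have U: "S \<inter> A \<union> (S - A) = S" "S - A \<union> S \<inter> A = S" by auto
      have D: "S \<inter> A \<inter> (S - A) = {}" "(S - A) \<inter> (S \<inter> A) = {}" by auto
      show False
      \<comment> \<open>The exchanged vertices are both rows or both columns of the bipartite
        matrix; the second case goes through the transposed weight.\<close>
      proof (cases "u \<in> A")
        case True
        then have "?\<Phi> \<rho> < ?\<Phi> ?\<rho>"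
          using uw y(1) \<open>E u y\<close> bip[OF \<open>E u y\<close>] inj fin
          by (intro edge_weight_swap[where y = y]) (simp_all add: U agree D)
        with le show False by simp
      next
        case False
        then have "edge_weight E (S - A) (S \<inter> A) \<rho> < edge_weight E (S - A) (S \<inter> A) ?\<rho>"
          using uw y(1) \<open>E u y\<close> bip[OF \<open>E u y\<close>] inj fin
          by (intro edge_weight_swap[where y = y]) (simp_all add: U agree D)
        with le show False
          using edge_weight_commute[of E "S - A" "S \<inter> A", OF sym] by simp
      qed
    qed
    moreover from this have "E w y" using y by auto
    moreover have "\<rho> x < \<rho> y"
    proof -
      have "\<rho> x \<noteq> \<rho> y" using inj x y(1) \<open>\<not> E u y\<close> by (auto dest: inj_onD)
      with y_max[of x] x show ?thesis by auto
    qed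
    ultimately show ?thesis using y(1) agree by blast
  qed
  then have "doubly_lexical \<rho>" unfolding doubly_lexical_def using inj by blast
  then show ?thesis by blast
qed

text \<open>
  Lubiw's argument: a submatrix \<open>1 1 / 1 0\<close> (rows \<open>r 0, r 1\<close>, columns \<open>c 0, c 1\<close>) of a doubly
  lexically ordered matrix extends to ever longer sequences of rows and columns forming an induced path
  \<open>\<dots> c 3, r 2, c 1, r 0, c 0, r 1, c 2, r 3 \<dots>\<close>, as long as this path does not close to an induced cycle.
\<close>

definition staircase :: "('a \<Rightarrow> nat) \<Rightarrow> nat \<Rightarrow> (nat \<Rightarrow> 'a) \<Rightarrow> (nat \<Rightarrow> 'a) \<Rightarrow> bool" where
  "staircase \<rho> k r c \<longleftrightarrow>
     (\<forall>i\<le>k. r i \<in> S \<and> c i \<in> S \<and> (r i \<in> A \<longleftrightarrow> r 0 \<in> A) \<and> (c i \<in> A \<longleftrightarrow> r 0 \<notin> A)) \<and>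
     (\<forall>i<k. \<rho> (r i) < \<rho> (r (Suc i)) \<and> \<rho> (c i) < \<rho> (c (Suc i))) \<and>
     (\<forall>i\<le>k. \<forall>j\<le>k. E (r i) (c j) \<longleftrightarrow> i = 0 \<and> j = 0 \<or> i = Suc j \<or> j = Suc i) \<and>
     (\<forall>i. Suc (Suc i) \<le> k \<longrightarrow> (\<forall>z\<in>S.
        (\<rho> (r (Suc (Suc i))) < \<rho> z \<longrightarrow> (E (c i) z \<longleftrightarrow> E (c (Suc i)) z)) \<and>
        (\<rho> (c (Suc (Suc i))) < \<rho> z \<longrightarrow> (E (r i) z \<longleftrightarrow> E (r (Suc i)) z))))"

lemma sym_iff: "E x y \<longleftrightarrow> E y x"
  using sym by blast

lemma staircaseD:
  assumes "staircase \<rho> k r c"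
  shows "i \<le> k \<Longrightarrow> r i \<in> S \<and> c i \<in> S \<and> (r i \<in> A \<longleftrightarrow> r 0 \<in> A) \<and> (c i \<in> A \<longleftrightarrow> r 0 \<notin> A)"
    and "i < k \<Longrightarrow> \<rho> (r i) < \<rho> (r (Suc i)) \<and> \<rho> (c i) < \<rho> (c (Suc i))"
    and "i \<le> k \<Longrightarrow> j \<le> k \<Longrightarrow> E (r i) (c j) \<longleftrightarrow> i = 0 \<and> j = 0 \<or> i = Suc j \<or> j = Suc i"
    and "Suc (Suc i) \<le> k \<Longrightarrow> z \<in> S \<Longrightarrow>
        (\<rho> (r (Suc (Suc i))) < \<rho> z \<longrightarrow> (E (c i) z \<longleftrightarrow> E (c (Suc i)) z)) \<and>
        (\<rho> (c (Suc (Suc i))) < \<rho> z \<longrightarrow> (E (r i) z \<longleftrightarrow> E (r (Suc i)) z))"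
  using assms unfolding staircase_def by (blast, blast, blast, blast)

text \<open>By this symmetry the extension step has to be proved for rows only.\<close>

lemma staircase_swap:
  assumes "staircase \<rho> k r c"
  shows "staircase \<rho> k c r"
  unfolding staircase_def
proof (intro conjI allI impI ballI)
  fix i j
  assume "i \<le> k" "j \<le> k"
  then show "E (c i) (r j) \<longleftrightarrow> i = 0 \<and> j = 0 \<or> i = Suc j \<or> j = Suc i"
    using staircaseD(3)[OF assms, of j i] sym_iff by blast
next
  fix i
  assume "i \<le> k"
  then show "c i \<in> S" "r i \<in> S" "c i \<in> A \<longleftrightarrow> c 0 \<in> A" "r i \<in> A \<longleftrightarrow> c 0 \<notin> A"
    using staircaseD(1)[OF assms, of i] staircaseD(1)[OF assms, of 0] by auto
next
  fix i
  assume "i < k"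
  then show "\<rho> (c i) < \<rho> (c (Suc i))" "\<rho> (r i) < \<rho> (r (Suc i))"
    using staircaseD(2)[OF assms] by simp_all
next
  fix i z
  assume "Suc (Suc i) \<le> k" "z \<in> S"
  then show "\<rho> (c (Suc (Suc i))) < \<rho> z \<Longrightarrow> E (r i) z \<longleftrightarrow> E (r (Suc i)) z"
    and "\<rho> (r (Suc (Suc i))) < \<rho> z \<Longrightarrow> E (c i) z \<longleftrightarrow> E (c (Suc i)) z"
    using staircaseD(4)[OF assms, of i z] by simp_all
qed

lemma staircase_mono:
  assumes "staircase \<rho> k r c" "i \<le> j" "j \<le> k"
  shows "\<rho> (r i) \<le> \<rho> (r j)"
  using assms(2,3)
proof (induction j rule: dec_induct)
  case (step n)
  then have "\<rho> (r n) < \<rho> (r (Suc n))" using staircaseD(2)[OF assms(1)] by simp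
  with step show ?case by simp
qed simp

lemma staircase_inj:
  assumes "staircase \<rho> k r c"
  shows "inj_on r {..k}"
proof (rule linorder_inj_onI)
  fix i j :: nat
  assume ij: "i < j" "i \<in> {..k}" "j \<in> {..k}"
  have "\<rho> (r i) < \<rho> (r (Suc i))" using staircaseD(2)[OF assms] ij by simp
  also have "\<dots> \<le> \<rho> (r j)" using staircase_mono[OF assms, of "Suc i" j] ij by auto
  finally show "r i \<noteq> r j" by auto
qed auto

text \<open>Of the columns \<open>c (k - 1)\<close> and \<open>c k\<close>, only the first meets row
  \<open>r k\<close>. The lexical order then forces a later row \<open>y\<close> that meets only the
  second: this is the next row.\<close>

lemma staircase_extend:
  assumes lex: "doubly_lexical \<rho>" and st: "staircase \<rho> k r c" and k: "0 < k"
  obtains y where "y \<in> S" "\<rho> (r k) < \<rho> y" "\<And>j. j \<le> k \<Longrightarrow> E y (c j) \<longleftrightarrow> j = k"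
    "y \<in> A \<longleftrightarrow> r 0 \<in> A"
    "\<And>z. z \<in> S \<Longrightarrow> \<rho> y < \<rho> z \<Longrightarrow> E (c (k - 1)) z \<longleftrightarrow> E (c k) z"
proof -
  obtain l where l: "k = Suc l" using k by (cases k) auto
  have "E (c l) (r k)" "\<not> E (c k) (r k)" "\<rho> (c l) < \<rho> (c k)" "c l \<in> S" "c k \<in> S" "r k \<in> S"
    "c l \<in> A \<longleftrightarrow> c k \<in> A"
    using staircaseD(3)[OF st, of k l] staircaseD(3)[OF st, of k k] staircaseD(2)[OF st, of l]
      staircaseD(1)[OF st, of l] staircaseD(1)[OF st, of k] l sym_iff[of "r k"] by simp_all
  with doubly_lexicalD[OF lex, of "c l" "c k" "r k"]
  have "\<exists>y\<in>S. \<rho> (r k) < \<rho> y \<and> E (c k) y \<and> \<not> E (c l) y \<and>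
      (\<forall>z\<in>S. \<rho> y < \<rho> z \<longrightarrow> (E (c l) z \<longleftrightarrow> E (c k) z))" by simp
  then obtain y where y: "y \<in> S" "\<rho> (r k) < \<rho> y" "E (c k) y" "\<not> E (c l) y"
    "\<And>z. z \<in> S \<Longrightarrow> \<rho> y < \<rho> z \<Longrightarrow> E (c l) z \<longleftrightarrow> E (c k) z"
    by (elim bexE conjE) simp
  \<comment> \<open>Nonadjacency spreads downwards: \<open>y\<close> lies beyond
    \<open>r (j + 2)\<close>, and beyond that position the columns \<open>c j\<close> and
    \<open>c (Suc j)\<close> agree.\<close>
  have "\<not> E (c j) y" if "j \<le> l" for j
    using that
  proof (induction j rule: inc_induct)
    case (step j)
    have "\<rho> (r (Suc (Suc j))) < \<rho> y"
      using staircase_mono[OF st, of "Suc (Suc j)" k] y(2) step l by simp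
    then have "E (c j) y \<longleftrightarrow> E (c (Suc j)) y"
      using staircaseD(4)[OF st, of j y] y(1) step l by simp
    with step show ?case by simp
  qed (use y in simp)
  then have "E y (c j) \<longleftrightarrow> j = k" if "j \<le> k" for j
    using that y(3) l sym_iff[of y "c j"] by (auto simp: le_Suc_eq)
  moreover have "y \<in> A \<longleftrightarrow> r 0 \<in> A"
    using bip[OF y(3)] staircaseD(1)[OF st, of k] by auto
  ultimately show thesis using that[of y] y l by auto
qed

section \<open>Induced cycles from closed staircases\<close>

definition induced_cycle_list :: "'a list \<Rightarrow> bool" where
  "induced_cycle_list c \<longleftrightarrow> distinct c \<and> set c \<subseteq> S \<and>
     (\<forall>i < length c. \<forall>j < length c. E (c ! i) (c ! j) \<longleftrightarrow>
        Suc i mod length c = j \<or> Suc j mod length c = i)"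

text \<open>The path of a staircase has the ends \<open>r m\<close> and \<open>c m\<close>; here an
  additional edge joins them.\<close>

lemma closed_staircase_cycle:
  assumes in_S: "\<And>i. i \<le> m \<Longrightarrow> r i \<in> S \<and> c i \<in> S \<and> (r i \<in> A \<longleftrightarrow> r 0 \<in> A) \<and> (c i \<in> A \<longleftrightarrow> r 0 \<notin> A)"
    and inj: "inj_on r {..m}" "inj_on c {..m}" and m: "0 < m"
    and rc: "\<And>i j. i \<le> m \<Longrightarrow> j \<le> m \<Longrightarrow>
      E (r i) (c j) \<longleftrightarrow> i = 0 \<and> j = 0 \<or> i = m \<and> j = m \<or> i = Suc j \<or> j = Suc i"
  shows "\<exists>cs. induced_cycle_list cs \<and> length cs = 2 * m + 2"
proof -
  \<comment> \<open>\<open>a\<close> is the half of the path that starts with r 0, c 1, r 2, and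
    \<open>b\<close> the half that starts with c 0, r 1, c 2. They are joined only at their first
    and at their last vertices, so \<open>f\<close> runs up along \<open>a\<close> and back down
    along \<open>b\<close>.\<close>
  define a where "a i = (if even i then r i else c i)" for i
  define b where "b i = (if even i then c i else r i)" for i
  define f where "f t = (if t \<le> m then a t else b (2 * m + 1 - t))" for t
  have rr: "\<not> E (r i) (r j)" "\<not> E (c i) (c j)" "r i \<noteq> c j" "c i \<noteq> r j" if "i \<le> m" "j \<le> m" for i j
  proof -
    have "r i \<in> A \<longleftrightarrow> r j \<in> A" "c i \<in> A \<longleftrightarrow> c j \<in> A" "r i \<in> A \<longleftrightarrow> c j \<notin> A" "c i \<in> A \<longleftrightarrow> r j \<notin> A"
      using in_S[OF that(1)] in_S[OF that(2)] by simp_all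
    then show "\<not> E (r i) (r j)" "\<not> E (c i) (c j)" "r i \<noteq> c j" "c i \<noteq> r j"
      using bip by (blast, blast, metis, metis)
  qed
  have cr: "E (c i) (r j) \<longleftrightarrow> j = 0 \<and> i = 0 \<or> j = m \<and> i = m \<or> j = Suc i \<or> i = Suc j"
    if "i \<le> m" "j \<le> m" for i j
    using rc[OF that(2,1)] sym_iff by blast
  have aa: "E (a i) (a j) \<longleftrightarrow> i = Suc j \<or> j = Suc i" if "i \<le> m" "j \<le> m" for i j
    using that rr[OF that] cr[OF that] rc[OF that] by (auto simp: a_def)
  have bb: "E (b i) (b j) \<longleftrightarrow> i = Suc j \<or> j = Suc i" if "i \<le> m" "j \<le> m" for i j
    using that rr[OF that] cr[OF that] rc[OF that] by (auto simp: b_def)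
  have ab: "E (a i) (b j) \<longleftrightarrow> i = 0 \<and> j = 0 \<or> i = m \<and> j = m" if "i \<le> m" "j \<le> m" for i j
    using that rr[OF that] cr[OF that] rc[OF that] by (auto simp: a_def b_def)
  have ba: "E (b j) (a i) \<longleftrightarrow> i = 0 \<and> j = 0 \<or> i = m \<and> j = m" if "i \<le> m" "j \<le> m" for i j
    using ab[OF that] sym_iff by blast
  have inj_ab: "i = j" if "i \<le> m" "j \<le> m" "a i = a j \<or> b i = b j" for i j
    using that inj rr[OF that(1,2)] by (auto simp: a_def b_def inj_on_def split: if_splits)
  have ne_ab: "a i \<noteq> b j" if "i \<le> m" "j \<le> m" for i j
    using that inj rr[OF that] by (auto simp: a_def b_def inj_on_def split: if_splits)
  define cs where "cs = map f [0..<2 * m + 2]"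
  have len: "length cs = 2 * m + 2" by (simp add: cs_def)
  have "inj_on f {0..<2 * m + 2}"
  proof (rule inj_onI)
    fix s t
    assume st: "s \<in> {0..<2 * m + 2}" "t \<in> {0..<2 * m + 2}" "f s = f t"
    have le: "\<not> t \<le> m \<Longrightarrow> 2 * m + 1 - t \<le> m" "\<not> s \<le> m \<Longrightarrow> 2 * m + 1 - s \<le> m" by linarith+
    show "s = t"
    proof (cases "s \<le> m")
      case True
      then show ?thesis
        using st le inj_ab[of s t] ne_ab[of s "2 * m + 1 - t"] by (auto simp: f_def split: if_splits)
    next
      case False
      then show ?thesis
        using st le inj_ab[of "2 * m + 1 - s" "2 * m + 1 - t"] ne_ab[of t "2 * m + 1 - s"]
        by (auto simp: f_def split: if_splits)
    qed
  qed
  then have "distinct cs" by (simp only: cs_def distinct_map set_upt distinct_upt simp_thms)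
  moreover have "set cs \<subseteq> S"
  proof
    fix x assume "x \<in> set cs"
    then obtain t where "t < 2 * m + 2" "x = f t"
      unfolding cs_def set_map set_upt by auto
    moreover have "2 * m + 1 - t \<le> m" if "\<not> t \<le> m" using that by linarith
    ultimately show "x \<in> S" using in_S by (auto simp: f_def a_def b_def)
  qed
  moreover have "E (cs ! s) (cs ! t) \<longleftrightarrow> Suc s mod length cs = t \<or> Suc t mod length cs = s"
    if st: "s < length cs" "t < length cs" for s t
  proof -
    \<comment> \<open>Without \<open>mod\<close> the cyclic successor is accessible to linear
      arithmetic.\<close>
    have mod: "Suc x mod (2 * m + 2) = (if x = 2 * m + 1 then 0 else Suc x)" if "x < 2 * m + 2" for x
      using that by auto
    have nth: "cs ! s = f s" "cs ! t = f t" using st by (simp_all add: cs_def del: upt_Suc)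
    have st': "s < 2 * m + 2" "t < 2 * m + 2" using st len by auto
    show ?thesis
      unfolding nth len mod[OF st'(1)] mod[OF st'(2)]
    proof (cases "s \<le> m"; cases "t \<le> m")
      assume "s \<le> m" "t \<le> m"
      then show "E (f s) (f t) \<longleftrightarrow> (if s = 2 * m + 1 then 0 else Suc s) = t \<or> (if t = 2 * m +
          1 then 0 else Suc t) = s"
        using aa by (auto simp: f_def)
    next
      assume "s \<le> m" "\<not> t \<le> m"
      then show "E (f s) (f t) \<longleftrightarrow> (if s = 2 * m + 1 then 0 else Suc s) = t \<or> (if t = 2 * m +
          1 then 0 else Suc t) = s"
        using ab[of s "2 * m + 1 - t"] st' by (simp add: f_def) linarith
    next
      assume "\<not> s \<le> m" "t \<le> m"
      then show "E (f s) (f t) \<longleftrightarrow> (if s = 2 * m + 1 then 0 else Suc s) = t \<or> (if t = 2 * m +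
          1 then 0 else Suc t) = s"
        using ba[of t "2 * m + 1 - s"] st' by (simp add: f_def) linarith
    next
      assume "\<not> s \<le> m" "\<not> t \<le> m"
      then show "E (f s) (f t) \<longleftrightarrow> (if s = 2 * m + 1 then 0 else Suc s) = t \<or> (if t = 2 * m +
          1 then 0 else Suc t) = s"
        using bb[of "2 * m + 1 - s" "2 * m + 1 - t"] st' by (simp add: f_def) linarith
    qed
  qed
  ultimately show ?thesis using len unfolding induced_cycle_list_def by blast
qed

text \<open>A row and a column are added at once. They cannot be adjacent, since otherwise the
  longer staircase would close to an induced cycle.\<close>

lemma staircase_Suc:
  assumes lex: "doubly_lexical \<rho>" and st: "staircase \<rho> k r c" and k: "0 < k"
    and no_cycle: "\<And>cs. induced_cycle_list cs \<Longrightarrow> length cs \<le> 4"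
  shows "\<exists>r c. staircase \<rho> (Suc k) r c"
proof -
  obtain y where y: "y \<in> S" "\<rho> (r k) < \<rho> y" "\<And>j. j \<le> k \<Longrightarrow> E y (c j) \<longleftrightarrow> j = k"
    "y \<in> A \<longleftrightarrow> r 0 \<in> A"
    "\<And>z. z \<in> S \<Longrightarrow> \<rho> y < \<rho> z \<Longrightarrow> E (c (k - 1)) z \<longleftrightarrow> E (c k) z"
    using staircase_extend[OF lex st k] by blast
  obtain x where x: "x \<in> S" "\<rho> (c k) < \<rho> x" "\<And>j. j \<le> k \<Longrightarrow> E x (r j) \<longleftrightarrow> j = k"
    "x \<in> A \<longleftrightarrow> c 0 \<in> A"
    "\<And>z. z \<in> S \<Longrightarrow> \<rho> x < \<rho> z \<Longrightarrow> E (r (k - 1)) z \<longleftrightarrow> E (r k) z"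
    using staircase_extend[OF lex staircase_swap[OF st] k] by blast
  define r' where "r' = r(Suc k := y)"
  define c' where "c' = c(Suc k := x)"
  note st0 = staircaseD(1)[OF st] and st1 = staircaseD(2)[OF st] and st2 = staircaseD(3)[OF st]
    and st3 = staircaseD(4)[OF st]
  have new: "r' (Suc k) = y" "c' (Suc k) = x" by (simp_all add: r'_def c'_def)
  have old: "r' i = r i" "c' i = c i" if "i \<le> k" for i using that by (simp_all add: r'_def c'_def)
  have old0: "r' 0 = r 0" "c' 0 = c 0" using old by simp_all
  have 0: "r' i \<in> S \<and> c' i \<in> S \<and> (r' i \<in> A \<longleftrightarrow> r' 0 \<in> A) \<and> (c' i \<in> A \<longleftrightarrow> r' 0 \<notin> A)" if "i \<le> Suc k" for i
  proof (cases "i = Suc k")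
    case True
    then show ?thesis using new x(1,4) y(1,4) st0[of 0] by (simp add: old0)
  next
    case False
    then show ?thesis using that st0[of i] old[of i] by (simp add: old0)
  qed
  have 1: "\<rho> (r' i) < \<rho> (r' (Suc i)) \<and> \<rho> (c' i) < \<rho> (c' (Suc i))" if "i < Suc k" for i
  proof (cases "i = k")
    case True
    then show ?thesis using new old[of k] x(2) y(2) by simp
  next
    case False
    then show ?thesis using that st1[of i] old[of i] old[of "Suc i"] by simp
  qed
  have 2: "E (r' i) (c' j) \<longleftrightarrow> i = 0 \<and> j = 0 \<or> i = Suc j \<or> j = Suc i \<or> i = Suc k \<and> j = Suc k \<and> E y x"
    if "i \<le> Suc k" "j \<le> Suc k" for i j
  proof (cases "i = Suc k"; cases "j = Suc k")
    assume "i = Suc k" "j = Suc k"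
    then show ?thesis using new by simp
  next
    assume "i = Suc k" "j \<noteq> Suc k"
    then show ?thesis using that new old[of j] y(3)[of j] by auto
  next
    assume "i \<noteq> Suc k" "j = Suc k"
    then show ?thesis using that new old[of i] x(3)[of i] sym_iff[of "r i" x] by auto
  next
    assume "i \<noteq> Suc k" "j \<noteq> Suc k"
    then show ?thesis using that old[of i] old[of j] st2[of i j] by simp
  qed
  have inj: "inj_on r' {..Suc k}" "inj_on c' {..Suc k}"
  proof -
    have "y \<noteq> r j" if "j \<le> k" for j using staircase_mono[OF st that] y(2) by auto
    then have "y \<notin> r' ` {..k}" using old by auto
    moreover have "inj_on r' {..k}" using staircase_inj[OF st] old inj_on_cong[of "{..k}" r' r] by simp
    ultimately show "inj_on r' {..Suc k}" using new by (simp add: atMost_Suc)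
    have "x \<noteq> c j" if "j \<le> k" for j using staircase_mono[OF staircase_swap[OF st] that] x(2) by auto
    then have "x \<notin> c' ` {..k}" using old by auto
    moreover have "inj_on c' {..k}"
      using staircase_inj[OF staircase_swap[OF st]] old inj_on_cong[of "{..k}" c' c] by simp
    ultimately show "inj_on c' {..Suc k}" using new by (simp add: atMost_Suc)
  qed
  have "\<not> E y x"
  proof
    assume "E y x"
    \<comment> \<open>As \<open>0 < k\<close>, this cycle has length at least six.\<close>
    have "\<exists>cs. induced_cycle_list cs \<and> length cs = 2 * Suc k + 2"
    proof (rule closed_staircase_cycle[OF 0 inj])
      fix i j assume "i \<le> Suc k" "j \<le> Suc k"
      then show "E (r' i) (c' j) \<longleftrightarrow> i = 0 \<and> j = 0 \<or> i = Suc k \<and> j = Suc k \<or> i = Suc j \<or> j = Suc i"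
        using 2[of i j] \<open>E y x\<close> by blast
    qed simp_all
    then obtain cs where "induced_cycle_list cs" "length cs = 2 * Suc k + 2" by blast
    with no_cycle[of cs] k show False by simp
  qed
  have "staircase \<rho> (Suc k) r' c'"
    unfolding staircase_def
  proof (intro conjI allI impI ballI)
    fix i z
    assume i: "Suc (Suc i) \<le> Suc k" and z: "z \<in> S"
    have "(E (c' i) z \<longleftrightarrow> E (c' (Suc i)) z) \<or> \<not> \<rho> (r' (Suc (Suc i))) < \<rho> z"
      and "(E (r' i) z \<longleftrightarrow> E (r' (Suc i)) z) \<or> \<not> \<rho> (c' (Suc (Suc i))) < \<rho> z"
    proof (atomize (full), cases "Suc i = k")
      case True
      then have "i = k - 1" by simp
      then show "((E (c' i) z \<longleftrightarrow> E (c' (Suc i)) z) \<or> \<not> \<rho> (r' (Suc (Suc i))) < \<rho> z) \<and>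
        ((E (r' i) z \<longleftrightarrow> E (r' (Suc i)) z) \<or> \<not> \<rho> (c' (Suc (Suc i))) < \<rho> z)"
        using True new old[of i] old[of k] y(5)[OF z] x(5)[OF z] by auto
    next
      case False
      then show "((E (c' i) z \<longleftrightarrow> E (c' (Suc i)) z) \<or> \<not> \<rho> (r' (Suc (Suc i))) < \<rho> z) \<and>
        ((E (r' i) z \<longleftrightarrow> E (r' (Suc i)) z) \<or> \<not> \<rho> (c' (Suc (Suc i))) < \<rho> z)"
        using i old[of i] old[of "Suc i"] old[of "Suc (Suc i)"] st3[of i z, OF _ z] by auto
    qed
    then show "E (c' i) z \<longleftrightarrow> E (c' (Suc i)) z" if "\<rho> (r' (Suc (Suc i))) < \<rho> z"
      using that by blast
    show "E (r' i) z \<longleftrightarrow> E (r' (Suc i)) z" if "\<rho> (c' (Suc (Suc i))) < \<rho> z"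
      using that \<open>(E (r' i) z \<longleftrightarrow> E (r' (Suc i)) z) \<or> \<not> \<rho> (c' (Suc (Suc i))) < \<rho> z\<close> by blast
  next
    fix i assume "i \<le> Suc k"
    then show "r' i \<in> S" "c' i \<in> S" "r' i \<in> A \<longleftrightarrow> r' 0 \<in> A" "c' i \<in> A \<longleftrightarrow> r' 0 \<notin> A"
      using 0 by (blast, blast, blast, blast)
  next
    fix i assume "i < Suc k"
    then show "\<rho> (r' i) < \<rho> (r' (Suc i))" "\<rho> (c' i) < \<rho> (c' (Suc i))"
      using 1 by (blast, blast)
  next
    fix i j assume "i \<le> Suc k" "j \<le> Suc k"
    then show "E (r' i) (c' j) \<longleftrightarrow> i = 0 \<and> j = 0 \<or> i = Suc j \<or> j = Suc i"
      using 2 \<open>\<not> E y x\<close> by blast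
  qed
  then show ?thesis by blast
qed

text \<open>The first vertex of a doubly lexical ordering works. If the neighbourhoods of two of its
  neighbours were not nested in the order of their positions, a staircase would start there and
  could be extended beyond the size of \<open>S\<close>.\<close>

theorem simple_vertex_exists:
  assumes no_cycle: "\<And>cs. induced_cycle_list cs \<Longrightarrow> length cs \<le> 4" and "S \<noteq> {}"
  shows "\<exists>v\<in>S. \<forall>u\<in>S. \<forall>w\<in>S. E v u \<and> E v w \<longrightarrow>
    (\<forall>z\<in>S. E u z \<longrightarrow> E w z) \<or> (\<forall>z\<in>S. E w z \<longrightarrow> E u z)"
proof -
  obtain \<rho> where lex: "doubly_lexical \<rho>" using doubly_lexical_exists by blast
  then have inj: "inj_on \<rho> S" unfolding doubly_lexical_def by blast
  obtain v where v: "v \<in> S" "\<And>x. x \<in> S \<Longrightarrow> \<rho> v \<le> \<rho> x"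
    using \<open>S \<noteq> {}\<close> ex_has_least_nat[of "\<lambda>x. x \<in> S" _ \<rho>] by blast
  have key: "E w x" if "u \<in> S" "w \<in> S" "E v u" "E v w" "\<rho> u < \<rho> w" "x \<in> S" "E u x" for u w x
  proof (rule ccontr)
    assume "\<not> E w x"
    have "x \<noteq> v" using \<open>\<not> E w x\<close> sym[OF \<open>E v w\<close>] by blast
    then have "\<rho> v \<noteq> \<rho> x" using inj_onD[OF inj] v(1) \<open>x \<in> S\<close> by blast
    then have "\<rho> v < \<rho> x" using v(2)[OF \<open>x \<in> S\<close>] by simp
    \<comment> \<open>The rows v, x and the columns u, w form the submatrix 1 1 / 1 0.\<close>
    let ?r = "\<lambda>i. if i = 0 then v else x" and ?c = "\<lambda>i. if i = 0 then u else w"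
    have base: "staircase \<rho> 1 ?r ?c"
      unfolding staircase_def
      using that v(1) \<open>\<rho> v < \<rho> x\<close> \<open>\<not> E w x\<close> sym_iff[of x] bip[OF \<open>E v u\<close>] bip[OF \<open>E v w\<close>] bip[OF \<open>E u x\<close>]
      by (intro conjI allI impI) (auto simp: le_Suc_eq)
    have "\<exists>r c. staircase \<rho> (Suc k) r c" for k
    proof (induction k)
      case 0
      then show ?case using base by auto
    next
      case (Suc k)
      then show ?case using staircase_Suc[OF lex _ _ no_cycle] by blast
    qed
    \<comment> \<open>This staircase has \<open>card S + 2\<close> rows, which would be distinct
      elements of \<open>S\<close>.\<close>
    then obtain r c where rc: "staircase \<rho> (Suc (card S)) r c" by blast
    then have "r ` {..Suc (card S)} \<subseteq> S" using staircaseD(1) by blast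
    then have "card (r ` {..Suc (card S)}) \<le> card S" by (rule card_mono[OF fin])
    then show False using card_image[OF staircase_inj[OF rc]] by simp
  qed
  show ?thesis
  proof (intro bexI[OF _ v(1)] ballI impI)
    fix u w
    assume "u \<in> S" "w \<in> S" "E v u \<and> E v w"
    moreover have "\<rho> u < \<rho> w \<or> \<rho> w < \<rho> u \<or> u = w"
      using inj \<open>u \<in> S\<close> \<open>w \<in> S\<close> by (metis inj_onD linorder_neqE_nat)
    ultimately show "(\<forall>z\<in>S. E u z \<longrightarrow> E w z) \<or> (\<forall>z\<in>S. E w z \<longrightarrow> E u z)"
      using key by blast
  qed
qed

end

section \<open>Extending minimal transversals of closed neighbourhoods\<close>

locale neighbourhoods =
  fixes V :: "'a set" and N :: "'a \<Rightarrow> 'a set"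
  assumes fin: "finite V" and N_subset: "u \<in> V \<Longrightarrow> N u \<subseteq> V"
    and N_sym: "u \<in> V \<Longrightarrow> v \<in> V \<Longrightarrow> u \<in> N v \<longleftrightarrow> v \<in> N u"
begin

section \<open>Transversals and greedy minimisation\<close>

definition closed_nbhd :: "'a \<Rightarrow> 'a set" where
  "closed_nbhd u = insert u (N u)"

definition transversal :: "'a set \<Rightarrow> 'a set \<Rightarrow> bool" where
  "transversal S D \<longleftrightarrow> (\<forall>u\<in>V. closed_nbhd u \<subseteq> S \<longrightarrow> closed_nbhd u \<inter> D \<noteq> {})"

definition minimal_transversal :: "'a set \<Rightarrow> 'a set \<Rightarrow> bool" where
  "minimal_transversal S D \<longleftrightarrow> D \<subseteq> V \<and> transversal S D \<and> (\<forall>x\<in>D. \<not> transversal S (D - {x}))"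

text \<open>The fixed order of the list makes the parent a function of the transversal.\<close>

definition shrink :: "'a set \<Rightarrow> 'a set \<Rightarrow> 'a list \<Rightarrow> 'a set" where
  "shrink S D us = foldl (\<lambda>R u. if transversal S (R - {u}) then R - {u} else R) D us"

definition simple :: "'a set \<Rightarrow> 'a \<Rightarrow> bool" where
  "simple S v \<longleftrightarrow> (\<forall>u\<in>V. \<forall>w\<in>V. closed_nbhd u \<subseteq> S \<and> v \<in> N u \<and> closed_nbhd w \<subseteq> S \<and> v \<in> N w \<longrightarrow>
      N u \<subseteq> N w \<or> N w \<subseteq> N u)"

text \<open>The centres that must be added because their edges miss \<open>Y\<close>. An edge
  contains its centre, so for \<open>S' = insert v S\<close> with \<open>v\<close> outside
  \<open>S\<close> the clause \<open>u \<in> S\<close> excludes just \<open>u = v\<close>.\<close>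

definition fill :: "'a set \<Rightarrow> 'a set \<Rightarrow> 'a set \<Rightarrow> 'a set" where
  "fill S S' Y = {u \<in> V. u \<in> S \<and> closed_nbhd u \<subseteq> S' \<and> closed_nbhd u \<inter> Y = {}}"

lemma transversal_mono: "transversal S D \<Longrightarrow> D \<subseteq> D' \<Longrightarrow> transversal S D'"
  unfolding transversal_def by blast

lemma transversal_antimono: "transversal S' D \<Longrightarrow> S \<subseteq> S' \<Longrightarrow> transversal S D"
  unfolding transversal_def by blast

lemma transversal_insert:
  assumes "transversal S D" "v \<in> D"
  shows "transversal (insert v S) D"
  unfolding transversal_def
proof (intro ballI impI)
  fix u assume u: "u \<in> V" "closed_nbhd u \<subseteq> insert v S"
  show "closed_nbhd u \<inter> D \<noteq> {}"
  proof (cases "v \<in> closed_nbhd u")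
    case False
    then have "closed_nbhd u \<subseteq> S" using u(2) by blast
    then show ?thesis using assms(1) u(1) unfolding transversal_def by simp
  qed (use assms(2) in blast)
qed

lemma closed_nbhd_subset: "u \<in> V \<Longrightarrow> closed_nbhd u \<subseteq> V"
  using N_subset by (auto simp: closed_nbhd_def)

lemma shrink_subset: "shrink S D us \<subseteq> D"
  unfolding shrink_def
proof (induction us arbitrary: D)
  case (Cons u us)
  show ?case using Cons.IH[of "if transversal S (D - {u}) then D - {u} else D"] by (auto split: if_splits)
qed simp

lemma shrink_Cons: "shrink S D (u # us) = shrink S (if transversal S (D - {u}) then D - {u} else D) us"
  by (simp add: shrink_def)

lemma transversal_shrink: "transversal S D \<Longrightarrow> transversal S (shrink S D us)"
proof (induction us arbitrary: D)
  case (Cons u us)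
  show ?case unfolding shrink_Cons by (rule Cons.IH) (use Cons.prems in simp)
qed (simp add: shrink_def)

text \<open>One pass suffices: a vertex kept at its turn could not be removed from a superset of the
  result, so it cannot be removed from the result.\<close>

lemma shrink_irredundant:
  "x \<in> set us \<Longrightarrow> x \<in> shrink S D us \<Longrightarrow> \<not> transversal S (shrink S D us - {x})"
proof (induction us arbitrary: D)
  case (Cons u us)
  let ?D = "if transversal S (D - {u}) then D - {u} else D"
  show ?case
  proof (cases "x \<in> set us")
    case True
    then show ?thesis using Cons.IH[OF True] Cons.prems(2) unfolding shrink_Cons by simp
  next
    case False
    then have "x = u" using Cons.prems by simp
    have "x \<in> ?D" using Cons.prems(2) shrink_subset[of S ?D us] unfolding shrink_Cons by blast
    with \<open>x = u\<close> have "\<not> transversal S (D - {u})" "?D = D" by (auto split: if_splits)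
    then show ?thesis
      using transversal_mono[of S "shrink S D us - {x}" "D - {u}"] shrink_subset[of S D us] \<open>x = u\<close>
      unfolding shrink_Cons by auto
  qed
qed simp

lemma minimal_transversal_shrink:
  assumes "transversal S D" "D \<subseteq> V" "set us = V"
  shows "minimal_transversal S (shrink S D us)"
  unfolding minimal_transversal_def
proof (intro conjI ballI)
  show sub: "shrink S D us \<subseteq> V" using shrink_subset assms(2) by (rule order_trans)
  show "\<not> transversal S (shrink S D us - {x})" if "x \<in> shrink S D us" for x
    using shrink_irredundant that sub assms(3) by auto
qed (rule transversal_shrink[OF assms(1)])

lemma minimal_transversal_subset_eq: "minimal_transversal S D \<Longrightarrow> D' \<subseteq> D \<Longrightarrow> transversal S D' \<Longrightarrow> D' = D"
proof (rule ccontr)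
  assume "minimal_transversal S D" "D' \<subseteq> D" "transversal S D'" "D' \<noteq> D"
  then obtain x where "x \<in> D" "D' \<subseteq> D - {x}" by blast
  moreover from this have "transversal S (D - {x})" using transversal_mono[OF \<open>transversal S D'\<close>] by simp
  ultimately show False using \<open>minimal_transversal S D\<close> unfolding minimal_transversal_def by simp
qed

text \<open>For dominating sets, \<open>u\<close> is a private neighbour of
  \<open>x\<close>.\<close>

lemma minimal_transversal_private:
  assumes "minimal_transversal S D" "x \<in> D"
  obtains u where "u \<in> V" "closed_nbhd u \<subseteq> S" "closed_nbhd u \<inter> D = {x}"
proof -
  have "transversal S D" "\<not> transversal S (D - {x})" using assms unfolding minimal_transversal_def by simp_all
  then obtain u where u: "u \<in> V" "closed_nbhd u \<subseteq> S" "closed_nbhd u \<inter> (D - {x}) = {}"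
    unfolding transversal_def by blast
  with \<open>transversal S D\<close> have "closed_nbhd u \<inter> D \<noteq> {}" unfolding transversal_def by simp
  with u that show thesis by blast
qed

text \<open>
  Let \<open>u\<close> have the smallest neighbourhood among the new edges, other than that of \<open>v\<close>, that are met by
  \<open>D\<close> in a neighbour of their centre. As these neighbourhoods form a chain, one such neighbour \<open>z\<close> of
  \<open>u\<close> serves all of them, and the other new edges are met in their centres only. Given \<open>z\<close>, at most one
  more vertex is needed, namely for the edge of \<open>v\<close>.
\<close>

lemma extension_form:
  assumes v: "v \<notin> S" "S \<subseteq> V" "v \<in> V" and simple: "simple (insert v S) v"
    and D: "minimal_transversal (insert v S) D" and T: "T \<subseteq> D" "transversal S T"
  shows "\<exists>Z\<in>insert {} ((\<lambda>x. {x}) ` V). \<exists>W\<in>insert {} ((\<lambda>x. {x}) ` V).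
    D = T \<union> Z \<union> fill S (insert v S) (T \<union> Z) \<union> W"
proof -
  let ?S = "insert v S"
  have "D \<subseteq> V" and trD: "transversal ?S D" using D unfolding minimal_transversal_def by auto
  define B where "B = {u \<in> V. u \<in> S \<and> closed_nbhd u \<subseteq> ?S \<and> closed_nbhd u \<inter> T = {}}"
  have new: "v \<in> closed_nbhd u" if "u \<in> V" "closed_nbhd u \<subseteq> ?S" "closed_nbhd u \<inter> T = {}" for u
  proof (rule ccontr)
    assume "v \<notin> closed_nbhd u"
    then have "closed_nbhd u \<subseteq> S" using that by blast
    with T(2) that(1) have "closed_nbhd u \<inter> T \<noteq> {}" unfolding transversal_def by simp
    with that(3) show False by simp
  qed
  have B: "v \<in> N u" if "u \<in> B" for u
    using new[of u] that v(1) by (auto simp: B_def closed_nbhd_def)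
  have "\<exists>Z. (Z = {} \<or> (\<exists>z\<in>D. Z = {z})) \<and> (\<forall>u\<in>B. N u \<inter> D \<noteq> {} \<longrightarrow> N u \<inter> Z \<noteq> {})"
  proof (cases "\<exists>u\<in>B. N u \<inter> D \<noteq> {}")
    case True
    then obtain u where u: "u \<in> B" "N u \<inter> D \<noteq> {}"
      and min: "\<And>w. w \<in> B \<Longrightarrow> N w \<inter> D \<noteq> {} \<Longrightarrow> card (N u) \<le> card (N w)"
    proof -
      from True obtain u\<^sub>0 where "u\<^sub>0 \<in> B \<and> N u\<^sub>0 \<inter> D \<noteq> {}" by blast
      from ex_has_least_nat[of "\<lambda>u. u \<in> B \<and> N u \<inter> D \<noteq> {}", OF this, of "\<lambda>u. card (N u)"]
      obtain u where "(u \<in> B \<and> N u \<inter> D \<noteq> {}) \<and>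
          (\<forall>w. w \<in> B \<and> N w \<inter> D \<noteq> {} \<longrightarrow> card (N u) \<le> card (N w))" by (elim exE)
      then show thesis by (intro that[of u]) simp_all
    qed
    from u(2) obtain z where z: "z \<in> N u" "z \<in> D" by blast
    have "z \<in> N w" if w: "w \<in> B" "N w \<inter> D \<noteq> {}" for w
    proof -
      have *: "u \<in> V" "w \<in> V" "closed_nbhd u \<subseteq> ?S" "closed_nbhd w \<subseteq> ?S" using u(1) w(1) by (auto simp: B_def)
      then have "N u \<subseteq> N w \<or> N w \<subseteq> N u"
        using simple B[OF u(1)] B[OF w(1)] unfolding simple_def by simp
      \<comment> \<open>By the choice of \<open>u\<close>, a neighbourhood of this kind inside
        \<open>N u\<close> cannot be smaller than \<open>N u\<close>.\<close>
      moreover have "N w = N u" if "N w \<subseteq> N u"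
        using card_seteq[OF finite_subset[OF N_subset[OF *(1)] fin] that min[OF w]] .
      ultimately have "N u \<subseteq> N w" by (elim disjE) simp_all
      with z(1) show ?thesis by (rule subsetD[rotated])
    qed
    then have "\<forall>w\<in>B. N w \<inter> D \<noteq> {} \<longrightarrow> N w \<inter> {z} \<noteq> {}" by simp
    with z(2) show ?thesis by (intro exI[of _ "{z}"]) simp
  next
    case False
    then show ?thesis by (intro exI[of _ "{}"]) simp
  qed
  then obtain Z where Z1: "Z = {} \<or> (\<exists>z\<in>D. Z = {z})"
    and Z2: "\<forall>u\<in>B. N u \<inter> D \<noteq> {} \<longrightarrow> N u \<inter> Z \<noteq> {}" by (elim exE conjE)
  have "Z \<subseteq> D" using Z1 by auto
  define F where "F = fill S ?S (T \<union> Z)"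
  have "F \<subseteq> D"
  proof
    fix u assume "u \<in> F"
    then have u: "u \<in> V" "u \<in> S" "closed_nbhd u \<subseteq> ?S" "closed_nbhd u \<inter> T = {}" "closed_nbhd u \<inter> Z = {}"
      by (auto simp: F_def fill_def)
    then have "u \<in> B" "N u \<inter> Z = {}" by (auto simp: B_def closed_nbhd_def)
    then have "N u \<inter> D = {}" using Z2 by blast
    moreover have "closed_nbhd u \<inter> D \<noteq> {}" using trD u(1,3) unfolding transversal_def by simp
    ultimately show "u \<in> D" by (auto simp: closed_nbhd_def)
  qed
  \<comment> \<open>A further vertex \<open>x\<close> of \<open>D\<close> has a private edge. A
    centre in \<open>S\<close> would have been filled in and so be \<open>x\<close> itself, which is
    excluded. Hence the edge is that of \<open>v\<close>, the same for all such \<open>x\<close>,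
    and there is at most one.\<close>
  have rest: "closed_nbhd v \<inter> D = {x}" if x: "x \<in> D" "x \<notin> T \<union> Z \<union> F" for x
  proof -
    obtain u where u: "u \<in> V" "closed_nbhd u \<subseteq> ?S" "closed_nbhd u \<inter> D = {x}"
        using minimal_transversal_private[OF D x(1)] .
    have none: "closed_nbhd u \<inter> (T \<union> Z) = {}"
    proof -
      have "closed_nbhd u \<inter> (T \<union> Z) \<subseteq> {x}" using u(3) T(1) \<open>Z \<subseteq> D\<close> by blast
      with x(2) show ?thesis by blast
    qed
    have "u \<in> closed_nbhd u" by (simp add: closed_nbhd_def)
    have "u = v"
    proof (rule ccontr)
      assume "u \<noteq> v"
      then have "u \<in> S" using u(2) \<open>u \<in> closed_nbhd u\<close> by blast
      then have "u \<in> F" using u(1,2) none by (simp add: F_def fill_def)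
      moreover from this have "u = x" using \<open>F \<subseteq> D\<close> u(3) \<open>u \<in> closed_nbhd u\<close> by blast
      ultimately show False using x(2) by simp
    qed
    with u(3) show ?thesis by simp
  qed
  have "T \<union> Z \<union> F \<subseteq> D" using T(1) \<open>Z \<subseteq> D\<close> \<open>F \<subseteq> D\<close> by simp
  have "\<exists>W\<in>insert {} ((\<lambda>x. {x}) ` V). D = T \<union> Z \<union> F \<union> W"
  proof (cases "D = T \<union> Z \<union> F")
    case False
    then obtain x where x: "x \<in> D" "x \<notin> T \<union> Z \<union> F" using \<open>T \<union> Z \<union> F \<subseteq> D\<close> by blast
    have "y = x" if "y \<in> D" "y \<notin> T \<union> Z \<union> F" for y using rest[OF x] rest[OF that] by simp
    then have "D \<subseteq> T \<union> Z \<union> F \<union> {x}" by auto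
    then have "D = T \<union> Z \<union> F \<union> {x}" using x(1) \<open>T \<union> Z \<union> F \<subseteq> D\<close> by (intro equalityI) auto
    moreover have "{x} \<in> insert {} ((\<lambda>x. {x}) ` V)" using x(1) \<open>D \<subseteq> V\<close> by auto
    ultimately show ?thesis by (rule bexI)
  next
    case True
    then have "D = T \<union> Z \<union> F \<union> {}" by simp
    then show ?thesis by (rule bexI) simp
  qed
  moreover have "Z \<in> insert {} ((\<lambda>x. {x}) ` V)" using Z1 \<open>D \<subseteq> V\<close> by auto
  ultimately show ?thesis unfolding F_def by (rule bexI)
qed

text \<open>No edge inside \<open>S\<close> contains \<open>v\<close>. So the vertices of
  \<open>T\<close> keep their private edges when \<open>v\<close> is added, and shrinking
  \<open>insert v T\<close> with respect to \<open>S\<close> discards \<open>v\<close> and nothing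
  else.\<close>

lemma extension_exists:
  assumes v: "v \<notin> S" "v \<in> V" and T: "minimal_transversal S T" and us: "set us = V"
  shows "\<exists>D. minimal_transversal (insert v S) D \<and> shrink S D us = T"
proof -
  have trT: "transversal S T" and "T \<subseteq> V" using T unfolding minimal_transversal_def by auto
  have irr: "\<not> transversal (insert v S) (T - {x})" if "x \<in> T" for x
  proof
    assume "transversal (insert v S) (T - {x})"
    then have "transversal S (T - {x})" by (rule transversal_antimono) blast
    with T that show False unfolding minimal_transversal_def by simp
  qed
  show ?thesis
  proof (cases "transversal (insert v S) T")
    case True
    then have "minimal_transversal (insert v S) T" using irr \<open>T \<subseteq> V\<close> unfolding minimal_transversal_def by simp
    moreover have "shrink S T us = T"
      using minimal_transversal_subset_eq[OF T shrink_subset transversal_shrink[OF trT]] .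
    ultimately show ?thesis by blast
  next
    case False
    let ?D = "insert v T"
    have v_irrelevant: "transversal S (X - {v}) \<longleftrightarrow> transversal S X" for X
    proof -
      have "closed_nbhd u \<inter> (X - {v}) = closed_nbhd u \<inter> X" if "closed_nbhd u \<subseteq> S" for u using v(1) that
          by blast
      then show ?thesis unfolding transversal_def by simp
    qed
    have "v \<notin> T"
      using False transversal_insert[OF trT] by blast
    have "transversal (insert v S) ?D"
      by (rule transversal_insert[OF transversal_mono[OF trT]]) auto
    moreover have "\<not> transversal (insert v S) (?D - {x})" if "x \<in> ?D" for x
    proof (cases "x = v")
      case True
      then show ?thesis using False \<open>v \<notin> T\<close> by simp
    next
      case False
      have "\<not> transversal S (T - {x})" using T that False unfolding minimal_transversal_def by simp
      moreover have "?D - {x} - {v} = T - {x}" using \<open>v \<notin> T\<close> by blast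
      ultimately have "\<not> transversal S (?D - {x})" using v_irrelevant[of "?D - {x}"] by simp
      then show ?thesis using transversal_antimono[of "insert v S" "?D - {x}" S] by blast
    qed
    ultimately have "minimal_transversal (insert v S) ?D" using v(2) \<open>T \<subseteq> V\<close>
        unfolding minimal_transversal_def by simp
    moreover have "shrink S ?D us = T"
    proof -
      have "transversal S ?D" using transversal_mono[OF trT] by blast
      then have P: "minimal_transversal S (shrink S ?D us)" using us v(2) \<open>T \<subseteq> V\<close>
          by (intro minimal_transversal_shrink) auto
      then have "transversal S (shrink S ?D us)" unfolding minimal_transversal_def by simp
      then have "transversal S (shrink S ?D us - {v})" by (simp only: v_irrelevant)
      then have "v \<notin> shrink S ?D us" using P unfolding minimal_transversal_def by auto
      with shrink_subset[of S ?D us] have "shrink S ?D us \<subseteq> T" by blast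
      with \<open>transversal S (shrink S ?D us)\<close> show ?thesis using minimal_transversal_subset_eq[OF T] by blast
    qed
    ultimately show ?thesis by blast
  qed
qed

end

section \<open>Depth-first enumeration\<close>

text \<open>\<open>fuel d f t\<close>: at most \<open>f\<close> steps until the first output, and at most \<open>d\<close> steps after each output.\<close>

fun fuel :: "nat \<Rightarrow> nat \<Rightarrow> trace \<Rightarrow> bool" where
  "fuel d f [] \<longleftrightarrow> True"
| "fuel d f ((s, None) # t) \<longleftrightarrow> 0 < f \<and> fuel d (f - 1) t"
| "fuel d f ((s, Some v) # t) \<longleftrightarrow> fuel d d t"

lemma fuel_mono: "fuel d f t \<Longrightarrow> f \<le> g \<Longrightarrow> fuel d g t"
proof (induction d f t arbitrary: g rule: fuel.induct)
  case (2 d f s t)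
  then show ?case using "2.IH"[of "g - 1"] by auto
qed auto

lemma fuel_mono_left: "fuel d f t \<Longrightarrow> d \<le> e \<Longrightarrow> fuel e f t"
proof (induction d f t rule: fuel.induct)
  case (3 d f s v t)
  then show ?case using fuel_mono[of e d t e] by auto
qed auto

lemma fuel_silent: "outputs u = [] \<Longrightarrow> fuel d f t \<Longrightarrow> length u + f \<le> g \<Longrightarrow> fuel d g (u @ t)"
proof (induction u arbitrary: g)
  case Nil
  then show ?case using fuel_mono by simp
next
  case (Cons x u)
  obtain s where "x = (s, None)" "outputs u = []"
    using Cons.prems(1) by (cases x, cases "snd x") (auto simp: outputs_simps)
  then show ?case using Cons.IH[of "g - 1"] Cons.prems(2,3) by simp
qed

text \<open>\<open>fuel\<close> reads the trace from the left and so suits induction on executions,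
  unlike the blocks of \<open>delay_at_most\<close>. Its budget never exceeds \<open>d\<close> and
  hence bounds every silent block.\<close>

lemma fuel_delay:
  assumes "fuel d f t" "f \<le> d"
  shows "delay_at_most d t"
  unfolding delay_at_most_def
proof (intro allI impI)
  fix t1 b t2
  assume "t = t1 @ b @ t2 \<and> outputs b = []"
  then have t: "fuel d f (t1 @ b @ t2)" and b: "outputs b = []" using assms(1) by auto
  have len: "length b \<le> g" if "fuel d g (b @ t2)" for g
    using that b
  proof (induction b arbitrary: g)
    case (Cons x b)
    obtain s where "x = (s, None)" "outputs b = []"
      using Cons.prems(2) by (cases x, cases "snd x") (auto simp: outputs_simps)
    then show ?case using Cons.IH[of "g - 1"] Cons.prems(1) by fastforce
  qed simp
  show "length b \<le> d"
    using t assms(2)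
  proof (induction t1 arbitrary: f)
    case Nil
    then show ?case using len[of f] by simp
  next
    case (Cons x t1)
    obtain s v where x: "x = (s, v)" by (cases x)
    show ?case
    proof (cases v)
      case None
      then show ?thesis using Cons.IH[of "f - 1"] Cons.prems x by simp
    next
      case (Some w)
      then show ?thesis using Cons.IH[of d] Cons.prems x by simp
    qed
  qed
qed

section \<open>Search trees and the stack\<close>

fun leaves :: "('x \<Rightarrow> 'x list) \<Rightarrow> nat \<Rightarrow> 'x \<Rightarrow> 'x list" where
  "leaves k 0 x = [x]"
| "leaves k (Suc h) x = concat (map (leaves k h) (k x))"

text \<open>The induction measure for the search loop; its size does not enter any time
  bound.\<close>

fun nodes :: "('x \<Rightarrow> 'x list) \<Rightarrow> nat \<Rightarrow> 'x \<Rightarrow> nat" where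
  "nodes k 0 x = 1"
| "nodes k (Suc h) x = Suc (\<Sum>y\<leftarrow>k x. nodes k h y)"

text \<open>\<open>h\<close> is the distance of a node to the leaves and \<open>n\<close> that of
  the root. Each of the \<open>n - h\<close> levels passed on the way down contributes at most
  \<open>c\<close> waiting nodes.\<close>

fun stack_inv :: "(nat \<Rightarrow> 'x \<Rightarrow> bool) \<Rightarrow> nat \<Rightarrow> nat \<Rightarrow> (nat \<times> 'x) list \<Rightarrow> bool" where
  "stack_inv good c n [] \<longleftrightarrow> True"
| "stack_inv good c n ((h, x) # st) \<longleftrightarrow>
     good h x \<and> h \<le> n \<and> length st \<le> c * (n - h) \<and> stack_inv good c n st"

lemma stack_inv_push:
  assumes "stack_inv good c n st" "h \<le> n" "\<And>y. y \<in> set ys \<Longrightarrow> good h y"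
    "length ys + length st \<le> c * (n - h)"
  shows "stack_inv good c n (map (\<lambda>y. (h, y)) ys @ st)"
  using assms by (induction ys) auto

lemma stack_inv_length:
  assumes "stack_inv good c n st"
  shows "length st \<le> Suc (c * n)"
proof (cases st)
  case (Cons p st')
  obtain h x where "p = (h, x)" by (cases p)
  then have "length st' \<le> c * (n - h)" using assms Cons by simp
  also have "\<dots> \<le> c * n" by (intro mult_le_mono2) simp
  finally show ?thesis using Cons by simp
qed simp

lemma stack_inv_good: "stack_inv good c n st \<Longrightarrow> p \<in> set st \<Longrightarrow> \<exists>h. good h (snd p)"
  by (induction good c n st rule: stack_inv.induct) auto

text \<open>A search step as a pure function, to which the closure properties apply: it returns a
  list of at most one output, and the new stack together with the unchanged environment.\<close>

definition expand :: "('e \<Rightarrow> 'x \<Rightarrow> 'x list) \<Rightarrow> ('x \<Rightarrow> bool) \<Rightarrow> ('x \<Rightarrow> 'o) \<Rightarrow>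
    ('x \<times> 'x list) \<times> 'e \<Rightarrow> 'o list \<times> ('x list \<times> 'e)" where
  "expand kids final out p = (if final (fst (fst p)) then ([out (fst (fst p))], (snd (fst p), snd p))
     else ([], (kids (snd p) (fst (fst p)) @ snd (fst p), snd p)))"

lemma polytime_expand:
  fixes kids :: "'e::enc \<Rightarrow> 'x::enc \<Rightarrow> 'x list" and out :: "'x \<Rightarrow> 'o::enc"
  assumes kids: "polytime (\<lambda>p. kids (fst p) (snd p))" and final: "polytime final" and out: "polytime out"
  shows "polytime (expand kids final out)"
proof -
  have "polytime (\<lambda>p :: ('x \<times> 'x list) \<times> 'e. kids (snd p) (fst (fst p)))"
    using polytime_comp[OF kids, of "\<lambda>p :: ('x \<times> 'x list) \<times> 'e. (snd p, fst (fst p))"]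
    by (simp add: polytime_Pair polytime_fst polytime_snd polytime_id)
  then show ?thesis
    unfolding expand_def[abs_def]
    by (intro polytime_if polytime_Pair polytime_Cons polytime_const polytime_append
        polytime_comp[OF final] polytime_comp[OF out] polytime_fst polytime_snd polytime_id)
qed

lemma trace_size_mono:
  fixes A :: "(store \<times> val option) set"
  assumes "\<forall>(r, _) \<in> A. size (r 0) \<le> a" "a \<le> b"
  shows "\<forall>(r, _) \<in> A. size (r 0) \<le> b"
proof clarify
  fix r v assume "(r, v) \<in> A"
  with assms show "size (r 0) \<le> b" by fastforce
qed

text \<open>\<open>X\<close> will compute \<open>expand\<close>. The assignment
  \<open>Assign 0 (Var 0)\<close> is an idle instruction, and the last one drops the list of
  outputs.\<close>

definition dfs_body :: "prog \<Rightarrow> prog" where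
  "dfs_body X = Seq X (Seq (If (Hd (Var 0)) (Output (Hd (Hd (Var 0)))) (Assign 0 (Var 0))) (Assign 0 (Tl (Var 0))))"

text \<open>The trace is split just before an output, where the budget restarts. Three steps are
  added to those of \<open>X\<close>: the test, the output or idle instruction, and the last
  assignment.\<close>

lemma exec_dfs_body:
  assumes X: "runs X (s 0) (Pair (enc (os :: 'o::enc list)) b) k" and os: "os = [] \<or> (\<exists>v. os = [v])"
  shows "\<exists>t u s'. exec (dfs_body X) s (t @ u) s' \<and> s' 0 = b \<and> outputs t = [] \<and> outputs (tl u) = [] \<and>
    (case os of [] \<Rightarrow> outputs u = [] | v # _ \<Rightarrow> \<exists>r. u = (r, Some (enc v)) # tl u) \<and>
    length t + length u \<le> k + 3 \<and> (\<forall>(r, _) \<in> set (t @ u). size (r 0) \<le> k)"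
proof -
  obtain t s1 where 1: "exec X s t s1" "s1 0 = Pair (enc os) b" "outputs t = []" "length t \<le> k"
    "\<And>r v. (r, v) \<in> set t \<Longrightarrow> size (r 0) \<le> k"
    by (rule runsE[of X s "Pair (enc os) b" k, OF X]) blast
  have size: "size (s1 0) \<le> k" using runs_size[OF X] 1(2) by simp
  then have size_b: "size b \<le> k" using 1(2) by simp
  define s2 where "s2 = s1(0 := b)"
  have tl: "exec (Assign 0 (Tl (Var 0))) s1 [(s2, None)] s2"
    by (rule exec.Assign) (simp add: s2_def 1(2))
  have s1: "s1(0 := s1 0) = s1" by simp
  show ?thesis
  proof (cases os)
    case Nil
    have "exec (If (Hd (Var 0)) (Output (Hd (Hd (Var 0)))) (Assign 0 (Var 0))) s1 ((s1, None) # [(s1, None)]) s1"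
      by (intro exec.If_false exec.Assign) (auto simp: 1(2) Nil fun_eq_iff)
    from exec.Seq[OF 1(1) exec.Seq[OF this tl]]
    have "exec (dfs_body X) s (t @ [(s1, None), (s1, None), (s2, None)]) s2" by (simp add: dfs_body_def)
    with 1 size size_b Nil show ?thesis
      by (intro exI[of _ t] exI[of _ "[(s1, None), (s1, None), (s2, None)]"] exI[of _ s2])
        (auto simp: outputs_simps s2_def)
  next
    case (Cons v os')
    have "exec (If (Hd (Var 0)) (Output (Hd (Hd (Var 0)))) (Assign 0 (Var 0))) s1
        ((s1, None) # [(s1, Some (evaluate (Hd (Hd (Var 0))) s1))]) s1"
      by (intro exec.If_true exec.Output) (simp add: 1(2) Cons)
    from exec.Seq[OF 1(1) exec.Seq[OF this tl]]
    have "exec (dfs_body X) s ((t @ [(s1, None)]) @ [(s1, Some (enc v)), (s2, None)]) s2"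
      by (simp add: dfs_body_def 1(2) Cons)
    with 1 size size_b Cons show ?thesis
      by (intro exI[of _ "t @ [(s1, None)]"] exI[of _ "[(s1, Some (enc v)), (s2, None)]"] exI[of _ s2])
        (auto simp: outputs_simps s2_def)
  qed
qed

text \<open>A round costs at most \<open>m\<close>. From a node of height \<open>h\<close> each
  round passes to a child, which always exists, so output occurs within \<open>h + 1\<close> rounds;
  a further \<open>m\<close> is kept in reserve.\<close>

lemma exec_dfs_loop:
  fixes kids :: "'e::enc \<Rightarrow> 'x::enc \<Rightarrow> 'x list" and out :: "'x \<Rightarrow> 'o::enc" and e :: 'e
  assumes X: "\<And>p. runs X (enc p) (enc (expand kids final out p)) (k p)"
    and kids: "\<And>h x. good (Suc h) x \<Longrightarrow> kids e x \<noteq> [] \<and> length (kids e x) \<le> c \<and> (\<forall>y \<in> set (kids e x). good h y)"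
    and final: "\<And>h x. good h x \<Longrightarrow> final x \<longleftrightarrow> h = 0"
    and m: "\<And>h x st. stack_inv good c n ((h, x) # st) \<Longrightarrow> k ((x, map snd st), e) + 4 \<le> m"
    and m': "\<And>st. stack_inv good c n st \<Longrightarrow> size (enc (map snd st, e)) \<le> m" and m0: "1 \<le> m"
    and inv: "stack_inv good c n st" and s: "s 0 = enc (map snd st, e)"
  shows "\<exists>t s'. exec (While (Hd (Var 0)) (dfs_body X)) s t s' \<and>
    outputs t = concat (map (\<lambda>(h, x). map (\<lambda>y. enc (out y)) (leaves (kids e) h x)) st) \<and>
    fuel ((n + 3) * m) (case st of [] \<Rightarrow> m | (h, x) # _ \<Rightarrow> (h + 2) * m) t \<and>
    (\<forall>(r, _) \<in> set t. size (r 0) \<le> m)"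
  using inv s
proof (induction "\<Sum>(h, x)\<leftarrow>st. nodes (kids e) h x" arbitrary: st s rule: less_induct)
  case less
  note inv = less.prems(1) and s = less.prems(2)
  have size_s: "size (s 0) \<le> m" unfolding s by (rule m'[OF inv])
  show ?case
  proof (cases st)
    case Nil
    have "exec (While (Hd (Var 0)) (dfs_body X)) s [(s, None)] s"
      by (rule exec.While_false) (simp add: s Nil)
    then show ?thesis
      using m0 size_s Nil by (intro exI[of _ "[(s, None)]"] exI[of _ s]) (auto simp: outputs_simps)
  next
    case (Cons p st')
    obtain h x where p: "p = (h, x)" by (cases p)
    have st: "st = (h, x) # st'" using Cons p by simp
    have inv': "good h x" "h \<le> n" "length st' \<le> c * (n - h)" "stack_inv good c n st'"
      using inv by (simp_all add: st)
    let ?p = "((x, map snd st'), e)"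
    have run: "runs X (s 0) (enc (expand kids final out ?p)) (k ?p)"
      using X[of ?p] by (simp add: s st)
    have test: "evaluate (Hd (Var 0)) s \<noteq> Leaf" by (simp add: s st)
    \<comment> \<open>Three of the four extra steps belong to the body, the fourth is the loop
      test.\<close>
    have k: "k ?p + 4 \<le> m" using m[OF inv[unfolded st]] .
    show ?thesis
    proof (cases h)
      case 0
      then have "final x" using final inv'(1) by simp
      then have eq: "enc (expand kids final out ?p) = Pair (enc [out x]) (enc (map snd st', e))"
        by (simp add: expand_def)
      obtain t u s' where 1: "exec (dfs_body X) s (t @ u) s'" "s' 0 = enc (map snd st', e)" "outputs t = []"
        "outputs (tl u) = []" "\<exists>r. u = (r, Some (enc (out x))) # tl u" "length t + length u \<le> k ?p + 3"
        "\<forall>(r, _) \<in> set (t @ u). size (r 0) \<le> k ?p"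
        using exec_dfs_body[of X s "[out x]" "enc (map snd st', e)" "k ?p"] run unfolding eq by auto
      have "(\<Sum>(h, x)\<leftarrow>st'. nodes (kids e) h x) < (\<Sum>(h, x)\<leftarrow>st. nodes (kids e) h x)"
        by (simp add: st 0)
      from less.hyps[of st' s', OF this inv'(4) 1(2)] obtain w s'' where 2:
        "exec (While (Hd (Var 0)) (dfs_body X)) s' w s''"
        "outputs w = concat (map (\<lambda>(h, x). map (\<lambda>y. enc (out y)) (leaves (kids e) h x)) st')"
        "fuel ((n + 3) * m) (case st' of [] \<Rightarrow> m | (h, x) # _ \<Rightarrow> (h + 2) * m) w"
        "\<forall>(r, _) \<in> set w. size (r 0) \<le> m" by blast
      obtain r where u: "u = (r, Some (enc (out x))) # tl u" using 1(5) by blast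
      \<comment> \<open>The next node may have any height up to \<open>n\<close>; the remaining
        \<open>m\<close> of the budget \<open>(n + 3) * m\<close> pays for the end of the current
        round.\<close>
      have "(case st' of [] \<Rightarrow> m | (h, x) # _ \<Rightarrow> (h + 2) * m) \<le> (n + 2) * m"
        using inv'(4) by (auto split: list.split intro!: mult_le_mono1)
      then have "fuel ((n + 3) * m) ((n + 3) * m) (tl u @ w)"
        using 1(4,6) k by (intro fuel_silent[OF _ 2(3)]) (auto simp: algebra_simps)
      then have "fuel ((n + 3) * m) 0 (u @ w)" by (subst u) simp
      from fuel_silent[OF _ this, of "(s, None) # t" "2 * m"]
      have "fuel ((n + 3) * m) (2 * m) (((s, None) # t) @ (u @ w))"
        using 1(3,6) k by (simp add: outputs_simps)
      moreover have "exec (While (Hd (Var 0)) (dfs_body X)) s ((s, None) # (t @ u) @ w) s''"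
        by (rule exec.While_true[OF test 1(1) 2(1)])
      moreover have "outputs ((s, None) # (t @ u) @ w) = enc (out x) # outputs w"
        using 1(3,4) by (subst u) (simp add: outputs_simps)
      moreover have "\<forall>(r, _) \<in> set ((s, None) # (t @ u) @ w). size (r 0) \<le> m"
        using size_s trace_size_mono[OF 1(7), of m] 2(4) k by (simp add: ball_Un)
      ultimately show ?thesis
        using 2(2) by (intro exI[of _ "(s, None) # (t @ u) @ w"] exI[of _ s'']) (simp add: st 0 mult_2)
    next
      case (Suc g)
      have ks: "kids e x \<noteq> []" "length (kids e x) \<le> c" "\<And>y. y \<in> set (kids e x) \<Longrightarrow> good g y"
        using kids[of g x] inv'(1) Suc by auto
      let ?st = "map (\<lambda>y. (g, y)) (kids e x) @ st'"
      have "\<not> final x" using final inv'(1) Suc by simp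
      then have eq: "enc (expand kids final out ?p) = Pair (enc ([] :: 'o list)) (enc (map snd ?st, e))"
        by (simp add: expand_def o_def)
      have "n - g = Suc (n - h)" using inv'(2) Suc by simp
      then have "stack_inv good c n ?st"
        using inv' ks Suc by (intro stack_inv_push) auto
      obtain t u s' where 1: "exec (dfs_body X) s (t @ u) s'" "s' 0 = enc (map snd ?st, e)" "outputs t = []"
        "outputs u = []" "length t + length u \<le> k ?p + 3" "\<forall>(r, _) \<in> set (t @ u). size (r 0) \<le> k ?p"
        using exec_dfs_body[of X s "[] :: 'o list" "enc (map snd ?st, e)" "k ?p"] run unfolding eq by auto
      have "(\<Sum>(h, x)\<leftarrow>?st. nodes (kids e) h x) < (\<Sum>(h, x)\<leftarrow>st. nodes (kids e) h x)"
        by (simp add: st Suc o_def)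
      from less.hyps[of ?st s', OF this \<open>stack_inv good c n ?st\<close> 1(2)] obtain w s'' where 2:
        "exec (While (Hd (Var 0)) (dfs_body X)) s' w s''"
        "outputs w = concat (map (\<lambda>(h, x). map (\<lambda>y. enc (out y)) (leaves (kids e) h x)) ?st)"
        "fuel ((n + 3) * m) (case ?st of [] \<Rightarrow> m | (h, x) # _ \<Rightarrow> (h + 2) * m) w"
        "\<forall>(r, _) \<in> set w. size (r 0) \<le> m" by blast
      have "(case ?st of [] \<Rightarrow> m | (h, x) # _ \<Rightarrow> (h + 2) * m) = (g + 2) * m"
        using ks(1) by (cases "kids e x") auto
      with 2(3) have "fuel ((n + 3) * m) ((h + 2) * m) (((s, None) # t @ u) @ w)"
        using 1(3,4,5) k by (intro fuel_silent[where f = "(g + 2) * m"]) (auto simp: outputs_simps Suc)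
      moreover have "exec (While (Hd (Var 0)) (dfs_body X)) s ((s, None) # (t @ u) @ w) s''"
        by (rule exec.While_true[OF test 1(1) 2(1)])
      moreover have "outputs ((s, None) # (t @ u) @ w) = outputs w"
        using 1(3,4) by (simp add: outputs_simps)
      moreover have "outputs w = concat (map (\<lambda>(h, x). map (\<lambda>y. enc (out y)) (leaves (kids e) h x)) st)"
        unfolding 2(2) by (simp add: st Suc o_def map_concat)
      moreover have "\<forall>(r, _) \<in> set ((s, None) # (t @ u) @ w). size (r 0) \<le> m"
        using size_s trace_size_mono[OF 1(6), of m] 2(4) k by (simp add: ball_Un)
      ultimately show ?thesis
        by (intro exI[of _ "(s, None) # (t @ u) @ w"] exI[of _ s'']) (simp add: st)
    qed
  qed
qed

text \<open>\<open>good i h x\<close> is meant to say that \<open>x\<close> is a node of height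
  \<open>h\<close> in the tree of input \<open>i\<close>. Nonempty lists of children bound the delay
  through the depth; their polynomial length bounds the stack.\<close>

theorem dfs_enumeration:
  fixes root :: "'i::enc \<Rightarrow> 'x::enc" and env :: "'i \<Rightarrow> 'e::enc" and kids :: "'e \<Rightarrow> 'x \<Rightarrow> 'x list"
    and final :: "'x \<Rightarrow> bool" and out :: "'x \<Rightarrow> 'o::enc"
  assumes polytime: "polytime root" "polytime env" "polytime (\<lambda>p. kids (fst p) (snd p))" "polytime final" "polytime out"
    and pb: "poly_bounded B" "poly_bounded depth"
    and root: "\<And>i. i \<in> I \<Longrightarrow> good i (depth i) (root i)"
    and size: "\<And>i h x. i \<in> I \<Longrightarrow> good i h x \<Longrightarrow> size (enc x) \<le> B i"
    and final: "\<And>i h x. i \<in> I \<Longrightarrow> good i h x \<Longrightarrow> final x \<longleftrightarrow> h = 0"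
    and kids: "\<And>i h x. i \<in> I \<Longrightarrow> good i (Suc h) x \<Longrightarrow>
      kids (env i) x \<noteq> [] \<and> (\<forall>y \<in> set (kids (env i) x). good i h y)"
    and problem: "\<And>v sol. (v, sol) \<in> problem \<Longrightarrow> \<exists>i\<in>I. v = enc i \<and>
      distinct (map (\<lambda>y. enc (out y)) (leaves (kids (env i)) (depth i) (root i))) \<and>
      sol = set (map (\<lambda>y. enc (out y)) (leaves (kids (env i)) (depth i) (root i)))"
  shows "\<exists>P. enumerates_poly_delay_poly_space P problem"
proof -
  have "polytime (\<lambda>i. ([root i], env i))" by (intro polytime_Pair polytime_Cons polytime_const polytime)
  then obtain Q j where Q: "vars Q \<subseteq> {0}" "poly_bounded j" "\<And>i. runs Q (enc i) (enc ([root i], env i)) (j i)"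
    by (rule polytimeE) blast
  obtain X k where X: "vars X \<subseteq> {0}" "poly_bounded k" "\<And>p. runs X (enc p) (enc (expand kids final out p)) (k p)"
    using polytime_expand[OF polytime(3-5)] by (rule polytimeE) blast
  obtain qk where qk: "\<And>p. k p \<le> poly qk (size (enc p))" using X(2) unfolding poly_bounded_def by blast
  obtain qc where qc: "\<And>p. size (enc (kids (fst p) (snd p))) \<le> poly qc (size (enc p))"
    using poly_bounded_size[OF polytime(3)] unfolding poly_bounded_def by blast
  define E where "E i = size (enc (env i))" for i
  \<comment> \<open>\<open>c\<close> bounds the number of children, \<open>Z\<close> the encoded
    stack with its environment, \<open>m\<close> one round, and \<open>d\<close> both delay and
    space.\<close>
  define c where "c i = poly qc (E i + B i + 1)" for i
  define Z where "Z i = Suc (c i * depth i) * Suc (B i) + E i + 1" for i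
  define m where "m i = poly qk (Z i) + Z i + 4" for i
  define d where "d i = j i + (depth i + 3) * m i" for i
  have pb': "poly_bounded (\<lambda>x. poly q (g x))" if g: "poly_bounded g" for q and g :: "'i \<Rightarrow> nat"
  proof -
    obtain r where r: "\<And>x. g x \<le> poly r (size (enc x))" using g unfolding poly_bounded_def by blast
    have "poly q (g x) \<le> poly (pcompose q r) (size (enc x))" for x
      using poly_nat_mono[OF r] by (simp add: poly_pcompose)
    then show ?thesis unfolding poly_bounded_def by blast
  qed
  have "poly_bounded d"
    unfolding d_def m_def Z_def c_def E_def by (intro poly_bounded_intros pb' pb poly_bounded_size polytime Q)
  then obtain D where D: "\<And>i. d i \<le> poly D (size (enc i))" unfolding poly_bounded_def by blast
  define P where "P = Seq Q (While (Hd (Var 0)) (dfs_body X))"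
  have vars: "vars P \<subseteq> {0}" using Q(1) X(1) by (simp add: P_def dfs_body_def)
  have memory: "memory P s \<le> size (s 0)" for s
  proof -
    have "memory P s \<le> (\<Sum>x\<in>{0}. size (s x))"
      unfolding memory_def using vars by (intro sum_mono2) auto
    then show ?thesis by simp
  qed
  have main: "\<exists>t s. exec P (initial (enc i)) t s \<and>
      outputs t = map (\<lambda>y. enc (out y)) (leaves (kids (env i)) (depth i) (root i)) \<and>
      delay_at_most (d i) t \<and> space_at_most (d i) P t" if i: "i \<in> I" for i
  proof -
    have stack: "size (enc (map snd st, env i)) \<le> Z i" if inv: "stack_inv (good i) (c i) (depth i) st" for st
    proof -
      have "size (enc (map snd st)) \<le> Suc (c i * depth i) * Suc (B i)"
      proof (rule size_enc_list_le)
        fix x assume "x \<in> set (map snd st)"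
        then obtain p where "p \<in> set st" "x = snd p" by auto
        then obtain h where "good i h x" using stack_inv_good[OF inv] by blast
        then show "size (enc x) \<le> B i" by (rule size[OF i])
      qed (use stack_inv_length[OF inv] in simp)
      then show ?thesis by (simp add: Z_def E_def)
    qed
    have "initial (enc i) 0 = enc i" by (simp add: initial_def)
    then obtain t s where 1: "exec Q (initial (enc i)) t s" "s 0 = enc ([root i], env i)" "outputs t = []"
      "length t \<le> j i" "\<And>r v. (r, v) \<in> set t \<Longrightarrow> size (r 0) \<le> j i"
      using runsE[of Q "initial (enc i)" "enc ([root i], env i)" "j i"] Q(3) by metis
    have "\<exists>u s'. exec (While (Hd (Var 0)) (dfs_body X)) s u s' \<and>
      outputs u = concat (map (\<lambda>(h, x). map (\<lambda>y. enc (out y)) (leaves (kids (env i)) h x)) [(depth i, root i)]) \<and>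
      fuel ((depth i + 3) * m i) (case [(depth i, root i)] of [] \<Rightarrow> m i | (h, x) # _ \<Rightarrow> (h + 2) * m i) u \<and>
      (\<forall>(r, _) \<in> set u. size (r 0) \<le> m i)"
    proof (rule exec_dfs_loop[OF X(3)])
      show "kids (env i) x \<noteq> [] \<and> length (kids (env i) x) \<le> c i \<and> (\<forall>y \<in> set (kids (env i) x). good i h y)"
        if "good i (Suc h) x" for h x
      proof -
        have "length (kids (env i) x) \<le> size (enc (kids (env i) x))" by (rule length_le_size_enc)
        also have "\<dots> \<le> poly qc (size (enc (env i, x)))" using qc[of "(env i, x)"] by simp
        also have "\<dots> \<le> c i"
          unfolding c_def by (rule poly_nat_mono) (use size[OF i that] in \<open>simp add: E_def\<close>)
        finally show ?thesis using kids[OF i that] by simp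
      qed
      show "k ((x, map snd st), env i) + 4 \<le> m i" if "stack_inv (good i) (c i) (depth i) ((h, x) # st)"
          for h x st
      proof -
        have "size (enc ((x, map snd st), env i)) \<le> Z i" using stack[OF that] by simp
        then have "k ((x, map snd st), env i) \<le> poly qk (Z i)"
          using order_trans[OF qk poly_nat_mono] by blast
        then show ?thesis by (simp add: m_def)
      qed
      show "size (enc (map snd st, env i)) \<le> m i" if "stack_inv (good i) (c i) (depth i) st" for st
        using stack[OF that] by (simp add: m_def)
    qed (use root[OF i] final[OF i] 1(2) in \<open>simp_all add: m_def\<close>)
    then obtain u s' where 2: "exec (While (Hd (Var 0)) (dfs_body X)) s u s'"
      "outputs u = map (\<lambda>y. enc (out y)) (leaves (kids (env i)) (depth i) (root i))"
      "fuel ((depth i + 3) * m i) ((depth i + 2) * m i) u" "\<forall>(r, _) \<in> set u. size (r 0) \<le> m i"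
      by auto
    have "fuel (d i) ((depth i + 2) * m i) u"
      using fuel_mono_left[OF 2(3), of "d i"] by (simp add: d_def)
    then have "fuel (d i) (d i) (t @ u)"
      using 1(3,4) by (intro fuel_silent[where f = "(depth i + 2) * m i"]) (auto simp: d_def algebra_simps)
    then have "delay_at_most (d i) (t @ u)" by (rule fuel_delay) simp
    moreover have "exec P (initial (enc i)) (t @ u) s'" unfolding P_def by (rule exec.Seq[OF 1(1) 2(1)])
    moreover have "outputs (t @ u) = map (\<lambda>y. enc (out y)) (leaves (kids (env i)) (depth i) (root i))"
      using 1(3) 2(2) by (simp add: outputs_simps)
    moreover have "space_at_most (d i) P (t @ u)"
      unfolding space_at_most_def
    proof clarify
      fix r v assume "(r, v) \<in> set (t @ u)"
      then have "size (r 0) \<le> j i \<or> size (r 0) \<le> m i" using 1(5) 2(4) by auto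
      moreover have "j i \<le> d i" "m i \<le> d i" by (simp_all add: d_def add_mult_distrib)
      ultimately have "size (r 0) \<le> d i" by linarith
      with memory[of r] show "memory P r \<le> d i" by (rule order_trans)
    qed
    ultimately show ?thesis by blast
  qed
  have "enumerates_poly_delay_poly_space P problem"
    unfolding enumerates_poly_delay_poly_space_def
  proof (rule exI[of _ D], rule exI[of _ D], clarify)
    fix v sol assume "(v, sol) \<in> problem"
    then obtain i where i: "i \<in> I" "v = enc i"
      "distinct (map (\<lambda>y. enc (out y)) (leaves (kids (env i)) (depth i) (root i)))"
      "sol = set (map (\<lambda>y. enc (out y)) (leaves (kids (env i)) (depth i) (root i)))"
      using problem by blast
    obtain t s where t: "exec P (initial (enc i)) t s"
      "outputs t = map (\<lambda>y. enc (out y)) (leaves (kids (env i)) (depth i) (root i))"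
      "delay_at_most (d i) t" "space_at_most (d i) P t"
      using main[OF i(1)] by blast
    have "delay_at_most (poly D (size v)) t"
      unfolding delay_at_most_def i(2)
    proof (intro allI impI)
      fix t1 b t2 assume "t = t1 @ b @ t2 \<and> outputs b = []"
      then have "length b \<le> d i" using t(3) unfolding delay_at_most_def by blast
      then show "length b \<le> poly D (size (enc i))" using D by (rule order_trans)
    qed
    moreover have "space_at_most (poly D (size v)) P t"
      unfolding space_at_most_def i(2)
    proof clarify
      fix r v assume "(r, v) \<in> set t"
      then have "memory P r \<le> d i" using t(4) unfolding space_at_most_def by blast
      then show "memory P r \<le> poly D (size (enc i))" using D by (rule order_trans)
    qed
    ultimately show "\<exists>t s. exec P (initial v) t s \<and> distinct (outputs t) \<and> set (outputs t) = sol \<and>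
        delay_at_most (poly D (size v)) t \<and> space_at_most (poly D (size v)) P t"
      using t(1,2) i by (intro exI[of _ t] exI[of _ s]) simp
  qed
  then show ?thesis by blast
qed

section \<open>The algorithm\<close>

text \<open>
  A vertex is represented by its unit vector and the characteristic vector of its neighbourhood. The
  prefix \<open>b\<close> marks the versions of set operations and of the notions above on characteristic vectors.
\<close>

type_synonym vertex = "bool list \<times> bool list"

definition bzip :: "bool list list \<Rightarrow> bool list list \<Rightarrow> vertex list" where
  "bzip xs ys = rev (snd (foldl (\<lambda>p x. (tl (fst p), (x, head (fst p)) # snd p)) (ys, []) xs))"

lemma bzip_map: "bzip (map f vs) (map g vs) = map (\<lambda>v. (f v, g v)) vs"
proof -
  have "foldl (\<lambda>p x. (tl (fst p), (x, head (fst p)) # snd p)) (map g vs, acc) (map f vs) =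
      ([], rev (map (\<lambda>v. (f v, g v)) vs) @ acc)" for acc
    by (induction vs arbitrary: acc) (simp_all add: head_def)
  then show ?thesis by (simp add: bzip_def)
qed

lemma polytime_bzip:
  assumes "polytime xs" "polytime ys"
  shows "polytime (\<lambda>x. bzip (xs x) (ys x))"
  unfolding bzip_def
proof (intro polytime_rev polytime_snd polytime_foldl_add[where h = "\<lambda>x. size (enc (xs x)) + 3"])
  fix x y and p :: "bool list list \<times> vertex list"
  assume "y \<in> set (xs x)"
  from size_enc_elem[OF this]
  show "size (enc (tl (fst p), (y, head (fst p)) # snd p)) \<le> size (enc p) + (size (enc (xs x)) + 3)"
    by (cases p; cases "fst p") (auto simp: head_def)
qed (intro polytime_intros poly_bounded_intros poly_bounded_size assms)+

section \<open>The search in terms of characteristic vectors\<close>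

definition bclosed_nbhd :: "vertex \<Rightarrow> bool list" where
  "bclosed_nbhd u = bunion (fst u) (snd u)"

definition btransversal :: "vertex list \<Rightarrow> bool list \<Rightarrow> bool list \<Rightarrow> bool" where
  "btransversal Vs S D \<longleftrightarrow> (\<forall>u\<in>set Vs. bsub (bclosed_nbhd u) S \<longrightarrow> bhit (bclosed_nbhd u) D)"

definition bminimal_transversal :: "vertex list \<Rightarrow> bool list \<Rightarrow> bool list \<Rightarrow> bool" where
  "bminimal_transversal Vs S D \<longleftrightarrow> btransversal Vs S D \<and> (\<forall>u\<in>set Vs. bhit (fst u) D \<longrightarrow>
      \<not> btransversal Vs S (bdiff D (fst u)))"

definition bshrink :: "vertex list \<Rightarrow> bool list \<Rightarrow> bool list \<Rightarrow> bool list" where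
  "bshrink Vs S D = foldl (\<lambda>R u. if btransversal Vs S (bdiff R (fst u)) then bdiff R (fst u) else R) D Vs"

definition bfill :: "vertex list \<Rightarrow> bool list \<Rightarrow> bool list \<Rightarrow> bool list \<Rightarrow> bool list" where
  "bfill Vs S S' Y = map (\<lambda>u. bhit (fst u) S \<and> bsub (bclosed_nbhd u) S' \<and> \<not> bhit (bclosed_nbhd u) Y) Vs"

text \<open>\<open>bdiff T T\<close> is the empty set, as a vector of the right length.\<close>

definition bsmall :: "vertex list \<Rightarrow> bool list \<Rightarrow> bool list list" where
  "bsmall Vs T = bdiff T T # map fst Vs"

definition bcands :: "vertex list \<Rightarrow> bool list \<Rightarrow> bool list \<Rightarrow> bool list \<Rightarrow> bool list list" where
  "bcands Vs S S' T = concat (map (\<lambda>Z. map (\<lambda>W.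
     bunion (bunion (bunion T Z) (bfill Vs S S' (bunion T Z))) W) (bsmall Vs T)) (bsmall Vs T))"

text \<open>Different choices of Z and W may give the same candidate, which may be listed only
  once.\<close>

definition bdedup :: "bool list list \<Rightarrow> bool list list" where
  "bdedup xs = foldl (\<lambda>acc D. if \<exists>E\<in>set acc. bequal D E then acc else D # acc) [] xs"

text \<open>A transversal, and the vertex sets from its level up to the full set. A leaf has a
  single set left.\<close>

type_synonym node = "bool list \<times> bool list list"

text \<open>The candidates provide completeness and the filter correctness. Recomputing the parent
  ensures that a set is listed below one node only.\<close>

definition kids :: "vertex list \<Rightarrow> node \<Rightarrow> node list" where
  "kids Vs x = map (\<lambda>D. (D, tl (snd x)))
     (bdedup (filter (\<lambda>D. bminimal_transversal Vs (head (tl (snd x))) D \<and>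
         bequal (bshrink Vs (head (snd x)) D) (fst x))
       (bcands Vs (head (snd x)) (head (tl (snd x))) (fst x))))"

definition bsimple :: "vertex list \<Rightarrow> bool list \<Rightarrow> vertex \<Rightarrow> bool" where
  "bsimple Vs S v \<longleftrightarrow> (\<forall>u\<in>set Vs. \<forall>w\<in>set Vs.
     bsub (bclosed_nbhd u) S \<and> bhit (fst v) (snd u) \<and> bsub (bclosed_nbhd w) S \<and> bhit (fst v) (snd w) \<longrightarrow>
     bsub (snd u) (snd w) \<or> bsub (snd w) (snd u))"

text \<open>All tests refer to the original \<open>S\<close>, so just one vertex is removed: the
  last suitable one in the list. Without such a vertex the result is \<open>S\<close>.\<close>

definition beliminate :: "vertex list \<Rightarrow> bool list \<Rightarrow> bool list" where
  "beliminate Vs S = foldl (\<lambda>R v. if bhit (fst v) S \<and> bsimple Vs S v then bdiff S (fst v) else R) S Vs"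

text \<open>The vertex list only counts the rounds. Sets are found from the full set downwards and
  put in front, so the search meets them in increasing order.\<close>

definition border :: "vertex list \<Rightarrow> bool list list" where
  "border Vs = foldl (\<lambda>Ss _. beliminate Vs (head Ss) # Ss) [map (\<lambda>_. True) Vs] Vs"

section \<open>Running times\<close>

lemma polytime_bclosed_nbhd: "polytime f \<Longrightarrow> polytime (\<lambda>x. bclosed_nbhd (f x))"
  unfolding bclosed_nbhd_def by (intro polytime_intros)

lemma polytime_btransversal:
  assumes "polytime Vs" "polytime S" "polytime D"
  shows "polytime (\<lambda>x. btransversal (Vs x) (S x) (D x))"
  unfolding btransversal_def by (intro polytime_intros polytime_bclosed_nbhd assms[THEN polytime_comp])

lemma polytime_bminimal_transversal:
  assumes "polytime Vs" "polytime S" "polytime D"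
  shows "polytime (\<lambda>x. bminimal_transversal (Vs x) (S x) (D x))"
  unfolding bminimal_transversal_def by (intro polytime_intros polytime_btransversal assms[THEN
      polytime_comp])

lemma polytime_bshrink:
  assumes "polytime Vs" "polytime S" "polytime D"
  shows "polytime (\<lambda>x. bshrink (Vs x) (S x) (D x))"
  unfolding bshrink_def
proof (rule polytime_foldl_add[where h = "\<lambda>_. 0"])
  show "size (enc (if btransversal (Vs x) (S x) (bdiff R (fst y)) then bdiff R (fst y) else R)) \<le> size (enc R) + 0"
    for x R and y :: vertex
    using size_bdiff[of R "fst y"] by simp
qed (intro polytime_intros poly_bounded_intros polytime_btransversal assms[THEN polytime_comp])+

lemma polytime_bfill:
  assumes "polytime Vs" "polytime S" "polytime S'" "polytime Y"
  shows "polytime (\<lambda>x. bfill (Vs x) (S x) (S' x) (Y x))"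
  unfolding bfill_def by (intro polytime_intros polytime_bclosed_nbhd assms[THEN polytime_comp])

lemma polytime_bsmall:
  assumes "polytime Vs" "polytime T"
  shows "polytime (\<lambda>x. bsmall (Vs x) (T x))"
  unfolding bsmall_def by (intro polytime_intros assms[THEN polytime_comp])

lemma polytime_bcands:
  assumes "polytime Vs" "polytime S" "polytime S'" "polytime T"
  shows "polytime (\<lambda>x. bcands (Vs x) (S x) (S' x) (T x))"
  unfolding bcands_def by (intro polytime_intros polytime_bsmall polytime_bfill assms[THEN polytime_comp])

lemma polytime_bdedup:
  assumes "polytime xs"
  shows "polytime (\<lambda>x. bdedup (xs x))"
  unfolding bdedup_def
proof (rule polytime_foldl_add[where h = "\<lambda>x. Suc (size (enc (xs x)))"])
  show "size (enc (if \<exists>E\<in>set acc. bequal D E then acc else D # acc)) \<le> size (enc acc) +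
      Suc (size (enc (xs x)))"
    if "D \<in> set (xs x)" for x acc D
    using size_enc_elem[OF that] by simp
qed (intro polytime_intros poly_bounded_intros poly_bounded_size assms)+

lemma polytime_kids: "polytime (\<lambda>p. kids (fst p) (snd p))"
  unfolding kids_def by (intro polytime_intros polytime_bdedup polytime_bminimal_transversal
      polytime_bshrink polytime_bcands)

lemma polytime_bsimple:
  assumes "polytime Vs" "polytime S" "polytime v"
  shows "polytime (\<lambda>x. bsimple (Vs x) (S x) (v x))"
  unfolding bsimple_def by (intro polytime_intros polytime_bclosed_nbhd assms[THEN polytime_comp])

lemma size_beliminate: "size (enc (beliminate Vs S)) \<le> size (enc S)"
proof -
  have "size (enc (foldl (\<lambda>R v. if bhit (fst v) S \<and>
      bsimple Vs S v then bdiff S (fst v) else R) R us)) \<le> size (enc S)"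
    if "size (enc R) \<le> size (enc S)" for R and us :: "vertex list"
    using that by (induction us arbitrary: R) (simp_all add: size_bdiff)
  then show ?thesis by (simp add: beliminate_def)
qed

lemma polytime_beliminate:
  assumes "polytime Vs" "polytime S"
  shows "polytime (\<lambda>x. beliminate (Vs x) (S x))"
  unfolding beliminate_def
proof (rule polytime_foldl_add[where h = "\<lambda>x. size (enc (S x))"])
  show "size (enc (if bhit (fst v) (S x) \<and> bsimple (Vs x) (S x) v then bdiff (S x) (fst v) else R))
      \<le> size (enc R) + size (enc (S x))" for x R and v :: vertex
    using size_bdiff[of "S x" "fst v"] by simp
qed (intro polytime_intros poly_bounded_intros poly_bounded_size polytime_bsimple assms assms[THEN
    polytime_comp])+

lemma polytime_border:
  assumes "polytime Vs"
  shows "polytime (\<lambda>x. border (Vs x))"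
  unfolding border_def
proof (rule polytime_foldl)
  \<comment> \<open>The new set is computed from the accumulator, so additive growth is not at hand;
    but elimination never enlarges a vector, so the initial one bounds them all.\<close>
  show "poly_bounded (\<lambda>x. Suc (size (enc (Vs x))) * Suc (2 * size (enc (Vs x))))"
    by (intro poly_bounded_intros poly_bounded_size assms)
  fix x i
  let ?f = "\<lambda>us. foldl (\<lambda>Ss _. beliminate (Vs x) (head Ss) # Ss) [map (\<lambda>_. True) (Vs x)] us"
  have "length (?f us) = Suc (length us) \<and> (\<forall>S\<in>set (?f us). size (enc S) \<le> 2 * size (enc (Vs x)))"
      for us :: "vertex list"
  proof (induction us rule: rev_induct)
    case Nil
    have "size (enc (map (\<lambda>_. True) (Vs x))) \<le> 2 * length (Vs x)"
      using size_enc_bools[of "map (\<lambda>_. True) (Vs x)"] by simp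
    then show ?case using length_le_size_enc[of "Vs x"] by simp
  next
    case (snoc u us)
    have "?f us \<noteq> []" using snoc by auto
    then have "head (?f us) \<in> set (?f us)" by (cases "?f us") (auto simp: head_def)
    then have "size (enc (beliminate (Vs x) (head (?f us)))) \<le> 2 * size (enc (Vs x))"
      using snoc size_beliminate order_trans by blast
    then show ?case using snoc by simp
  qed
  from this[of "take i (Vs x)"]
  show "size (enc (?f (take i (Vs x)))) \<le> Suc (size (enc (Vs x))) * Suc (2 * size (enc (Vs x)))"
    using length_le_size_enc[of "Vs x"] by (intro size_enc_list_le) auto
qed (intro polytime_intros polytime_beliminate assms[THEN polytime_comp])+

section \<open>Vectors and the sets they represent\<close>

locale listed_neighbourhoods = neighbourhoods V N for V :: "'a set" and N +
  fixes vs :: "'a list"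
  assumes distinct_vs: "distinct vs" and set_vs: "set vs = V"
begin

definition vertices :: "vertex list" where
  "vertices = map (\<lambda>u. (bits vs {u}, bits vs (N u))) vs"

lemma set_vertices: "set vertices = (\<lambda>u. (bits vs {u}, bits vs (N u))) ` V"
  by (simp add: vertices_def set_vs)

lemma bits_inj: "A \<subseteq> V \<Longrightarrow> B \<subseteq> V \<Longrightarrow> bits vs A = bits vs B \<longleftrightarrow> A = B"
  by (auto simp: bits_eq_iff set_vs)

lemma bclosed_nbhd_bits: "bclosed_nbhd (bits vs {u}, bits vs (N u)) = bits vs (closed_nbhd u)"
  by (simp add: bclosed_nbhd_def closed_nbhd_def)

lemma closed_nbhd_Int_set_vs: "u \<in> V \<Longrightarrow> closed_nbhd u \<inter> set vs = closed_nbhd u"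
  using closed_nbhd_subset set_vs by blast

lemma bsub_closed_nbhd: "u \<in> V \<Longrightarrow> bsub (bits vs (closed_nbhd u)) (bits vs S) \<longleftrightarrow> closed_nbhd u \<subseteq> S"
  by (simp add: closed_nbhd_Int_set_vs)

lemma bhit_closed_nbhd: "u \<in> V \<Longrightarrow> bhit (bits vs (closed_nbhd u)) (bits vs D) \<longleftrightarrow> closed_nbhd u \<inter> D \<noteq> {}"
  using closed_nbhd_subset[of u] set_vs by auto

lemma bhit_unit: "u \<in> V \<Longrightarrow> bhit (bits vs {u}) (bits vs D) \<longleftrightarrow> u \<in> D"
  by (auto simp: set_vs)

lemma btransversal_bits: "btransversal vertices (bits vs S) (bits vs D) \<longleftrightarrow> transversal S D"
  by
      (auto simp: btransversal_def transversal_def set_vertices bclosed_nbhd_bits bsub_closed_nbhd bhit_closed_nbhd simp del: bits_simps)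

lemma bminimal_transversal_bits: "D \<subseteq> V \<Longrightarrow> bminimal_transversal vertices (bits vs S) (bits vs D) \<longleftrightarrow>
    minimal_transversal S D"
  by
      (auto simp: bminimal_transversal_def minimal_transversal_def set_vertices btransversal_bits bhit_unit simp del: bits_simps(3))

lemma bshrink_bits: "bshrink vertices (bits vs S) (bits vs D) = bits vs (shrink S D vs)"
proof -
  have "foldl (\<lambda>R u.
      if btransversal vertices (bits vs S) (bdiff R (fst u)) then bdiff R (fst u) else R) (bits vs D)
      (map (\<lambda>u. (bits vs {u}, bits vs (N u))) us) = bits vs (shrink S D us)" for us
    by (induction us arbitrary: D) (simp_all add: shrink_def btransversal_bits)
  then show ?thesis by (simp add: bshrink_def vertices_def)
qed

lemma bfill_bits: "bfill vertices (bits vs S) (bits vs S') (bits vs Y) = bits vs (fill S S' Y)"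
proof -
  have "bfill vertices (bits vs S) (bits vs S') (bits vs Y) =
      map (\<lambda>u. u \<in> S \<and> closed_nbhd u \<subseteq> S' \<and> closed_nbhd u \<inter> Y = {}) vs"
    unfolding bfill_def vertices_def map_map
    by (rule map_cong)
        (auto simp: set_vs bclosed_nbhd_bits bsub_closed_nbhd bhit_closed_nbhd bhit_unit simp del: bits_simps)
  also have "\<dots> = bits vs (fill S S' Y)"
    unfolding bits_def by (rule map_cong) (auto simp: fill_def set_vs)
  finally show ?thesis .
qed

lemma bsimple_bits:
  assumes "v \<in> V"
  shows "bsimple vertices (bits vs S) (bits vs {v}, bits vs (N v)) \<longleftrightarrow> simple S v"
proof -
  have "bsub (bits vs (N u)) (bits vs (N w)) \<longleftrightarrow> N u \<subseteq> N w" if "u \<in> V" for u w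
    using N_subset[OF that] set_vs by auto
  then show ?thesis
    using assms unfolding bsimple_def simple_def set_vertices
    by (simp add: bclosed_nbhd_bits bsub_closed_nbhd bhit_unit del: bits_simps)
qed

definition small :: "'a set set" where
  "small = insert {} ((\<lambda>x. {x}) ` V)"

lemma set_bsmall: "set (bsmall vertices (bits vs T)) = bits vs ` small"
  by (auto simp: bsmall_def set_vertices small_def image_image)

lemma set_bcands:
  "set (bcands vertices (bits vs S) (bits vs S') (bits vs T)) =
     {bits vs (T \<union> Z \<union> fill S S' (T \<union> Z) \<union> W) | Z W. Z \<in> small \<and> W \<in> small}"
  by (simp add: bcands_def set_bsmall bfill_bits image_image) blast

text \<open>On characteristic vectors over the common listing, \<open>bequal\<close> is equality;
  hence the assumption.\<close>

lemma bdedup_bits: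
  assumes "\<And>x. x \<in> set xs \<Longrightarrow> \<exists>D. x = bits vs D"
  shows "distinct (bdedup xs)" "set (bdedup xs) = set xs"
proof -
  let ?f = "\<lambda>xs. foldl (\<lambda>acc D. if \<exists>E\<in>set acc. bequal D E then acc else D # acc) [] xs"
  have "distinct (?f xs) \<and> set (?f xs) = set xs"
    using assms
  proof (induction xs rule: rev_induct)
    case (snoc x xs)
    then have IH: "distinct (?f xs)" "set (?f xs) = set xs" by simp_all
    have "(\<exists>E\<in>set (?f xs). bequal x E) \<longleftrightarrow> x \<in> set xs"
    proof -
      have "bequal x E \<longleftrightarrow> x = E" if "E \<in> set xs" for E
        using snoc.prems[of x] snoc.prems[of E] that by auto
      then show ?thesis unfolding IH(2) by auto
    qed
    with IH show ?case by auto
  qed simp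
  then show "distinct (bdedup xs)" "set (bdedup xs) = set xs" by (simp_all add: bdedup_def)
qed

text \<open>By \<open>extension_form\<close> every child is among the candidates, and the tests are
  exact since \<open>bits vs\<close> is injective on subsets of \<open>V\<close>.\<close>

lemma kids_bits:
  assumes v: "v \<notin> S" "S \<subseteq> V" "v \<in> V" and simple: "simple (insert v S) v" and T: "minimal_transversal S T"
  obtains L where
    "kids vertices (bits vs T, bits vs S # bits vs (insert v S) # Ss) = map (\<lambda>D. (D, bits vs (insert v S) # Ss)) L"
    "distinct L" "set L = bits vs ` {D. minimal_transversal (insert v S) D \<and> shrink S D vs = T}"
proof -
  let ?S = "insert v S"
  define C where "C = bcands vertices (bits vs S) (bits vs ?S) (bits vs T)"
  define F where "F = filter (\<lambda>D. bminimal_transversal vertices (bits vs ?S) D \<and>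
      bequal (bshrink vertices (bits vs S) D) (bits vs T)) C"
  have "T \<subseteq> V" "transversal S T" using T unfolding minimal_transversal_def by simp_all
  have sub: "T \<union> Z \<union> fill S ?S (T \<union> Z) \<union> W \<subseteq> V" if "Z \<in> small" "W \<in> small" for Z W
    using that \<open>T \<subseteq> V\<close> by (auto simp: small_def fill_def)
  have test: "bminimal_transversal vertices (bits vs ?S) (bits vs D) \<and>
      bequal (bshrink vertices (bits vs S) (bits vs D)) (bits vs T) \<longleftrightarrow>
      minimal_transversal ?S D \<and> shrink S D vs = T" if "D \<subseteq> V" for D
    using that \<open>T \<subseteq> V\<close> shrink_subset[of S D vs] by (simp add: bminimal_transversal_bits bshrink_bits bits_inj)
  have "set F = bits vs ` {D. minimal_transversal ?S D \<and> shrink S D vs = T}"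
  proof
    show "set F \<subseteq> bits vs ` {D. minimal_transversal ?S D \<and> shrink S D vs = T}"
    proof
      fix x assume x: "x \<in> set F"
      then obtain Z W where ZW: "Z \<in> small" "W \<in> small" "x = bits vs (T \<union> Z \<union> fill S ?S (T \<union> Z) \<union> W)"
        unfolding F_def C_def set_filter set_bcands by blast
      from x test[OF sub[OF ZW(1,2)]] ZW(3) show "x \<in> bits vs ` {D. minimal_transversal ?S D \<and>
          shrink S D vs = T}"
        unfolding F_def by simp
    qed
    show "bits vs ` {D. minimal_transversal ?S D \<and> shrink S D vs = T} \<subseteq> set F"
    proof clarify
      fix D assume D: "minimal_transversal ?S D" "T = shrink S D vs"
      then have "D \<subseteq> V" "T \<subseteq> D" using shrink_subset by (auto simp: minimal_transversal_def)
      obtain Z W where ZW: "Z \<in> small" "W \<in> small" "D = T \<union> Z \<union> fill S ?S (T \<union> Z) \<union> W"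
        using extension_form[OF v simple D(1) \<open>T \<subseteq> D\<close> \<open>transversal S T\<close>] unfolding small_def by blast
      then have "bits vs D \<in> set C" unfolding C_def set_bcands by blast
      then show "bits vs D \<in> set F" using test[OF \<open>D \<subseteq> V\<close>] D by (simp add: F_def)
    qed
  qed
  moreover have "\<exists>D. x = bits vs D" if "x \<in> set F" for x
    using that unfolding F_def C_def set_filter set_bcands by blast
  ultimately show thesis
    using that[of "bdedup F"] bdedup_bits[of F] by (simp add: kids_def F_def C_def head_def)
qed

section \<open>Chains of vertex sets and iterated parents\<close>

fun chain :: "'a set list \<Rightarrow> bool" where
  "chain [] \<longleftrightarrow> False"
| "chain [S] \<longleftrightarrow> S = V"
| "chain (S # S' # Ss) \<longleftrightarrow> S \<subseteq> V \<and> (\<exists>v\<in>V. v \<notin> S \<and> S' = insert v S \<and> simple S' v) \<and> chain (S' # Ss)"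

text \<open>The ancestor of a solution on the level of the first set, obtained by taking parents
  down from \<open>V\<close>.\<close>

fun project :: "'a set list \<Rightarrow> 'a set \<Rightarrow> 'a set" where
  "project (S # S' # Ss) D = shrink S (project (S' # Ss) D) vs"
| "project _ D = D"

text \<open>Each link adds one vertex. Starting from the empty set, the depth of the tree is thus
  the number of vertices.\<close>

lemma chain_card: "chain (S # Ss) \<Longrightarrow> card S + length Ss = card V"
proof (induction Ss arbitrary: S)
  case (Cons S' Ss)
  then obtain v where "v \<notin> S" "S' = insert v S" "S \<subseteq> V" by auto
  then have "card S' = Suc (card S)" using fin finite_subset by fastforce
  then show ?case using Cons.IH[of S'] Cons.prems by simp
qed simp

lemma minimal_transversal_project: "chain (S # Ss) \<Longrightarrow> minimal_transversal V D \<Longrightarrow>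
    minimal_transversal S (project (S # Ss) D)"
proof (induction Ss arbitrary: S)
  case (Cons S' Ss)
  then have P: "minimal_transversal S' (project (S' # Ss) D)" and "S \<subseteq> S'" by auto
  then have "transversal S (project (S' # Ss) D)" using transversal_antimono
      unfolding minimal_transversal_def by blast
  then show ?case using P set_vs by (simp add: minimal_transversal_shrink minimal_transversal_def[of S'])
qed simp

lemma distinct_concat_map:
  assumes "distinct xs" "\<And>x. x \<in> set xs \<Longrightarrow> distinct (f x)"
    "\<And>x y. x \<in> set xs \<Longrightarrow> y \<in> set xs \<Longrightarrow> x \<noteq> y \<Longrightarrow> set (f x) \<inter> set (f y) = {}"
  shows "distinct (concat (map f xs))"
  using assms
proof (induction xs)
  case (Cons x xs)
  have "set (f x) \<inter> set (f y) = {}" if "y \<in> set xs" for y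
    using Cons.prems(3)[of x y] that Cons.prems(1) by auto
  then show ?case using Cons by auto
qed simp

text \<open>A solution has just one ancestor on each level, so the subtrees of different siblings
  share no leaf; distinctness follows without comparing outputs.\<close>

lemma leaves_bits:
  "chain (S # Ss) \<Longrightarrow> minimal_transversal S T \<Longrightarrow>
    distinct (map fst (leaves (kids vertices) (length Ss) (bits vs T, map (bits vs) (S # Ss)))) \<and>
    set (map fst (leaves (kids vertices) (length Ss) (bits vs T, map (bits vs) (S # Ss)))) =
      bits vs ` {D. minimal_transversal V D \<and> project (S # Ss) D = T}"
proof (induction Ss arbitrary: S T)
  case Nil
  then have "{D. minimal_transversal V D \<and> project [S] D = T} = {T}" by auto
  then show ?case by simp
next
  case (Cons S' Ss)
  then obtain v where v: "v \<in> V" "v \<notin> S" "S' = insert v S" "S \<subseteq> V" "simple S' v" and ch: "chain (S' # Ss)"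
    by auto
  obtain L where L: "kids vertices (bits vs T, map (bits vs) (S # S' # Ss)) = map (\<lambda>D. (D, map (bits vs) (S' # Ss))) L"
    "distinct L" "set L = bits vs ` {D. minimal_transversal S' D \<and> shrink S D vs = T}"
    using kids_bits[of v S T "map (bits vs) Ss"] v Cons.prems(2) by auto
  define f where "f X = map fst (leaves (kids vertices) (length Ss) (X, map (bits vs) (S' # Ss)))" for X
  have eq: "map fst (leaves (kids vertices) (length (S' # Ss)) (bits vs T, map (bits vs) (S # S' # Ss))) = concat (map f L)"
    unfolding length_Cons leaves.simps L(1) map_concat map_map by (simp add: f_def[abs_def] o_def)
  have f: "distinct (f (bits vs D))" "set (f (bits vs D)) = bits vs ` {D'. minimal_transversal V D' \<and>
      project (S' # Ss) D' = D}"
    if "minimal_transversal S' D" for D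
    using Cons.IH[OF ch that] by (simp_all only: f_def)
  have "distinct (concat (map f L))"
  proof (rule distinct_concat_map[OF L(2)])
    fix X assume "X \<in> set L"
    then show "distinct (f X)" using L(3) f(1) by auto
  next
    fix X Y assume "X \<in> set L" "Y \<in> set L" "X \<noteq> Y"
    then obtain D E where DE: "X = bits vs D" "Y = bits vs E" "minimal_transversal S' D" "minimal_transversal S' E" "D \<noteq> E"
      using L(3) by auto
    show "set (f X) \<inter> set (f Y) = {}"
    proof (rule ccontr)
      assume "set (f X) \<inter> set (f Y) \<noteq> {}"
      then obtain D' E' where "minimal_transversal V D'" "minimal_transversal V E'" "project (S' # Ss) D' = D" "project (S' # Ss) E' = E"
        "bits vs D' = bits vs E'"
        unfolding DE(1,2) f(2)[OF DE(3)] f(2)[OF DE(4)] by blast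
      then show False using \<open>D \<noteq> E\<close> bits_inj[of D' E'] by (auto simp: minimal_transversal_def)
    qed
  qed
  moreover have "set (concat (map f L)) = bits vs ` {D. minimal_transversal V D \<and>
      project (S # S' # Ss) D = T}"
  proof -
    have "set (concat (map f L)) = (\<Union>D\<in>{D. minimal_transversal S' D \<and>
        shrink S D vs = T}. set (f (bits vs D)))"
      using L(3) by auto
    also have "\<dots> = (\<Union>D\<in>{D. minimal_transversal S' D \<and>
        shrink S D vs = T}. bits vs ` {D'. minimal_transversal V D' \<and> project (S' # Ss) D' = D})"
      using f(2) by auto
    \<comment> \<open>The ancestor on the next level is a minimal transversal there, so the union
      over the children misses no solution.\<close>
    also have "\<dots> = bits vs ` {D. minimal_transversal V D \<and> project (S # S' # Ss) D = T}"
      using minimal_transversal_project[OF ch] by auto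
    finally show ?thesis .
  qed
  ultimately show ?case unfolding eq by simp
qed

lemma beliminate_bits:
  assumes "S \<subseteq> V" "\<exists>v\<in>S. simple S v"
  obtains v where "v \<in> S" "simple S v" "beliminate vertices (bits vs S) = bits vs (S - {v})"
proof -
  \<comment> \<open>The last element that passes the test determines the value, whatever the initial
    one.\<close>
  have fold: "\<exists>u\<in>set us. c u \<and> foldl (\<lambda>R u. if c u then f u else R) R us = f u"
    if "\<exists>u\<in>set us. c u" for us :: "vertex list" and c f and R :: "bool list"
    using that by (induction us rule: rev_induct) auto
  have eq: "bhit (bits vs {v}) (bits vs S) \<and> bsimple vertices (bits vs S) (bits vs {v}, bits vs (N v)) \<longleftrightarrow>
      v \<in> S \<and> simple S v" if "v \<in> V" for v
    using that by (simp add: bhit_unit bsimple_bits del: bits_simps)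
  have "\<exists>u\<in>set vertices. bhit (fst u) (bits vs S) \<and> bsimple vertices (bits vs S) u"
    using assms eq unfolding set_vertices by fastforce
  from fold[OF this, of "\<lambda>u. bdiff (bits vs S) (fst u)" "bits vs S"]
  obtain u where u: "u \<in> set vertices" "bhit (fst u) (bits vs S) \<and> bsimple vertices (bits vs S) u"
    "beliminate vertices (bits vs S) = bdiff (bits vs S) (fst u)"
    unfolding beliminate_def by blast
  then obtain v where v: "v \<in> V" "u = (bits vs {v}, bits vs (N v))" unfolding set_vertices by blast
  show thesis using that[of v] u v eq[OF v(1)] by simp
qed

lemma border_bits:
  assumes "\<And>S. S \<subseteq> V \<Longrightarrow> S \<noteq> {} \<Longrightarrow> \<exists>v\<in>S. simple S v"
  obtains Ss where "border vertices = map (bits vs) ({} # Ss)" "chain ({} # Ss)"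
proof -
  let ?f = "\<lambda>us. foldl (\<lambda>Ss _. beliminate vertices (head Ss) # Ss) [map (\<lambda>_. True) vertices] us"
  \<comment> \<open>Every round removes one vertex; the bound on \<open>us\<close> ensures that
    \<open>S\<close> is nonempty as long as rounds remain.\<close>
  have key: "\<exists>S Ss. ?f us = map (bits vs) (S # Ss) \<and> chain (S # Ss) \<and> S \<subseteq> V \<and> card S + length us = card V"
    if "length us \<le> card V" for us :: "vertex list"
    using that
  proof (induction us rule: rev_induct)
    case Nil
    have "[map (\<lambda>_. True) vertices] = map (bits vs) [V]"
      by (simp add: vertices_def bits_def o_def flip: set_vs)
    then show ?case by (intro exI[of _ V] exI[of _ "[]"]) simp
  next
    case (snoc u us)
    then obtain S Ss where S: "?f us = map (bits vs) (S # Ss)" "chain (S # Ss)" "S \<subseteq> V" "card S +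
        length us = card V"
      by auto
    then have "card S \<noteq> 0" using snoc.prems by auto
    then have "S \<noteq> {}" by auto
    then obtain v where v: "v \<in> S" "simple S v" "beliminate vertices (bits vs S) = bits vs (S - {v})"
      using beliminate_bits[OF S(3) assms[OF S(3)]] by blast
    have "?f (us @ [u]) = map (bits vs) ((S - {v}) # S # Ss)"
      using S(1) v(3) by (simp add: head_def)
    moreover have "chain ((S - {v}) # S # Ss)"
      using v(1,2) S(2,3) by (auto simp: insert_absorb)
    moreover have "card (S - {v}) + length (us @ [u]) = card V"
      using S(4) v(1) card_Suc_Diff1[of S v] finite_subset[OF S(3) fin] by simp
    ultimately show ?case using S(3) by blast
  qed
  have "length vertices = card V"
    using distinct_card[OF distinct_vs] by (simp add: vertices_def set_vs)
  then obtain S Ss where S: "border vertices = map (bits vs) (S # Ss)" "chain (S # Ss)" "S \<subseteq> V" "card S = 0"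
    using key[of vertices] unfolding border_def by auto
  then have "S = {}" using finite_subset[OF S(3) fin] by simp
  with S that show thesis by blast
qed

end

section \<open>From graphs to search trees\<close>

definition vertices_of :: "bool list list \<Rightarrow> vertex list" where
  "vertices_of M = bzip (unit_vectors M) M"

lemma (in listed_neighbourhoods) vertices_of_bits:
  "vertices_of (map (\<lambda>u. bits vs (N u)) vs) = vertices"
  using unit_vectors_bits[OF distinct_vs, of "map (\<lambda>u. bits vs (N u)) vs"]
  by (simp add: vertices_of_def vertices_def bzip_map)


text \<open>Carries distinctness over from the leaves to the trees that are output.\<close>

lemma enc_bools_inj: "enc (xs :: bool list) = enc ys \<Longrightarrow> xs = ys"
proof (induction xs arbitrary: ys)
  case (Cons x xs)
  then obtain y ys' where "ys = y # ys'" by (cases ys) auto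
  moreover have "enc x = enc y \<Longrightarrow> x = y" for y by (cases x; cases y) auto
  ultimately show ?case using Cons by auto
qed (metis enc_list_eq_Leaf enc_simps(3))

definition adjacency :: "'a list \<Rightarrow> 'a pair_pre_digraph \<Rightarrow> bool list list" where
  "adjacency vs G = map (\<lambda>u. bits vs {v. (u, v) \<in> parcs G}) vs"

lemma enc_adjacency: "enc (adjacency vs G) = graph_val vs G"
  by (simp add: adjacency_def graph_val_def enc_list_def[of "map _ _"] enc_bits o_def)

lemma listed_neighbourhoods_graph:
  assumes "pair_graph G" "distinct vs" "set vs = pverts G"
  shows "listed_neighbourhoods (pverts G) (\<lambda>u. {v. (u, v) \<in> parcs G}) vs"
proof -
  interpret pair_graph G by fact
  show ?thesis
  proof
    show "finite (pverts G)" by (rule pair_finite_verts)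
    show "{v. (u, v) \<in> parcs G} \<subseteq> pverts G" for u
      using in_arcsD2 by auto
    show "u \<in> {w. (v, w) \<in> parcs G} \<longleftrightarrow> v \<in> {w. (u, w) \<in> parcs G}" for u v
      using arcs_symmetric by auto
  qed (use assms in auto)
qed

text \<open>The existence theorem compares neighbourhoods within \<open>S\<close> only. This is
  enough, because \<open>simple\<close> concerns vertices whose closed neighbourhoods lie in
  \<open>S\<close>; and an induced cycle within \<open>S\<close> is one of the graph.\<close>

lemma simple_vertex_in_chordal_bipartite:
  assumes cb: "chordal_bipartite G" and S: "S \<subseteq> pverts G" "S \<noteq> {}"
  shows "\<exists>v\<in>S. neighbourhoods.simple (pverts G) (\<lambda>u. {v. (u, v) \<in> parcs G}) S v"
proof -
  have "pair_graph G" using cb by (simp add: chordal_bipartite_def)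
  then interpret pair_graph G .
  obtain A B where AB: "A \<union> B = pverts G" "A \<inter> B = {}" "parcs G \<subseteq> A \<times> B \<union> B \<times> A"
    using cb unfolding chordal_bipartite_def bipartite_def by blast
  obtain vs where "distinct vs" "set vs = pverts G"
    using finite_distinct_list[OF pair_finite_verts] by blast
  then interpret listed_neighbourhoods "pverts G" "\<lambda>u. {v. (u, v) \<in> parcs G}" vs
    using listed_neighbourhoods_graph \<open>pair_graph G\<close> by blast
  interpret R: bipartite_relation "\<lambda>u v. (u, v) \<in> parcs G" A S
  proof
    show "(y, x) \<in> parcs G" if "(x, y) \<in> parcs G" for x y using that arcs_symmetric by auto
    show "x \<in> A \<longleftrightarrow> y \<notin> A" if "(x, y) \<in> parcs G" for x y using that AB by auto
    show "finite S" using S(1) pair_finite_verts by (rule finite_subset)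
  qed
  have "length c \<le> 4" if "R.induced_cycle_list c" for c
  proof (rule ccontr)
    assume "\<not> length c \<le> 4"
    then have "induced_cycle G c"
      using that S(1) unfolding R.induced_cycle_list_def induced_cycle_def by auto
    with \<open>\<not> length c \<le> 4\<close> cb show False unfolding chordal_bipartite_def by auto
  qed
  from R.simple_vertex_exists[OF this S(2)] obtain v where v: "v \<in> S"
    "\<And>u w. u \<in> S \<Longrightarrow> w \<in> S \<Longrightarrow> (v, u) \<in> parcs G \<and> (v, w) \<in> parcs G \<Longrightarrow>
      (\<forall>z\<in>S. (u, z) \<in> parcs G \<longrightarrow> (w, z) \<in> parcs G) \<or> (\<forall>z\<in>S. (w, z) \<in> parcs G \<longrightarrow> (u, z) \<in> parcs G)"
    by blast
  have "simple S v"
    unfolding simple_def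
  proof (intro ballI impI, elim conjE)
    fix u w
    assume uw: "closed_nbhd u \<subseteq> S" "v \<in> {v. (u, v) \<in> parcs G}" "closed_nbhd w \<subseteq> S" "v \<in> {v. (w, v) \<in> parcs G}"
    then have "u \<in> S" "w \<in> S" "(v, u) \<in> parcs G \<and> (v, w) \<in> parcs G"
      using R.sym by (auto simp: closed_nbhd_def)
    from v(2)[OF this] show "{v. (u, v) \<in> parcs G} \<subseteq> {v. (w, v) \<in> parcs G} \<or>
        {v. (w, v) \<in> parcs G} \<subseteq> {v. (u, v) \<in> parcs G}"
      using uw(1,3) by (auto simp: closed_nbhd_def)
  qed
  with v(1) show ?thesis by blast
qed

text \<open>Supersets of transversals are transversals, so irredundance of single vertices amounts
  to inclusion-wise minimality.\<close>

lemma (in listed_neighbourhoods) minimal_dominating_set_iff: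
  assumes "V = pverts G" "N = (\<lambda>u. {v. (u, v) \<in> parcs G})"
  shows "minimal_dominating_set G D \<longleftrightarrow> minimal_transversal V D"
proof -
  have dom: "dominating_set G D \<longleftrightarrow> D \<subseteq> V \<and> transversal V D" for D
  proof -
    have iff: "v \<in> D \<or> (\<exists>u\<in>D. (u, v) \<in> parcs G) \<longleftrightarrow> closed_nbhd v \<inter> D \<noteq> {}" if "v \<in> V" "D \<subseteq> V" for v
    proof -
      have "(u, v) \<in> parcs G \<longleftrightarrow> u \<in> N v" if "u \<in> D" for u
        using N_sym[of v u] \<open>v \<in> V\<close> \<open>D \<subseteq> V\<close> that assms(2) by auto
      then show ?thesis unfolding closed_nbhd_def by auto
    qed
    show ?thesis
    proof (cases "D \<subseteq> V")
      case True
      then have "(\<forall>v\<in>V. v \<in> D \<or> (\<exists>u\<in>D. (u, v) \<in> parcs G)) \<longleftrightarrow> (\<forall>v\<in>V. closed_nbhd v \<inter> D \<noteq> {})"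
        by (intro ball_cong refl iff)
      moreover have "transversal V D \<longleftrightarrow> (\<forall>v\<in>V. closed_nbhd v \<inter> D \<noteq> {})"
        unfolding transversal_def using closed_nbhd_subset by (intro ball_cong refl) simp
      ultimately show ?thesis
        unfolding dominating_set_def assms(1)[symmetric] by simp
    qed (simp add: dominating_set_def flip: assms(1))
  qed
  show ?thesis
  proof
    assume D: "minimal_dominating_set G D"
    then have "D \<subseteq> V" "transversal V D" using dom unfolding minimal_dominating_set_def by blast+
    moreover have "\<not> transversal V (D - {x})" if "x \<in> D" for x
    proof
      assume "transversal V (D - {x})"
      then have "dominating_set G (D - {x})" using dom \<open>D \<subseteq> V\<close> by blast
      with D that show False unfolding minimal_dominating_set_def by blast
    qed
    ultimately show "minimal_transversal V D" unfolding minimal_transversal_def by simp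
  next
    assume D: "minimal_transversal V D"
    then have "dominating_set G D" using dom unfolding minimal_transversal_def by simp
    moreover have "\<not> dominating_set G D'" if "D' \<subset> D" for D'
      using minimal_transversal_subset_eq[OF D, of D'] dom that by auto
    ultimately show "minimal_dominating_set G D" unfolding minimal_dominating_set_def by blast
  qed
qed

text \<open>A node stores vectors only; the vertex sets, neighbourhoods and listing behind them are
  recovered existentially. Chordality is reflected in the chain of simple vertices.\<close>

definition good_node :: "bool list list \<Rightarrow> nat \<Rightarrow> node \<Rightarrow> bool" where
  "good_node M h x \<longleftrightarrow> (\<exists>V N (vs :: nat list) S Ss T. listed_neighbourhoods V N vs \<and>
     M = map (\<lambda>u. bits vs (N u)) vs \<and> listed_neighbourhoods.chain V N (S # Ss) \<and>
     neighbourhoods.minimal_transversal V N S T \<and> h = length Ss \<and> x = (bits vs T, map (bits vs) (S # Ss)))"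

text \<open>The existence of a child is \<open>extension_exists\<close> for the next vertex of the
  chain.\<close>

lemma good_node_kids:
  assumes "good_node M (Suc h) x"
  shows "kids (vertices_of M) x \<noteq> [] \<and> (\<forall>y \<in> set (kids (vertices_of M) x). good_node M h y)"
proof -
  obtain V N and vs :: "nat list" and S Ss' T where l: "listed_neighbourhoods V N vs"
    and x: "M = map (\<lambda>u. bits vs (N u)) vs" "listed_neighbourhoods.chain V N (S # Ss')"
      "neighbourhoods.minimal_transversal V N S T" "Suc h = length Ss'" "x = (bits vs T, map (bits vs) (S # Ss'))"
    using assms unfolding good_node_def by blast
  interpret listed_neighbourhoods V N vs by fact
  obtain S' Ss where Ss': "Ss' = S' # Ss" "h = length Ss" using x(4) by (cases Ss') auto
  obtain v where v: "v \<in> V" "v \<notin> S" "S' = insert v S" "S \<subseteq> V" "simple S' v" and ch: "chain (S' # Ss)"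
    using x(2) Ss' by auto
  have M: "vertices_of M = vertices" unfolding x(1) by (rule vertices_of_bits)
  obtain L where "kids vertices (bits vs T, bits vs S # bits vs (insert v S) # map (bits vs) Ss) =
      map (\<lambda>D. (D, bits vs (insert v S) # map (bits vs) Ss)) L"
    "set L = bits vs ` {D. minimal_transversal (insert v S) D \<and> shrink S D vs = T}"
    by (rule kids_bits[OF v(2,4,1) v(5)[unfolded v(3)] x(3), of "map (bits vs) Ss"])
  then have L: "kids vertices (bits vs T, map (bits vs) (S # S' # Ss)) = map (\<lambda>D. (D, map (bits vs) (S' # Ss))) L"
    "set L = bits vs ` {D. minimal_transversal S' D \<and> shrink S D vs = T}"
    by (simp_all add: v(3))
  have kids: "kids (vertices_of M) x = map (\<lambda>D. (D, map (bits vs) (S' # Ss))) L"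
    using L(1) by (simp add: M x(5) Ss')
  have "L \<noteq> []" using extension_exists[OF v(2,1) x(3) set_vs] L(2) v(3) by auto
  moreover have "good_node M h y" if y: "y \<in> set (kids (vertices_of M) x)" for y
  proof -
    obtain D where "minimal_transversal S' D" "y = (bits vs D, map (bits vs) (S' # Ss))"
      using y L(2) unfolding kids by auto
    then show ?thesis
      unfolding good_node_def using l x(1) ch Ss'(2)
      by (intro exI[of _ V] exI[of _ N] exI[of _ vs] exI[of _ S'] exI[of _ Ss] exI[of _ D]) simp
  qed
  ultimately show ?thesis unfolding kids by simp
qed

lemma size_good_node:
  assumes "good_node M h x"
  shows "size (enc x) \<le> Suc (2 * length M + Suc (length M) * Suc (2 * length M))"
proof -
  obtain V N and vs :: "nat list" and S Ss T where l: "listed_neighbourhoods V N vs"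
    and x: "M = map (\<lambda>u. bits vs (N u)) vs" "listed_neighbourhoods.chain V N (S # Ss)"
      "x = (bits vs T, map (bits vs) (S # Ss))"
    using assms unfolding good_node_def by blast
  interpret listed_neighbourhoods V N vs by fact
  have len: "length M = length vs" by (simp add: x(1))
  have size: "size (enc (bits vs D)) \<le> 2 * length M" for D
    using size_enc_bools[of "bits vs D"] by (simp add: bits_def len)
  \<comment> \<open>The chain adds one vertex per link, and the matrix has one row per
    vertex.\<close>
  have "length Ss \<le> length M"
    using chain_card[OF x(2)] distinct_card[OF distinct_vs] by (simp add: len set_vs)
  then have "size (enc (map (bits vs) (S # Ss))) \<le> Suc (length M) * Suc (2 * length M)"
    by (intro size_enc_list_le) (use size in auto)
  with size[of T] show ?thesis unfolding x(3) enc_simps by simp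
qed

lemma good_node_final: "good_node M h x \<Longrightarrow> tl (snd x) = [] \<longleftrightarrow> h = 0"
  unfolding good_node_def by auto

definition root_node :: "bool list list \<Rightarrow> node" where
  "root_node M = (map (\<lambda>_. False) M, border (vertices_of M))"

lemma chordal_bipartite_root:
  fixes G :: "nat pair_pre_digraph"
  assumes cb: "chordal_bipartite G" and vs: "distinct vs" "set vs = pverts G"
  defines "M \<equiv> adjacency vs G"
  shows "good_node M (length M) (root_node M)"
    and "distinct (map fst (leaves (kids (vertices_of M)) (length M) (root_node M)))"
    and "set (map fst (leaves (kids (vertices_of M)) (length M) (root_node M))) =
      bits vs ` {D. minimal_dominating_set G D}"
proof -
  let ?N = "\<lambda>u. {v. (u, v) \<in> parcs G}"
  have l: "listed_neighbourhoods (pverts G) ?N vs"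
    using cb vs by (intro listed_neighbourhoods_graph) (simp_all add: chordal_bipartite_def)
  interpret listed_neighbourhoods "pverts G" ?N vs by (rule l)
  have M: "M = map (\<lambda>u. bits vs (?N u)) vs" by (simp add: M_def adjacency_def)
  have vM: "vertices_of M = vertices" unfolding M by (rule vertices_of_bits)
  obtain Ss where Ss: "border vertices = map (bits vs) ({} # Ss)" "chain ({} # Ss)"
    by (rule border_bits[OF simple_vertex_in_chordal_bipartite[OF cb]])
  have root: "root_node M = (bits vs {}, map (bits vs) ({} # Ss))"
    unfolding root_node_def vM Ss(1) by (simp add: M bits_def)
  \<comment> \<open>Every edge contains its centre, so none lies inside the empty set. The root is
    therefore the only node of its level and an ancestor of all solutions.\<close>
  have empty: "minimal_transversal {} D \<longleftrightarrow> D = {}" for D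
    by (auto simp: minimal_transversal_def transversal_def closed_nbhd_def)
  have len: "length Ss = length M"
    using chain_card[OF Ss(2)] distinct_card[OF distinct_vs] by (simp add: M set_vs)
  show "good_node M (length M) (root_node M)"
    unfolding good_node_def using l M Ss(2) empty len root
    by (intro exI[of _ "pverts G"] exI[of _ ?N] exI[of _ vs] exI[of _ "{}"] exI[of _ Ss]) simp
  have "{D. minimal_transversal (pverts G) D \<and> project ({} # Ss) D = {}} = {D. minimal_dominating_set G D}"
  proof (rule Collect_cong)
    fix D
    show "minimal_transversal (pverts G) D \<and> project ({} # Ss) D = {} \<longleftrightarrow> minimal_dominating_set G D"
      using minimal_transversal_project[OF Ss(2), of D]
          unfolding empty minimal_dominating_set_iff[OF refl refl] by blast
  qed
  with leaves_bits[OF Ss(2), of "{}"] empty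
  show "distinct (map fst (leaves (kids (vertices_of M)) (length M) (root_node M)))"
    and "set (map fst (leaves (kids (vertices_of M)) (length M) (root_node M))) =
      bits vs ` {D. minimal_dominating_set G D}"
    unfolding vM root len by simp_all
qed

theorem theorem18:
  shows "\<exists>P. enumerates_poly_delay_poly_space P chordal_bipartite_domination"
proof (rule dfs_enumeration[where root = root_node and env = vertices_of and kids = kids and out = fst
      and final = "\<lambda>x. tl (snd x) = []" and depth = length and good = good_node
      and B = "\<lambda>M. Suc (2 * length M + Suc (length M) * Suc (2 * length M))"
      and I = "{adjacency vs G | vs (G :: nat pair_pre_digraph).
        chordal_bipartite G \<and> distinct vs \<and> set vs = pverts G}"])
  show env: "polytime vertices_of"
    unfolding vertices_of_def[abs_def] by (intro polytime_bzip polytime_unit_vectors polytime_id)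
  show "polytime root_node"
    unfolding root_node_def[abs_def] by (intro polytime_Pair polytime_map polytime_const polytime_id
        polytime_border env)
  show "polytime (\<lambda>p. kids (fst p) (snd p))" by (rule polytime_kids)
  show "polytime (\<lambda>x :: node. tl (snd x) = [])" "polytime (fst :: node \<Rightarrow> _)" by (intro polytime_intros)+
  show pb: "poly_bounded (length :: bool list list \<Rightarrow> _)"
    by (rule poly_bounded_le[OF poly_bounded_size_enc length_le_size_enc])
  show "poly_bounded (\<lambda>M :: bool list list. Suc (2 * length M + Suc (length M) * Suc (2 * length M)))"
    by (intro poly_bounded_intros pb)
  fix M v sol
  assume "(v, sol) \<in> chordal_bipartite_domination"
  then obtain vs
      and G :: "nat pair_pre_digraph" where G: "chordal_bipartite G" "distinct vs" "set vs = pverts G"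
    "v = graph_val vs G" "sol = set_val vs ` {D. minimal_dominating_set G D}"
    unfolding chordal_bipartite_domination_def by blast
  let ?M = "adjacency vs G"
  let ?L = "map fst (leaves (kids (vertices_of ?M)) (length ?M) (root_node ?M))"
  have L: "distinct ?L" "set ?L = bits vs ` {D. minimal_dominating_set G D}"
    using chordal_bipartite_root(2,3)[OF G(1-3)] .
  have eq: "map (\<lambda>y. enc (fst y)) (leaves (kids (vertices_of ?M)) (length ?M) (root_node ?M)) = map enc ?L"
    by simp
  have "inj_on enc (set ?L)" using enc_bools_inj by (rule inj_onI)
  then have "distinct (map enc ?L)" using L(1) unfolding distinct_map by (rule conjI[rotated])
  moreover have "sol = set (map enc ?L)"
    unfolding set_map[of enc] L(2) G(5) by (simp add: image_image enc_bits)
  moreover have "v = enc ?M" by (simp only: G(4) enc_adjacency)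
  moreover have "?M \<in> {adjacency vs G | vs (G :: nat pair_pre_digraph).
        chordal_bipartite G \<and> distinct vs \<and> set vs = pverts G}" using G(1-3) by blast
  ultimately show "\<exists>M\<in>{adjacency vs G | vs (G :: nat pair_pre_digraph).
        chordal_bipartite G \<and> distinct vs \<and> set vs = pverts G}. v = enc M \<and>
      distinct (map (\<lambda>y. enc (fst y)) (leaves (kids (vertices_of M)) (length M) (root_node M))) \<and>
      sol = set (map (\<lambda>y. enc (fst y)) (leaves (kids (vertices_of M)) (length M) (root_node M)))"
    unfolding eq[symmetric] by (intro bexI[of _ ?M] conjI)
next
  fix M
  assume "M \<in> {adjacency vs G | vs (G :: nat pair_pre_digraph).
    chordal_bipartite G \<and> distinct vs \<and> set vs = pverts G}"
  then show "good_node M (length M) (root_node M)"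
    by (elim CollectE exE conjE) (simp only: chordal_bipartite_root(1))
next
  fix M h x
  assume "good_node M h x"
  then show "size (enc x) \<le> Suc (2 * length M + Suc (length M) * Suc (2 * length M))"
    and "tl (snd x) = [] \<longleftrightarrow> h = 0"
    by (rule size_good_node, rule good_node_final)
next
  fix M h x
  assume "good_node M (Suc h) x"
  then show "kids (vertices_of M) x \<noteq> [] \<and> (\<forall>y \<in> set (kids (vertices_of M) x). good_node M h y)"
    by (rule good_node_kids)
qed

end
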